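(* Let $P:\mathbb{C}^{\mathrm{op}}\to\mathbf{Pos}$ be an implicational existential doctrine with a small base category $\mathbb{C}$. Then the doctrine $\underrightarrow{P}:\underline{\mathbb{C}}^{\mathrm{op}}\to\mathbf{Pos}$ constructed from $P$ as described in the context is rich.
   Context: **Doctrines.** $\mathbf{Pos}$ is the category of posets and monotone maps. A doctrine is a functor $P:\mathbb{C}^{\mathrm{op}}\to\mathbf{Pos}$ where $\mathbb{C}$ (the base category) has finite products; $\mathbf{t}$ is the terminal object, $!_A:A\to\mathbf{t}$ the unique arrow, $P(A)$ a fiber, $P(f)$ a reindexing. $P$ is primary if every $P(A)$ has finite meets (including $\top$), preserved by reindexings. $P$ is implicational if every $P(A)$ has finite meets and a Heyting implication $\to$ (i.e. $P(A)$ is cartesian closed), all preserved by reindexings. A primary doctrine $P$ is existential if for all objects $B,C$ the map $P(\mathrm{pr}_1):P(C)\to P(C\times B)$ has a left adjoint $\exists^B_C$ satisfying Beck–Chevalley ($\exists^B_C P(f\times \mathrm{id}_B)=P(f)\exists^B_{C'}$ for all $f:C\to C'$) and Frobenius reciprocity ($\exists^B_C(\alpha\wedge P(\mathrm{pr}_1)\beta)=\exists^B_C(\alpha)\wedge\beta$). **Rich.** An existential doctrine $R:\mathbb{D}^{\mathrm{op}}\to\mathbf{Pos}$ is rich if for every object $A$ of $\mathbb{D}$ and every $\sigma\in R(A)$ there is an arrow $d:\mathbf{t}\to A$ in $\mathbb{D}$ with $\exists^A_{\mathbf{t}}\sigma\le R(d)\sigma$. **Construction of $\underline{P}$.** Let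 $P$ be implicational existential with $\mathbb{C}$ small. Let $\Lambda$ be the cardinality of $\bigsqcup_{X\in\mathrm{ob}\,\mathbb{C}}P(X)$, regarded as an initial ordinal. Let $J$ be the set of finite lists (including the empty list) of pairwise distinct elements of $\mathrm{ob}\,\mathbb{C}\times\Lambda$, preordered by inclusion of the sets of entries. For $\bar X=((X_1,x_1),\dots,(X_n,x_n))\in J$ write $\Pi\bar X=X_1\times\dots\times X_n$ (terminal if $\bar X=\emptyset$; $\mathbf{t}\times A$ is identified with $A$). For $\bar X\le\bar Y$ let $\pi_{\bar Y\bar X}:\Pi\bar Y\to\Pi\bar X$ be the map whose $i$-th component is the projection onto the factor given by the unique entry of $\bar Y$ equal to $(X_i,x_i)$. The category $\underline{\mathbb{C}}$ has the objects of $\mathbb{C}$; an arrow $A\dashrightarrow B$ is a class $[f,\bar X]$ with $\bar X\in J$ and $f:\Pi\bar X\times A\to B$ in $\mathbb{C}$, where $[f,\bar X]=[f',\bar Y]$ iff there is $\bar Z\ge\bar X,\bar Y$ with $f\circ(\pi_{\bar Z\bar X}\times\mathrm{id}_A)=f'\circ(\pi_{\bar Z\bar Y}\times\mathrm{id}_A)$; composition is computed over a common list by $[g,\bar Z]\circ[f,\bar Z]=[g\circ\langle\mathrm{pr}_{\Pi\bar Z},f\rangle,\bar Z]$. The doctrine $\underline{P}:\underline{\mathbb{C}}^{\mathrm{op}}\to\mathbf{Pos}$ has as elements of $\underline{P}(A)$ the classes $[\alpha,\bar X]$ with $\alpha\in P(\Pi\bar X\times A)$, where $[\alpha,\bar X]\le[\beta,\bar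 Y]$ (resp. $=$) iff there is $\bar Z\ge\bar X,\bar Y$ with $P(\pi_{\bar Z\bar X}\times\mathrm{id}_A)\alpha\le P(\pi_{\bar Z\bar Y}\times\mathrm{id}_A)\beta$ (resp. $=$) in $P(\Pi\bar Z\times A)$; reindexing over a common list is $\underline{P}([f,\bar Z])[\beta,\bar Z]=[P(\langle\mathrm{pr}_{\Pi\bar Z},f\rangle)\beta,\bar Z]$. It is the directed colimit over $J$ of the doctrines obtained by adding to $P$ a constant of sort $\Pi\bar X$; it is implicational and existential, with operations computed over a common list and $\underline{\exists}^B_A[\varphi,\bar X]=[\exists^B_{\Pi\bar X\times A}\varphi,\bar X]$. **Construction of $\underrightarrow{P}$.** For each object $B$ fix a listing $([\varphi^B_j,\bar X^{(B,j)}])_{j\in\Lambda}$ (repetitions allowed) of all elements of $\underline{P}(B)$, with fixed representatives $\bar X^{(B,j)}=((X_1^{(B,j)},x_1^{(B,j)}),\dots,(X_{n}^{(B,j)},x_{n}^{(B,j)}))\in J$, $n=n^{(B,j)}$, and $\varphi^B_j\in P(\Pi\bar X^{(B,j)}\times B)$. Define recursively $d^B_j$ as the smallest ordinal strictly greater than all $d^B_h$ with $h<j$ and than all $x_a^{(B,k)}$ with $k\le j$, $1\le a\le n^{(B,k)}$; the listings are assumed chosen so that all $d^B_j\in\Lambda$. Let $\bar X^{(B,j)}_\star\in J$ be $\bar X^{(B,j)}$ with $(B,d^B_j)$ appended, let $\psi^B_j=\big(P(\mathrm{pr}_1)\exists^B_{\Pi\bar X^{(B,j)}}\varphi^B_j\to\varphi^B_j\big)\in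 P(\Pi\bar X^{(B,j)}\times B)$ with $\mathrm{pr}_1:\Pi\bar X^{(B,j)}\times B\to\Pi\bar X^{(B,j)}$, and consider $[\psi^B_j,\bar X^{(B,j)}_\star]\in\underline{P}(\mathbf{t})$. For a finite set $\mathcal{U}\subseteq\mathrm{ob}\,\mathbb{C}\times\Lambda$ put $\psi_{\mathcal{U}}=\bigwedge_{(B,j)\in\mathcal{U}}[\psi^B_j,\bar X^{(B,j)}_\star]\in\underline{P}(\mathbf{t})$. The doctrine $\underrightarrow{P}:\underline{\mathbb{C}}^{\mathrm{op}}\to\mathbf{Pos}$ has as elements of $\underrightarrow{P}(A)$ the classes $[a,\mathcal{U}]$ with $\mathcal{U}$ finite and $a\in\underline{P}(A)$, $a\le\underline{P}(!_A)\psi_{\mathcal{U}}$, where $[a,\mathcal{U}]\le[b,\mathcal{V}]$ (resp. $=$) iff there is a finite $\mathcal{W}\supseteq\mathcal{U}\cup\mathcal{V}$ with $a\wedge\underline{P}(!_A)\psi_{\mathcal{W}}\le b\wedge\underline{P}(!_A)\psi_{\mathcal{W}}$ (resp. $=$) in $\underline{P}(A)$; reindexing is induced by that of $\underline{P}$. It is the directed colimit of the doctrines obtained from $\underline{P}$ by adding the axiom $\psi_{\mathcal{U}}$; it is implicational and existential, with existential quantifier $\underrightarrow{\exists}$ induced by that of $\underline{P}$. *)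

theory Defs
  imports "HOL-Algebra.Galois_Connection"
begin

section \<open>Categories with chosen finite products\<close>

text \<open>Objects and arrows form sets, so these categories are small.\<close>

record ('o, 'm) fpcat =
  Ob  :: "'o set"
  Ar  :: "'m set"
  Dom :: "'m \<Rightarrow> 'o"
  Cod :: "'m \<Rightarrow> 'o"
  Idt :: "'o \<Rightarrow> 'm"
  Cmp :: "'m \<Rightarrow> 'm \<Rightarrow> 'm" (infixr \<open>\<cdot>\<index>\<close> 75)
  Trm :: "'o"
  Prd :: "'o \<Rightarrow> 'o \<Rightarrow> 'o"
  Pr1 :: "'o \<Rightarrow> 'o \<Rightarrow> 'm"
  Pr2 :: "'o \<Rightarrow> 'o \<Rightarrow> 'm"

definition hom :: "('o, 'm) fpcat \<Rightarrow> 'o \<Rightarrow> 'o \<Rightarrow> 'm set" where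
  "hom C A B = {f \<in> Ar C. Dom C f = A \<and> Cod C f = B}"

locale fp_category =
  fixes C :: "('o, 'm) fpcat" (structure)
  assumes Dom_Ob: "f \<in> Ar C \<Longrightarrow> Dom C f \<in> Ob C"
    and Cod_Ob: "f \<in> Ar C \<Longrightarrow> Cod C f \<in> Ob C"
    and Idt_hom: "A \<in> Ob C \<Longrightarrow> Idt C A \<in> hom C A A"
    and Cmp_hom: "\<lbrakk>f \<in> hom C A B; g \<in> hom C B D\<rbrakk> \<Longrightarrow> g \<cdot> f \<in> hom C A D"
    and Cmp_assoc: "\<lbrakk>f \<in> hom C A B; g \<in> hom C B D; h \<in> hom C D E\<rbrakk>
          \<Longrightarrow> h \<cdot> (g \<cdot> f) = (h \<cdot> g) \<cdot> f"
    and Cmp_Idt_left: "f \<in> hom C A B \<Longrightarrow> Idt C B \<cdot> f = f"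
    and Cmp_Idt_right: "f \<in> hom C A B \<Longrightarrow> f \<cdot> Idt C A = f"
    and Trm_Ob: "Trm C \<in> Ob C"
    and Trm_universal: "A \<in> Ob C \<Longrightarrow> \<exists>!f. f \<in> hom C A (Trm C)"
    and Prd_Ob: "\<lbrakk>A \<in> Ob C; B \<in> Ob C\<rbrakk> \<Longrightarrow> Prd C A B \<in> Ob C"
    and Pr1_hom: "\<lbrakk>A \<in> Ob C; B \<in> Ob C\<rbrakk> \<Longrightarrow> Pr1 C A B \<in> hom C (Prd C A B) A"
    and Pr2_hom: "\<lbrakk>A \<in> Ob C; B \<in> Ob C\<rbrakk> \<Longrightarrow> Pr2 C A B \<in> hom C (Prd C A B) B"
    and Prd_universal: "\<lbrakk>f \<in> hom C Z A; g \<in> hom C Z B\<rbrakk>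
          \<Longrightarrow> \<exists>!h. h \<in> hom C Z (Prd C A B) \<and> Pr1 C A B \<cdot> h = f \<and> Pr2 C A B \<cdot> h = g"

definition bang :: "('o, 'm) fpcat \<Rightarrow> 'o \<Rightarrow> 'm" where
  "bang C A = (THE f. f \<in> hom C A (Trm C))"

definition pairing :: "('o, 'm) fpcat \<Rightarrow> 'm \<Rightarrow> 'm \<Rightarrow> 'm" where
  "pairing C f g = (THE h. h \<in> hom C (Dom C f) (Prd C (Cod C f) (Cod C g))
      \<and> Pr1 C (Cod C f) (Cod C g) \<cdot>\<^bsub>C\<^esub> h = f
      \<and> Pr2 C (Cod C f) (Cod C g) \<cdot>\<^bsub>C\<^esub> h = g)"

definition cross :: "('o, 'm) fpcat \<Rightarrow> 'm \<Rightarrow> 'm \<Rightarrow> 'm" where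
  "cross C f g = pairing C (f \<cdot>\<^bsub>C\<^esub> Pr1 C (Dom C f) (Dom C g))
                           (g \<cdot>\<^bsub>C\<^esub> Pr2 C (Dom C f) (Dom C g))"


section \<open>Doctrines\<close>

record ('o, 'm, 'p) doctrine_data =
  base :: "('o, 'm) fpcat"
  fib  :: "'o \<Rightarrow> 'p gorder"
  rei  :: "'m \<Rightarrow> 'p \<Rightarrow> 'p"

locale doctrine =
  fixes P :: "('o, 'm, 'p) doctrine_data"
  assumes base_fp_category: "fp_category (base P)"
    and fib_poset: "A \<in> Ob (base P) \<Longrightarrow> partial_order (fib P A)"
    and rei_carrier: "f \<in> hom (base P) A B \<Longrightarrow> rei P f \<in> carrier (fib P B) \<rightarrow> carrier (fib P A)"
    and rei_monotone: "f \<in> hom (base P) A B \<Longrightarrow> isotone (fib P B) (fib P A) (rei P f)"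
    and rei_Idt: "\<lbrakk>A \<in> Ob (base P); a \<in> carrier (fib P A)\<rbrakk> \<Longrightarrow> rei P (Idt (base P) A) a = a"
    and rei_Cmp: "\<lbrakk>f \<in> hom (base P) A B; g \<in> hom (base P) B D; a \<in> carrier (fib P D)\<rbrakk>
          \<Longrightarrow> rei P (g \<cdot>\<^bsub>base P\<^esub> f) a = rei P f (rei P g a)"

locale primary_doctrine = doctrine +
  assumes fib_top: "A \<in> Ob (base P) \<Longrightarrow> weak_partial_order_top (fib P A)"
    and fib_meet: "A \<in> Ob (base P) \<Longrightarrow> lower_semilattice (fib P A)"
    and rei_top: "f \<in> hom (base P) A B \<Longrightarrow> rei P f \<top>\<^bsub>fib P B\<^esub> = \<top>\<^bsub>fib P A\<^esub>"
    and rei_meet: "\<lbrakk>f \<in> hom (base P) A B; a \<in> carrier (fib P B); b \<in> carrier (fib P B)\<rbrakk>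
          \<Longrightarrow> rei P f (a \<sqinter>\<^bsub>fib P B\<^esub> b) = rei P f a \<sqinter>\<^bsub>fib P A\<^esub> rei P f b"

definition is_himp :: "'p gorder \<Rightarrow> 'p \<Rightarrow> 'p \<Rightarrow> 'p \<Rightarrow> bool" where
  "is_himp L a b c \<longleftrightarrow> c \<in> carrier L \<and>
     (\<forall>x\<in>carrier L. x \<sqinter>\<^bsub>L\<^esub> a \<sqsubseteq>\<^bsub>L\<^esub> b \<longleftrightarrow> x \<sqsubseteq>\<^bsub>L\<^esub> c)"

definition himp :: "'p gorder \<Rightarrow> 'p \<Rightarrow> 'p \<Rightarrow> 'p" where
  "himp L a b = (THE c. is_himp L a b c)"

locale implicational_doctrine = primary_doctrine +
  assumes himp_exists: "\<lbrakk>A \<in> Ob (base P); a \<in> carrier (fib P A); b \<in> carrier (fib P A)\<rbrakk>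
          \<Longrightarrow> \<exists>c. is_himp (fib P A) a b c"
    and rei_himp: "\<lbrakk>f \<in> hom (base P) A B; a \<in> carrier (fib P B); b \<in> carrier (fib P B)\<rbrakk>
          \<Longrightarrow> rei P f (himp (fib P B) a b) = himp (fib P A) (rei P f a) (rei P f b)"

text \<open>\<open>exq P B C\<close> is the quantifier $\exists^B_C$, the value at each element of the left
  adjoint to reindexing along the first projection from \<open>C \<times> B\<close>. That it is indeed a left
  adjoint is part of \<open>existential_doctrine\<close>.\<close>

definition exq :: "('o, 'm, 'p) doctrine_data \<Rightarrow> 'o \<Rightarrow> 'o \<Rightarrow> 'p \<Rightarrow> 'p" where
  "exq P B C \<phi> = (THE e. e \<in> carrier (fib P C) \<and>
     (\<forall>\<beta>\<in>carrier (fib P C). e \<sqsubseteq>\<^bsub>fib P C\<^esub> \<beta>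
        \<longleftrightarrow> \<phi> \<sqsubseteq>\<^bsub>fib P (Prd (base P) C B)\<^esub> rei P (Pr1 (base P) C B) \<beta>))"

locale existential_doctrine = primary_doctrine +
  assumes exq_left_adjoint: "\<lbrakk>B \<in> Ob (base P); C \<in> Ob (base P)\<rbrakk> \<Longrightarrow>
      galois_connection \<lparr>orderA = fib P (Prd (base P) C B), orderB = fib P C,
                         lower = exq P B C, upper = rei P (Pr1 (base P) C B)\<rparr>"
    and beck_chevalley: "\<lbrakk>B \<in> Ob (base P); f \<in> hom (base P) C C';
        \<phi> \<in> carrier (fib P (Prd (base P) C' B))\<rbrakk> \<Longrightarrow>
      exq P B C (rei P (cross (base P) f (Idt (base P) B)) \<phi>) = rei P f (exq P B C' \<phi>)"
    and frobenius: "\<lbrakk>B \<in> Ob (base P); C \<in> Ob (base P);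
        \<alpha> \<in> carrier (fib P (Prd (base P) C B)); \<beta> \<in> carrier (fib P C)\<rbrakk> \<Longrightarrow>
      exq P B C (\<alpha> \<sqinter>\<^bsub>fib P (Prd (base P) C B)\<^esub> rei P (Pr1 (base P) C B) \<beta>)
        = exq P B C \<alpha> \<sqinter>\<^bsub>fib P C\<^esub> \<beta>"

text \<open>The second projection \<open>\<t> \<times> A \<rightarrow> A\<close> realises the identification of \<open>\<t> \<times> A\<close> with \<open>A\<close>.\<close>

locale rich_doctrine = existential_doctrine R for R +
  assumes rich: "\<lbrakk>A \<in> Ob (base R); \<sigma> \<in> carrier (fib R A)\<rbrakk> \<Longrightarrow>
      \<exists>d \<in> hom (base R) (Trm (base R)) A.
        exq R A (Trm (base R)) (rei R (Pr2 (base R) (Trm (base R)) A) \<sigma>)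
          \<sqsubseteq>\<^bsub>fib R (Trm (base R))\<^esub> rei R d \<sigma>"


section \<open>Adding constants\<close>

text \<open>The initial ordinal $\Lambda$ is represented by a cardinal well-order whose field is the
  disjoint union of the fibres itself, so the ordinals below $\Lambda$ are the elements of
  that field.\<close>

type_synonym ('o, 'p) ordl = "'o \<times> 'p"
type_synonym ('o, 'p) ctx = "('o \<times> ('o, 'p) ordl) list"

definition Lam :: "('o, 'm, 'p) doctrine_data \<Rightarrow> ('o, 'p) ordl rel" where
  "Lam P = card_of (SIGMA X : Ob (base P). carrier (fib P X))"

definition ctxs :: "('o, 'm, 'p) doctrine_data \<Rightarrow> ('o, 'p) ctx set" where
  "ctxs P = {xs. distinct xs \<and> set xs \<subseteq> Ob (base P) \<times> Field (Lam P)}"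

text \<open>Products of lists associate to the left and start from the terminal object, so that
  \<open>lprod C (xs @ [(X, x)]) = Prd C (lprod C xs) X\<close>.\<close>

definition lprod :: "('o, 'm) fpcat \<Rightarrow> ('o \<times> 'l) list \<Rightarrow> 'o" where
  "lprod C xs = foldl (\<lambda>A x. Prd C A (fst x)) (Trm C) xs"

primrec entry_proj_rev :: "('o, 'm) fpcat \<Rightarrow> ('o \<times> 'l) list \<Rightarrow> 'o \<times> 'l \<Rightarrow> 'm" where
  "entry_proj_rev C [] e = undefined"
| "entry_proj_rev C (x # r) e =
     (if x = e then Pr2 C (lprod C (rev r)) (fst x)
      else entry_proj_rev C r e \<cdot>\<^bsub>C\<^esub> Pr1 C (lprod C (rev r)) (fst x))"

text \<open>\<open>entry_proj C xs e\<close> is the projection from \<open>lprod C xs\<close> onto the factor given by the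
  entry \<open>e\<close> of \<open>xs\<close>; \<open>ctx_proj C ys xs\<close> is $\pi_{\bar Y\bar X}$, the tuple of the projections of
  \<open>lprod C ys\<close> onto the entries of \<open>xs\<close>; and \<open>weak C A ys xs\<close> is $\pi_{\bar Y\bar X}\times\mathrm{id}_A$.\<close>

definition entry_proj :: "('o, 'm) fpcat \<Rightarrow> ('o \<times> 'l) list \<Rightarrow> 'o \<times> 'l \<Rightarrow> 'm" where
  "entry_proj C xs e = entry_proj_rev C (rev xs) e"

definition ctx_proj :: "('o, 'm) fpcat \<Rightarrow> ('o \<times> 'l) list \<Rightarrow> ('o \<times> 'l) list \<Rightarrow> 'm" where
  "ctx_proj C ys xs = foldl (\<lambda>u e. pairing C u (entry_proj C ys e)) (bang C (lprod C ys)) xs"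

definition weak :: "('o, 'm) fpcat \<Rightarrow> 'o \<Rightarrow> ('o \<times> 'l) list \<Rightarrow> ('o \<times> 'l) list \<Rightarrow> 'm" where
  "weak C A ys xs = cross C (ctx_proj C ys xs) (Idt C A)"


subsection \<open>The category \<open>under_cat P\<close>\<close>

definition arr_reps :: "('o, 'm, 'p) doctrine_data \<Rightarrow> 'o \<Rightarrow> 'o \<Rightarrow> ('m \<times> ('o, 'p) ctx) set" where
  "arr_reps P A B =
     {(f, X). X \<in> ctxs P \<and> f \<in> hom (base P) (Prd (base P) (lprod (base P) X) A) B}"

definition arr_rel :: "('o, 'm, 'p) doctrine_data \<Rightarrow> 'o \<Rightarrow> 'o \<Rightarrow> ('m \<times> ('o, 'p) ctx) rel" where
  "arr_rel P A B =
     {((f, X), (g, Y)). (f, X) \<in> arr_reps P A B \<and> (g, Y) \<in> arr_reps P A B \<and>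
        (\<exists>Z\<in>ctxs P. set X \<subseteq> set Z \<and> set Y \<subseteq> set Z \<and>
           f \<cdot>\<^bsub>base P\<^esub> weak (base P) A Z X = g \<cdot>\<^bsub>base P\<^esub> weak (base P) A Z Y)}"

definition arr_class ::
    "('o, 'm, 'p) doctrine_data \<Rightarrow> 'o \<Rightarrow> 'o \<Rightarrow> 'm \<times> ('o, 'p) ctx \<Rightarrow> ('m \<times> ('o, 'p) ctx) set" where
  "arr_class P A B r = arr_rel P A B `` {r}"

text \<open>An arrow carries its domain and codomain, which its class does not determine.\<close>

type_synonym ('o, 'm, 'p) under_arr = "'o \<times> 'o \<times> ('m \<times> ('o, 'p) ctx) set"

definition base_arr :: "('o, 'm, 'p) doctrine_data \<Rightarrow> 'm \<Rightarrow> ('o, 'm, 'p) under_arr" where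
  "base_arr P f =
     (Dom (base P) f, Cod (base P) f,
      arr_class P (Dom (base P) f) (Cod (base P) f)
        (f \<cdot>\<^bsub>base P\<^esub> Pr2 (base P) (lprod (base P) ([] :: ('o, 'p) ctx)) (Dom (base P) f), []))"

text \<open>A class contains representatives over all sufficiently large lists. For composition, and
  likewise for reindexing below, all choices of representatives over a common list give
  the same class, which is therefore the union of the results.\<close>

definition under_comp ::
    "('o, 'm, 'p) doctrine_data \<Rightarrow> ('o, 'm, 'p) under_arr \<Rightarrow> ('o, 'm, 'p) under_arr
      \<Rightarrow> ('o, 'm, 'p) under_arr" where
  "under_comp P = (\<lambda>(_, D, G) (A, _, F). (A, D,
     \<Union>{arr_class P A D (g \<cdot>\<^bsub>base P\<^esub> pairing (base P) (Pr1 (base P) (lprod (base P) Z) A) f, Z)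
        | f g Z. (f, Z) \<in> F \<and> (g, Z) \<in> G}))"

definition under_cat ::
    "('o, 'm, 'p) doctrine_data \<Rightarrow> ('o, ('o, 'm, 'p) under_arr) fpcat" where
  "under_cat P =
     \<lparr>Ob = Ob (base P),
      Ar = {(A, B, F). A \<in> Ob (base P) \<and> B \<in> Ob (base P) \<and> F \<in> arr_reps P A B // arr_rel P A B},
      Dom = (\<lambda>(A, B, F). A),
      Cod = (\<lambda>(A, B, F). B),
      Idt = (\<lambda>A. base_arr P (Idt (base P) A)),
      Cmp = under_comp P,
      Trm = Trm (base P),
      Prd = Prd (base P),
      Pr1 = (\<lambda>A B. base_arr P (Pr1 (base P) A B)),
      Pr2 = (\<lambda>A B. base_arr P (Pr2 (base P) A B))\<rparr>"


subsection \<open>The doctrine \<open>under_doctrine P\<close>\<close>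

definition el_reps :: "('o, 'm, 'p) doctrine_data \<Rightarrow> 'o \<Rightarrow> ('p \<times> ('o, 'p) ctx) set" where
  "el_reps P A =
     {(\<alpha>, X). X \<in> ctxs P \<and> \<alpha> \<in> carrier (fib P (Prd (base P) (lprod (base P) X) A))}"

definition el_rel :: "('o, 'm, 'p) doctrine_data \<Rightarrow> 'o \<Rightarrow> ('p \<times> ('o, 'p) ctx) rel" where
  "el_rel P A =
     {((\<alpha>, X), (\<beta>, Y)). (\<alpha>, X) \<in> el_reps P A \<and> (\<beta>, Y) \<in> el_reps P A \<and>
        (\<exists>Z\<in>ctxs P. set X \<subseteq> set Z \<and> set Y \<subseteq> set Z \<and>
           rei P (weak (base P) A Z X) \<alpha> = rei P (weak (base P) A Z Y) \<beta>)}"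

definition el_class ::
    "('o, 'm, 'p) doctrine_data \<Rightarrow> 'o \<Rightarrow> 'p \<times> ('o, 'p) ctx \<Rightarrow> ('p \<times> ('o, 'p) ctx) set" where
  "el_class P A r = el_rel P A `` {r}"

type_synonym ('o, 'p) under_el = "('p \<times> ('o, 'p) ctx) set"

definition under_le ::
    "('o, 'm, 'p) doctrine_data \<Rightarrow> 'o \<Rightarrow> ('o, 'p) under_el \<Rightarrow> ('o, 'p) under_el \<Rightarrow> bool" where
  "under_le P A a b \<longleftrightarrow>
     (\<exists>(\<alpha>, X)\<in>a. \<exists>(\<beta>, Y)\<in>b. \<exists>Z\<in>ctxs P. set X \<subseteq> set Z \<and> set Y \<subseteq> set Z \<and>
        rei P (weak (base P) A Z X) \<alpha>
          \<sqsubseteq>\<^bsub>fib P (Prd (base P) (lprod (base P) Z) A)\<^esub> rei P (weak (base P) A Z Y) \<beta>)"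

definition under_rei ::
    "('o, 'm, 'p) doctrine_data \<Rightarrow> ('o, 'm, 'p) under_arr \<Rightarrow> ('o, 'p) under_el
      \<Rightarrow> ('o, 'p) under_el" where
  "under_rei P = (\<lambda>(A, B, F) b.
     \<Union>{el_class P A (rei P (pairing (base P) (Pr1 (base P) (lprod (base P) Z) A) f) \<beta>, Z)
        | f \<beta> Z. (f, Z) \<in> F \<and> (\<beta>, Z) \<in> b})"

definition under_doctrine ::
    "('o, 'm, 'p) doctrine_data
      \<Rightarrow> ('o, ('o, 'm, 'p) under_arr, ('o, 'p) under_el) doctrine_data" where
  "under_doctrine P =
     \<lparr>base = under_cat P,
      fib = (\<lambda>A. \<lparr>carrier = el_reps P A // el_rel P A, eq = (=), le = under_le P A\<rparr>),
      rei = under_rei P\<rparr>"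


section \<open>Adding Henkin axioms\<close>

text \<open>A listing \<open>ls\<close> gives the pair \<open>ls B j\<close> $= (\varphi^B_j, \bar X^{(B,j)})$ for each object
  \<open>B\<close> and each \<open>j\<close> below $\Lambda$.\<close>

type_synonym ('o, 'p) listing = "'o \<Rightarrow> ('o, 'p) ordl \<Rightarrow> 'p \<times> ('o, 'p) ctx"

definition witness_avoid ::
    "('o, 'm, 'p) doctrine_data \<Rightarrow> ('o, 'p) listing \<Rightarrow> 'o
      \<Rightarrow> (('o, 'p) ordl \<Rightarrow> ('o, 'p) ordl) \<Rightarrow> ('o, 'p) ordl \<Rightarrow> ('o, 'p) ordl set" where
  "witness_avoid P ls B d j =
     d ` underS (Lam P) j \<union> (\<Union>k\<in>under (Lam P) j. snd ` set (snd (ls B k)))"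

text \<open>\<open>witness P ls B j\<close> is $d^B_j$, defined by well-founded recursion; \<open>wo_rel.suc r S\<close> is the
  least strict upper bound of \<open>S\<close> in the field of \<open>r\<close>. It is meaningful when a strict upper bound
  below $\Lambda$ exists, which is the last condition of \<open>admissible_listing\<close>.\<close>

definition witness ::
    "('o, 'm, 'p) doctrine_data \<Rightarrow> ('o, 'p) listing \<Rightarrow> 'o \<Rightarrow> ('o, 'p) ordl \<Rightarrow> ('o, 'p) ordl" where
  "witness P ls B =
     wo_rel.worec (Lam P) (\<lambda>d j. wo_rel.suc (Lam P) (witness_avoid P ls B d j))"

definition admissible_listing ::
    "('o, 'm, 'p) doctrine_data \<Rightarrow> ('o, 'p) listing \<Rightarrow> bool" where
  "admissible_listing P ls \<longleftrightarrow>
     (\<forall>B\<in>Ob (base P).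
        (\<forall>j\<in>Field (Lam P). ls B j \<in> el_reps P B) \<and>
        (\<lambda>j. el_class P B (ls B j)) ` Field (Lam P) = carrier (fib (under_doctrine P) B) \<and>
        (\<forall>j\<in>Field (Lam P). AboveS (Lam P) (witness_avoid P ls B (witness P ls B) j) \<noteq> {}))"

definition henkin_formula ::
    "('o, 'm, 'p) doctrine_data \<Rightarrow> ('o, 'p) listing \<Rightarrow> 'o \<Rightarrow> ('o, 'p) ordl \<Rightarrow> 'p" where
  "henkin_formula P ls B j =
     (let (\<phi>, X) = ls B j; PX = lprod (base P) X
      in himp (fib P (Prd (base P) PX B)) (rei P (Pr1 (base P) PX B) (exq P B PX \<phi>)) \<phi>)"

text \<open>$\psi^B_j$ lies in the fibre over \<open>lprod (base P) Xstar\<close>, which is identified with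
  \<open>lprod (base P) Xstar \<times> \<t>\<close> via the first projection.\<close>

definition henkin_axiom ::
    "('o, 'm, 'p) doctrine_data \<Rightarrow> ('o, 'p) listing \<Rightarrow> 'o \<times> ('o, 'p) ordl \<Rightarrow> ('o, 'p) under_el" where
  "henkin_axiom P ls = (\<lambda>(B, j).
     let Xstar = snd (ls B j) @ [(B, witness P ls B j)]
     in el_class P (Trm (base P))
          (rei P (Pr1 (base P) (lprod (base P) Xstar) (Trm (base P))) (henkin_formula P ls B j),
           Xstar))"

definition henkin_sets :: "('o, 'm, 'p) doctrine_data \<Rightarrow> ('o \<times> ('o, 'p) ordl) set set" where
  "henkin_sets P = {U. finite U \<and> U \<subseteq> Ob (base P) \<times> Field (Lam P)}"

text \<open>\<open>axioms_at P ls A U\<close> is the reindexing of $\psi_{\mathcal U}$ to the fibre over \<open>A\<close>.\<close>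

definition axioms_at ::
    "('o, 'm, 'p) doctrine_data \<Rightarrow> ('o, 'p) listing \<Rightarrow> 'o \<Rightarrow> ('o \<times> ('o, 'p) ordl) set
      \<Rightarrow> ('o, 'p) under_el" where
  "axioms_at P ls A U =
     rei (under_doctrine P) (bang (under_cat P) A)
       (\<Sqinter>\<^bsub>fib (under_doctrine P) (Trm (under_cat P))\<^esub> (henkin_axiom P ls ` U))"

type_synonym ('o, 'p) arrow_rep = "('o, 'p) under_el \<times> ('o \<times> ('o, 'p) ordl) set"

definition arrow_reps ::
    "('o, 'm, 'p) doctrine_data \<Rightarrow> ('o, 'p) listing \<Rightarrow> 'o \<Rightarrow> ('o, 'p) arrow_rep set" where
  "arrow_reps P ls A =
     {(a, U). U \<in> henkin_sets P \<and> a \<in> carrier (fib (under_doctrine P) A) \<and>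
        a \<sqsubseteq>\<^bsub>fib (under_doctrine P) A\<^esub> axioms_at P ls A U}"

definition arrow_rel ::
    "('o, 'm, 'p) doctrine_data \<Rightarrow> ('o, 'p) listing \<Rightarrow> 'o \<Rightarrow> ('o, 'p) arrow_rep rel" where
  "arrow_rel P ls A =
     {((a, U), (b, V)). (a, U) \<in> arrow_reps P ls A \<and> (b, V) \<in> arrow_reps P ls A \<and>
        (\<exists>W\<in>henkin_sets P. U \<union> V \<subseteq> W \<and>
           a \<sqinter>\<^bsub>fib (under_doctrine P) A\<^esub> axioms_at P ls A W
             = b \<sqinter>\<^bsub>fib (under_doctrine P) A\<^esub> axioms_at P ls A W)}"

definition arrow_le ::
    "('o, 'm, 'p) doctrine_data \<Rightarrow> ('o, 'p) listing \<Rightarrow> 'o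
      \<Rightarrow> ('o, 'p) arrow_rep set \<Rightarrow> ('o, 'p) arrow_rep set \<Rightarrow> bool" where
  "arrow_le P ls A s t \<longleftrightarrow>
     (\<exists>(a, U)\<in>s. \<exists>(b, V)\<in>t. \<exists>W\<in>henkin_sets P. U \<union> V \<subseteq> W \<and>
        a \<sqinter>\<^bsub>fib (under_doctrine P) A\<^esub> axioms_at P ls A W
          \<sqsubseteq>\<^bsub>fib (under_doctrine P) A\<^esub> b \<sqinter>\<^bsub>fib (under_doctrine P) A\<^esub> axioms_at P ls A W)"

definition arrow_rei ::
    "('o, 'm, 'p) doctrine_data \<Rightarrow> ('o, 'p) listing \<Rightarrow> ('o, 'm, 'p) under_arr
      \<Rightarrow> ('o, 'p) arrow_rep set \<Rightarrow> ('o, 'p) arrow_rep set" where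
  "arrow_rei P ls f t =
     (\<Union>(b, V)\<in>t. arrow_rel P ls (Dom (under_cat P) f) `` {(rei (under_doctrine P) f b, V)})"

definition arrow_doctrine ::
    "('o, 'm, 'p) doctrine_data \<Rightarrow> ('o, 'p) listing
      \<Rightarrow> ('o, ('o, 'm, 'p) under_arr, ('o, 'p) arrow_rep set) doctrine_data" where
  "arrow_doctrine P ls =
     \<lparr>base = under_cat P,
      fib = (\<lambda>A. \<lparr>carrier = arrow_reps P ls A // arrow_rel P ls A, eq = (=),
                  le = arrow_le P ls A\<rparr>),
      rei = arrow_rei P ls\<rparr>"

end

theory Submission
  imports Defs
begin

text \<open>Both constructions are directed colimits. Every arrow and every element has a
  representative over each sufficiently large list, and an equation or inequality between
  classes holds iff it holds between representatives eventually along the filter of large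
  lists. Over a fixed list \<open>X\<close> the arrows are the coKleisli arrows of the comonad
  $\Pi X \times -$, so products, meets and quantifiers are inherited from \<open>P\<close>.

  Adding the axioms replaces the order of each fibre by the entailment
  $a \wedge \psi_W \le b$ for some \<open>W\<close>. Frobenius reciprocity makes the quantifiers respect it.

  For richness, let $\sigma$ be the class of $[\varphi_j, X_j]$. The witness is the projection
  onto the last entry of $X_j$ extended by $(A, d_j)$, which is a valid list because
  $d_j$ is fresh. Modulo the axiom $\psi_j$, which reads
  $\exists \varphi_j \to \varphi_j$ over the extended list, modus ponens gives
  $\exists \sigma \le \sigma(d)$.\<close>

section \<open>Calculus of finite products\<close>

text \<open>Richness presupposes an existential doctrine, and most of the work goes into that. The
  operations of the constructed doctrines are unions over all representatives, while quantifiers,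
  meets and pairings are descriptions or choices; so each is computed once on representatives over a
  common list, and \<open>existential_doctrineI\<close> turns such formulas into the doctrine laws.
  A square in the category with constants commutes only up to enlarging the list. This is why
  Beck-Chevalley is stated for any arrow with the two projections of f \<times> id, and proved over
  a list where these equations hold between representatives. The quantifier with constants
  eliminates B from \<Pi>Z \<times> (A \<times> B), whereas \<open>exq P\<close> eliminates the last
  factor of (\<Pi>Z \<times> A) \<times> B, so reassociations intervene. In the Henkin argument the
  appended entry has sort A, hence the product of the extended list is literally \<Pi>X \<times> A,
  the context of \<phi>: the new constant is the generic element of A, and weakening to the extended
  list is a first projection.\<close>

context fp_category
begin

lemma hom_iff: "f \<in> hom C A B \<longleftrightarrow> f \<in> Ar C \<and> Dom C f = A \<and> Cod C f = B"
  by (auto simp: hom_def)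

lemma
  assumes "f \<in> Ar C" "g \<in> Ar C" "Cod C f = Dom C g"
  shows Cmp_Ar: "g \<cdot> f \<in> Ar C"
    and Dom_Cmp: "Dom C (g \<cdot> f) = Dom C f"
    and Cod_Cmp: "Cod C (g \<cdot> f) = Cod C g"
  using Cmp_hom[of f "Dom C f" "Cod C f" g "Cod C g"] assms by (auto simp: hom_iff)

lemma
  assumes "A \<in> Ob C"
  shows Idt_Ar: "Idt C A \<in> Ar C"
    and Dom_Idt: "Dom C (Idt C A) = A"
    and Cod_Idt: "Cod C (Idt C A) = A"
  using Idt_hom[OF assms] by (auto simp: hom_iff)

lemma Idt_left: "f \<in> Ar C \<Longrightarrow> Cod C f = B \<Longrightarrow> Idt C B \<cdot> f = f"
  using Cmp_Idt_left by (auto simp: hom_iff)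

lemma Idt_right: "f \<in> Ar C \<Longrightarrow> Dom C f = A \<Longrightarrow> f \<cdot> Idt C A = f"
  using Cmp_Idt_right by (auto simp: hom_iff)

lemma assoc:
  "\<lbrakk>f \<in> Ar C; g \<in> Ar C; h \<in> Ar C; Cod C f = Dom C g; Cod C g = Dom C h\<rbrakk>
    \<Longrightarrow> (h \<cdot> g) \<cdot> f = h \<cdot> (g \<cdot> f)"
  using Cmp_assoc[of f "Dom C f" "Cod C f" g "Cod C g" h "Cod C h"] by (auto simp: hom_iff)

lemma
  assumes "A \<in> Ob C" "B \<in> Ob C"
  shows Pr1_Ar: "Pr1 C A B \<in> Ar C"
    and Dom_Pr1: "Dom C (Pr1 C A B) = Prd C A B"
    and Cod_Pr1: "Cod C (Pr1 C A B) = A"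
    and Pr2_Ar: "Pr2 C A B \<in> Ar C"
    and Dom_Pr2: "Dom C (Pr2 C A B) = Prd C A B"
    and Cod_Pr2: "Cod C (Pr2 C A B) = B"
  using Pr1_hom[OF assms] Pr2_hom[OF assms] by (auto simp: hom_iff)

lemma bang_hom: "A \<in> Ob C \<Longrightarrow> bang C A \<in> hom C A (Trm C)"
  unfolding bang_def using theI'[OF Trm_universal] .

lemma
  assumes "A \<in> Ob C"
  shows bang_Ar: "bang C A \<in> Ar C"
    and Dom_bang: "Dom C (bang C A) = A"
    and Cod_bang: "Cod C (bang C A) = Trm C"
  using bang_hom[OF assms] by (auto simp: hom_iff)

lemma to_Trm_eq: "\<lbrakk>f \<in> hom C A (Trm C); g \<in> hom C A (Trm C)\<rbrakk> \<Longrightarrow> f = g"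
  by (metis Dom_Ob Trm_universal hom_iff)

lemma pairing_props:
  assumes "f \<in> hom C Z A" "g \<in> hom C Z B"
  shows "pairing C f g \<in> hom C Z (Prd C A B) \<and> Pr1 C A B \<cdot> pairing C f g = f
    \<and> Pr2 C A B \<cdot> pairing C f g = g"
proof -
  have [simp]: "Dom C f = Z" "Cod C f = A" "Cod C g = B" using assms by (auto simp: hom_iff)
  show ?thesis unfolding pairing_def using theI'[OF Prd_universal[OF assms]] by simp
qed

lemma
  assumes "f \<in> Ar C" "g \<in> Ar C" "Dom C f = Dom C g"
  shows pairing_Ar: "pairing C f g \<in> Ar C"
    and Dom_pairing: "Dom C (pairing C f g) = Dom C f"
    and Cod_pairing: "Cod C (pairing C f g) = Prd C (Cod C f) (Cod C g)"
  using pairing_props[of f "Dom C f" "Cod C f" g "Cod C g"] assms by (auto simp: hom_iff)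

lemma
  assumes "f \<in> Ar C" "g \<in> Ar C" "Dom C f = Dom C g" "Cod C f = A" "Cod C g = B"
  shows Pr1_pairing: "Pr1 C A B \<cdot> pairing C f g = f"
    and Pr2_pairing: "Pr2 C A B \<cdot> pairing C f g = g"
  using pairing_props[of f "Dom C f" A g B] assms by (auto simp: hom_iff)

lemma Prd_eqI:
  assumes "u \<in> hom C Z (Prd C A B)" "v \<in> hom C Z (Prd C A B)" "A \<in> Ob C" "B \<in> Ob C"
    and "Pr1 C A B \<cdot> u = Pr1 C A B \<cdot> v" "Pr2 C A B \<cdot> u = Pr2 C A B \<cdot> v"
  shows "u = v"
proof -
  have "Pr1 C A B \<cdot> v \<in> hom C Z A" "Pr2 C A B \<cdot> v \<in> hom C Z B"
    using assms Pr1_hom Pr2_hom Cmp_hom by blast+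
  from Prd_universal[OF this] show ?thesis using assms by blast
qed

text \<open>With \<open>hom\<close> split into membership in \<open>Ar\<close> and equations for
  \<open>Dom\<close> and \<open>Cod\<close>, the simplifier can compute the type of any composite
  and so discharge the side conditions of the equations below.\<close>

lemmas typing = Cmp_Ar Dom_Cmp Cod_Cmp Idt_Ar Dom_Idt Cod_Idt Pr1_Ar Dom_Pr1 Cod_Pr1
  Pr2_Ar Dom_Pr2 Cod_Pr2 bang_Ar Dom_bang Cod_bang pairing_Ar Dom_pairing Cod_pairing
  Trm_Ob Prd_Ob Dom_Ob Cod_Ob

text \<open>Composites are kept associated to the right, which hides a projection applied to a
  pairing behind a further arrow \<open>h\<close>; these variants recover it.\<close>

lemma
  assumes "f \<in> Ar C" "g \<in> Ar C" "Dom C f = Dom C g" "Cod C f = A" "Cod C g = B"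
    and "h \<in> Ar C" "Cod C h = Dom C f"
  shows Pr1_pairing_Cmp: "Pr1 C A B \<cdot> (pairing C f g \<cdot> h) = f \<cdot> h"
    and Pr2_pairing_Cmp: "Pr2 C A B \<cdot> (pairing C f g \<cdot> h) = g \<cdot> h"
proof -
  have "A \<in> Ob C" "B \<in> Ob C" using assms typing by auto
  with assms show "Pr1 C A B \<cdot> (pairing C f g \<cdot> h) = f \<cdot> h"
    and "Pr2 C A B \<cdot> (pairing C f g \<cdot> h) = g \<cdot> h"
    by (simp_all add: assoc[symmetric] typing Pr1_pairing Pr2_pairing)
qed

lemma pairing_Cmp:
  assumes "f \<in> Ar C" "g \<in> Ar C" "Dom C f = Dom C g" "h \<in> Ar C" "Cod C h = Dom C f"
  shows "pairing C f g \<cdot> h = pairing C (f \<cdot> h) (g \<cdot> h)"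
proof (rule Prd_eqI)
  show "pairing C f g \<cdot> h \<in> hom C (Dom C h) (Prd C (Cod C f) (Cod C g))"
    "pairing C (f \<cdot> h) (g \<cdot> h) \<in> hom C (Dom C h) (Prd C (Cod C f) (Cod C g))"
    using assms by (simp_all add: hom_iff typing)
qed (use assms in \<open>simp_all add: typing Pr1_pairing Pr2_pairing Pr1_pairing_Cmp Pr2_pairing_Cmp\<close>)

lemma pairing_Pr: "\<lbrakk>A \<in> Ob C; B \<in> Ob C\<rbrakk> \<Longrightarrow> pairing C (Pr1 C A B) (Pr2 C A B) = Idt C (Prd C A B)"
  by (rule Prd_eqI[of _ "Prd C A B" A B])
    (simp_all add: hom_iff typing Pr1_pairing Pr2_pairing Idt_right)

lemma pairing_Pr_Cmp:
  "\<lbrakk>A \<in> Ob C; B \<in> Ob C; h \<in> Ar C; Cod C h = Prd C A B\<rbrakk>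
    \<Longrightarrow> pairing C (Pr1 C A B \<cdot> h) (Pr2 C A B \<cdot> h) = h"
  by (rule Prd_eqI[of _ "Dom C h" A B]) (simp_all add: hom_iff typing Pr1_pairing Pr2_pairing)

text \<open>A rewrite system for arrows built from projections and pairings: composites associate to
  the right, pairing moves outside composition, projections cancel. It settles most of the coherence
  equations that follow.\<close>

lemmas products = typing Idt_left Idt_right assoc Pr1_pairing Pr2_pairing
  Pr1_pairing_Cmp Pr2_pairing_Cmp pairing_Cmp pairing_Pr pairing_Pr_Cmp

text \<open>Beck-Chevalley will be used for an arbitrary arrow with these two projections;
  uniqueness turns it back into \<open>cross\<close>.\<close>

lemma cross_eqI:
  assumes "f \<in> hom C A A'" "g \<in> hom C B B'" "h \<in> hom C (Prd C A B) (Prd C A' B')"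
    and "Pr1 C A' B' \<cdot> h = f \<cdot> Pr1 C A B" "Pr2 C A' B' \<cdot> h = g \<cdot> Pr2 C A B"
  shows "h = cross C f g"
  by (rule Prd_eqI[of _ "Prd C A B" A' B'])
    (use assms in \<open>auto simp: hom_iff cross_def products\<close>)

lemma
  assumes "f \<in> hom C A A'" "g \<in> hom C B B'"
  shows cross_hom: "cross C f g \<in> hom C (Prd C A B) (Prd C A' B')"
    and Pr1_cross: "Pr1 C A' B' \<cdot> cross C f g = f \<cdot> Pr1 C A B"
    and Pr2_cross: "Pr2 C A' B' \<cdot> cross C f g = g \<cdot> Pr2 C A B"
  using assms by (auto simp: hom_iff cross_def products)


subsection \<open>Products of lists\<close>

lemma lprod_Nil: "lprod C [] = Trm C"
  by (simp add: lprod_def)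

lemma lprod_snoc: "lprod C (xs @ [e]) = Prd C (lprod C xs) (fst e)"
  by (simp add: lprod_def)

lemma lprod_Ob: "fst ` set xs \<subseteq> Ob C \<Longrightarrow> lprod C xs \<in> Ob C"
  by (induction xs rule: rev_induct) (auto simp: lprod_Nil lprod_snoc typing)

text \<open>\<open>lprod\<close> grows at its right end, so the recursion runs over the reversed
  list; this equation is the form suited to \<open>rev_induct\<close>.\<close>

lemma entry_proj_snoc:
  "entry_proj C (xs @ [x]) e =
     (if x = e then Pr2 C (lprod C xs) (fst x) else entry_proj C xs e \<cdot> Pr1 C (lprod C xs) (fst x))"
  by (simp add: entry_proj_def)

lemma entry_proj_hom:
  "\<lbrakk>fst ` set xs \<subseteq> Ob C; e \<in> set xs\<rbrakk> \<Longrightarrow> entry_proj C xs e \<in> hom C (lprod C xs) (fst e)"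
proof (induction xs rule: rev_induct)
  case (snoc x xs)
  moreover have "lprod C xs \<in> Ob C" using snoc.prems by (intro lprod_Ob) auto
  ultimately show ?case by (auto simp: entry_proj_snoc hom_iff lprod_snoc products)
qed simp

text \<open>The entry projections of a duplicate-free list are jointly monic. Distinctness matters
  because for a repeated entry \<open>entry_proj\<close> sees only the last occurrence.\<close>

lemma lprod_eqI:
  assumes "fst ` set xs \<subseteq> Ob C" "distinct xs" "u \<in> hom C K (lprod C xs)" "v \<in> hom C K (lprod C xs)"
    and "\<And>e. e \<in> set xs \<Longrightarrow> entry_proj C xs e \<cdot> u = entry_proj C xs e \<cdot> v"
  shows "u = v"
  using assms
proof (induction xs arbitrary: u v rule: rev_induct)
  case Nil then show ?case using to_Trm_eq by (simp add: lprod_Nil)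
next
  case (snoc x xs)
  have o: "lprod C xs \<in> Ob C" using snoc.prems by (intro lprod_Ob) auto
  have x: "fst x \<in> Ob C" using snoc.prems by auto
  have u: "u \<in> Ar C" "Dom C u = K" "Cod C u = Prd C (lprod C xs) (fst x)"
    and v: "v \<in> Ar C" "Dom C v = K" "Cod C v = Prd C (lprod C xs) (fst x)"
    using snoc.prems by (auto simp: hom_iff lprod_snoc)
  have "Pr1 C (lprod C xs) (fst x) \<cdot> u = Pr1 C (lprod C xs) (fst x) \<cdot> v"
  proof (rule snoc.IH)
    fix e assume e: "e \<in> set xs"
    then have "entry_proj C xs e \<in> hom C (lprod C xs) (fst e)"
      using snoc.prems by (intro entry_proj_hom) auto
    \<comment> \<open>Since \<open>e\<close> is not the last entry, its projection factors through
      the first projection, and the hypothesis for \<open>e\<close> descends to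
      \<open>xs\<close>.\<close>
    moreover have "x \<noteq> e" using e snoc.prems by auto
    ultimately show "entry_proj C xs e \<cdot> Pr1 C (lprod C xs) (fst x) \<cdot> u
        = entry_proj C xs e \<cdot> Pr1 C (lprod C xs) (fst x) \<cdot> v"
      using snoc.prems(5)[of e] e o x u v by (simp add: entry_proj_snoc hom_iff products)
  qed (use snoc.prems o x u v in \<open>auto simp: hom_iff products\<close>)
  moreover have "Pr2 C (lprod C xs) (fst x) \<cdot> u = Pr2 C (lprod C xs) (fst x) \<cdot> v"
    using snoc.prems(5)[of x] by (simp add: entry_proj_snoc)
  ultimately show ?case using o x u v Prd_eqI by (metis hom_iff)
qed

section \<open>Projections between products of lists\<close>

lemma ctx_proj_snoc:
  "ctx_proj C ys (xs @ [e]) = pairing C (ctx_proj C ys xs) (entry_proj C ys e)"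
  by (simp add: ctx_proj_def)

lemma ctx_proj_hom:
  assumes "fst ` set ys \<subseteq> Ob C" "set xs \<subseteq> set ys"
  shows "ctx_proj C ys xs \<in> hom C (lprod C ys) (lprod C xs)"
  using assms(2)
proof (induction xs rule: rev_induct)
  case Nil then show ?case
    using bang_hom[OF lprod_Ob[OF assms(1)]] by (simp add: ctx_proj_def lprod_Nil)
next
  case (snoc x xs)
  then have "entry_proj C ys x \<in> hom C (lprod C ys) (fst x)"
    using assms(1) by (intro entry_proj_hom) auto
  with snoc show ?case by (auto simp: ctx_proj_snoc lprod_snoc hom_iff products)
qed

text \<open>The characteristic property of a tuple. Together with \<open>lprod_eqI\<close> it
  replaces computation with nested pairings.\<close>

lemma entry_proj_ctx_proj:
  assumes "fst ` set ys \<subseteq> Ob C" "set xs \<subseteq> set ys" "e \<in> set xs"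
  shows "entry_proj C xs e \<cdot> ctx_proj C ys xs = entry_proj C ys e"
  using assms(2,3)
proof (induction xs rule: rev_induct)
  case (snoc x xs)
  have x: "entry_proj C ys x \<in> hom C (lprod C ys) (fst x)"
    using assms(1) snoc.prems by (intro entry_proj_hom) auto
  have c: "ctx_proj C ys xs \<in> hom C (lprod C ys) (lprod C xs)"
    using assms(1) snoc.prems by (intro ctx_proj_hom) auto
  have xs: "fst ` set xs \<subseteq> Ob C" using snoc.prems assms(1) by auto
  then have o: "lprod C xs \<in> Ob C" by (rule lprod_Ob)
  show ?case
  proof (cases "x = e")
    case True
    with x c o show ?thesis by (auto simp: entry_proj_snoc ctx_proj_snoc hom_iff products)
  next
    case False
    with snoc.prems have e: "e \<in> set xs" by auto
    have "fst x \<in> Ob C" using snoc.prems assms(1) by auto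
    with snoc x c o False e entry_proj_hom[OF xs e] show ?thesis
      by (auto simp: entry_proj_snoc ctx_proj_snoc hom_iff products)
  qed
qed simp

text \<open>Both sides have the same components, so \<open>lprod_eqI\<close> identifies them. This
  functoriality makes weakening a directed system.\<close>

lemma ctx_proj_Cmp:
  assumes "fst ` set zs \<subseteq> Ob C" "set xs \<subseteq> set ys" "set ys \<subseteq> set zs" "distinct xs"
  shows "ctx_proj C ys xs \<cdot> ctx_proj C zs ys = ctx_proj C zs xs"
proof (rule lprod_eqI)
  have ys: "fst ` set ys \<subseteq> Ob C" and xz: "set xs \<subseteq> set zs" using assms by auto
  show xs: "fst ` set xs \<subseteq> Ob C" using image_mono[OF assms(2)] ys by (rule order_trans)
  have h: "ctx_proj C ys xs \<in> hom C (lprod C ys) (lprod C xs)"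
    "ctx_proj C zs ys \<in> hom C (lprod C zs) (lprod C ys)"
    "ctx_proj C zs xs \<in> hom C (lprod C zs) (lprod C xs)"
    using assms ys xz by (auto intro!: ctx_proj_hom)
  then show "ctx_proj C ys xs \<cdot> ctx_proj C zs ys \<in> hom C (lprod C zs) (lprod C xs)"
    "ctx_proj C zs xs \<in> hom C (lprod C zs) (lprod C xs)"
    by (auto simp: hom_iff products)
  fix e assume e: "e \<in> set xs"
  then have "entry_proj C xs e \<cdot> (ctx_proj C ys xs \<cdot> ctx_proj C zs ys)
    = (entry_proj C xs e \<cdot> ctx_proj C ys xs) \<cdot> ctx_proj C zs ys"
    using h entry_proj_hom[OF xs e] by (auto simp: hom_iff assoc)
  also have "\<dots> = entry_proj C xs e \<cdot> ctx_proj C zs xs"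
    using e assms(2) by (simp add: entry_proj_ctx_proj[OF ys assms(2)]
      entry_proj_ctx_proj[OF assms(1,3)] entry_proj_ctx_proj[OF assms(1) xz] subsetD)
  finally show "entry_proj C xs e \<cdot> (ctx_proj C ys xs \<cdot> ctx_proj C zs ys)
    = entry_proj C xs e \<cdot> ctx_proj C zs xs" .
qed (use assms in auto)

text \<open>Dropping the last entry is an ordinary product projection. The Henkin argument uses this
  for the list with the witness appended.\<close>

lemma ctx_proj_snoc_self:
  assumes "fst ` set (xs @ [e]) \<subseteq> Ob C" "distinct (xs @ [e])"
  shows "ctx_proj C (xs @ [e]) xs = Pr1 C (lprod C xs) (fst e)"
proof (rule lprod_eqI[where xs = xs])
  have xs: "fst ` set xs \<subseteq> Ob C" using assms by auto
  then have o: "lprod C xs \<in> Ob C" "fst e \<in> Ob C" using lprod_Ob assms by auto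
  show "ctx_proj C (xs @ [e]) xs \<in> hom C (lprod C (xs @ [e])) (lprod C xs)"
    using assms by (intro ctx_proj_hom) auto
  show "Pr1 C (lprod C xs) (fst e) \<in> hom C (lprod C (xs @ [e])) (lprod C xs)"
    using o by (simp add: hom_iff typing lprod_snoc)
  fix x assume "x \<in> set xs"
  moreover have "x \<noteq> e" using calculation assms by auto
  moreover have "entry_proj C xs x \<cdot> ctx_proj C (xs @ [e]) xs = entry_proj C (xs @ [e]) x"
    by (rule entry_proj_ctx_proj) (use assms calculation in auto)
  ultimately show "entry_proj C xs x \<cdot> ctx_proj C (xs @ [e]) xs
      = entry_proj C xs x \<cdot> Pr1 C (lprod C xs) (fst e)"
    by (simp add: entry_proj_snoc)
qed (use assms in auto)

end


section \<open>Elementary description of existential doctrines\<close>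

text \<open>A \<open>gorder\<close> carries its own equality relation; taking it to be
  \<open>(=)\<close> makes the congruence conditions hold automatically.\<close>

lemma partial_orderI:
  assumes "eq L = (=)"
    and "\<And>x. x \<in> carrier L \<Longrightarrow> x \<sqsubseteq>\<^bsub>L\<^esub> x"
    and "\<And>x y. \<lbrakk>x \<in> carrier L; y \<in> carrier L; x \<sqsubseteq>\<^bsub>L\<^esub> y; y \<sqsubseteq>\<^bsub>L\<^esub> x\<rbrakk> \<Longrightarrow> x = y"
    and "\<And>x y z. \<lbrakk>x \<in> carrier L; y \<in> carrier L; z \<in> carrier L; x \<sqsubseteq>\<^bsub>L\<^esub> y; y \<sqsubseteq>\<^bsub>L\<^esub> z\<rbrakk>
      \<Longrightarrow> x \<sqsubseteq>\<^bsub>L\<^esub> z"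
  shows "partial_order L"
proof unfold_locales
  show "x \<sqsubseteq>\<^bsub>L\<^esub> z" if "x \<sqsubseteq>\<^bsub>L\<^esub> y" "y \<sqsubseteq>\<^bsub>L\<^esub> z" "x \<in> carrier L" "y \<in> carrier L" "z \<in> carrier L" for x y z
    using assms(4) that by blast
qed (use assms(1-3) in auto)

lemma greatest_Lower_two:
  assumes "i \<in> carrier L" "x \<in> carrier L" "y \<in> carrier L" "i \<sqsubseteq>\<^bsub>L\<^esub> x" "i \<sqsubseteq>\<^bsub>L\<^esub> y"
    and "\<And>z. \<lbrakk>z \<in> carrier L; z \<sqsubseteq>\<^bsub>L\<^esub> x; z \<sqsubseteq>\<^bsub>L\<^esub> y\<rbrakk> \<Longrightarrow> z \<sqsubseteq>\<^bsub>L\<^esub> i"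
  shows "greatest L i (Lower L {x, y})"
  using assms by (auto simp: greatest_def Lower_def)

text \<open>Infima are selected by choice; in a partial order antisymmetry leaves only one
  candidate.\<close>

lemma (in partial_order) inf_eqI: "greatest L i (Lower L A) \<Longrightarrow> \<Sqinter>A = i"
  unfolding inf_def by (rule some_equality) (auto intro: greatest_unique)

lemma (in partial_order) top_eqI: "greatest L i (carrier L) \<Longrightarrow> \<top> = i"
  unfolding top_def by (rule some_equality) (auto intro: greatest_unique)

lemma (in partial_order) meet_eqI: "greatest L i (Lower L {x, y}) \<Longrightarrow> x \<sqinter> y = i"
  unfolding meet_def by (rule inf_eqI)

text \<open>Two values with this universal property lie below each other, as each may be tested
  against the other; so the description in \<open>exq\<close> denotes any \<open>e\<close> that has
  it.\<close>

lemma exq_eqI: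
  assumes "partial_order (fib R C)" "e \<in> carrier (fib R C)"
    and "\<And>\<beta>. \<beta> \<in> carrier (fib R C) \<Longrightarrow> e \<sqsubseteq>\<^bsub>fib R C\<^esub> \<beta>
      \<longleftrightarrow> \<phi> \<sqsubseteq>\<^bsub>fib R (Prd (base R) C B)\<^esub> rei R (Pr1 (base R) C B) \<beta>"
  shows "exq R B C \<phi> = e"
proof -
  interpret partial_order "fib R C" by fact
  show ?thesis unfolding exq_def
  proof (rule the_equality)
    fix e' assume e': "e' \<in> carrier (fib R C) \<and> (\<forall>\<beta>\<in>carrier (fib R C). e' \<sqsubseteq>\<^bsub>fib R C\<^esub> \<beta>
      \<longleftrightarrow> \<phi> \<sqsubseteq>\<^bsub>fib R (Prd (base R) C B)\<^esub> rei R (Pr1 (base R) C B) \<beta>)"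
    then have "e \<sqsubseteq>\<^bsub>fib R C\<^esub> e'" "e' \<sqsubseteq>\<^bsub>fib R C\<^esub> e" using assms(2,3) le_refl by blast+
    then show "e' = e" using e' assms(2) by blast
  qed (use assms in blast)
qed

text \<open>The constructed doctrines come with explicit formulas for top, meet and quantifier, and
  checking these elementwise suffices: the facts \<open>top\<close>, \<open>meet\<close> and
  \<open>exq\<close> in the proof identify them with the values selected by the lattice operations
  and by the description. Assumption \<open>bc\<close> ranges over every \<open>h\<close> with the
  right projections, so that no description of a pairing has to be evaluated.\<close>

lemma existential_doctrineI:
  fixes R :: "('o, 'm, 'p) doctrine_data" and tp mt ex
  defines "D \<equiv> base R" and "F \<equiv> \<lambda>A. carrier (fib R A)"
  assumes base: "fp_category D"
    and po: "\<And>A. A \<in> Ob D \<Longrightarrow> partial_order (fib R A)"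
    and rei_in: "\<And>f A B a. \<lbrakk>f \<in> hom D A B; a \<in> F B\<rbrakk> \<Longrightarrow> rei R f a \<in> F A"
    and rei_mono: "\<And>f A B a b. \<lbrakk>f \<in> hom D A B; a \<in> F B; b \<in> F B; a \<sqsubseteq>\<^bsub>fib R B\<^esub> b\<rbrakk>
      \<Longrightarrow> rei R f a \<sqsubseteq>\<^bsub>fib R A\<^esub> rei R f b"
    and rei_Idt: "\<And>A a. \<lbrakk>A \<in> Ob D; a \<in> F A\<rbrakk> \<Longrightarrow> rei R (Idt D A) a = a"
    and rei_Cmp: "\<And>f g A B E a. \<lbrakk>f \<in> hom D A B; g \<in> hom D B E; a \<in> F E\<rbrakk>
      \<Longrightarrow> rei R (g \<cdot>\<^bsub>D\<^esub> f) a = rei R f (rei R g a)"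
    and tp: "\<And>A. A \<in> Ob D \<Longrightarrow> tp A \<in> F A" "\<And>A a. \<lbrakk>A \<in> Ob D; a \<in> F A\<rbrakk> \<Longrightarrow> a \<sqsubseteq>\<^bsub>fib R A\<^esub> tp A"
    and rei_tp: "\<And>f A B. f \<in> hom D A B \<Longrightarrow> rei R f (tp B) = tp A"
    and mt: "\<And>A a b. \<lbrakk>A \<in> Ob D; a \<in> F A; b \<in> F A\<rbrakk> \<Longrightarrow> mt A a b \<in> F A"
      "\<And>A a b. \<lbrakk>A \<in> Ob D; a \<in> F A; b \<in> F A\<rbrakk> \<Longrightarrow> mt A a b \<sqsubseteq>\<^bsub>fib R A\<^esub> a"
      "\<And>A a b. \<lbrakk>A \<in> Ob D; a \<in> F A; b \<in> F A\<rbrakk> \<Longrightarrow> mt A a b \<sqsubseteq>\<^bsub>fib R A\<^esub> b"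
      "\<And>A a b c. \<lbrakk>A \<in> Ob D; a \<in> F A; b \<in> F A; c \<in> F A; c \<sqsubseteq>\<^bsub>fib R A\<^esub> a; c \<sqsubseteq>\<^bsub>fib R A\<^esub> b\<rbrakk>
        \<Longrightarrow> c \<sqsubseteq>\<^bsub>fib R A\<^esub> mt A a b"
    and rei_mt: "\<And>f A B a b. \<lbrakk>f \<in> hom D A B; a \<in> F B; b \<in> F B\<rbrakk>
      \<Longrightarrow> rei R f (mt B a b) = mt A (rei R f a) (rei R f b)"
    and ex_in: "\<And>B A a. \<lbrakk>B \<in> Ob D; A \<in> Ob D; a \<in> F (Prd D A B)\<rbrakk> \<Longrightarrow> ex B A a \<in> F A"
    and ex_adj: "\<And>B A a b. \<lbrakk>B \<in> Ob D; A \<in> Ob D; a \<in> F (Prd D A B); b \<in> F A\<rbrakk>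
      \<Longrightarrow> ex B A a \<sqsubseteq>\<^bsub>fib R A\<^esub> b \<longleftrightarrow> a \<sqsubseteq>\<^bsub>fib R (Prd D A B)\<^esub> rei R (Pr1 D A B) b"
    and bc: "\<And>B f A A' h a. \<lbrakk>B \<in> Ob D; f \<in> hom D A A'; a \<in> F (Prd D A' B);
        h \<in> hom D (Prd D A B) (Prd D A' B);
        Pr1 D A' B \<cdot>\<^bsub>D\<^esub> h = f \<cdot>\<^bsub>D\<^esub> Pr1 D A B; Pr2 D A' B \<cdot>\<^bsub>D\<^esub> h = Pr2 D A B\<rbrakk>
      \<Longrightarrow> ex B A (rei R h a) = rei R f (ex B A' a)"
    and frob: "\<And>B A a b. \<lbrakk>B \<in> Ob D; A \<in> Ob D; a \<in> F (Prd D A B); b \<in> F A\<rbrakk>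
      \<Longrightarrow> ex B A (mt (Prd D A B) a (rei R (Pr1 D A B) b)) = mt A (ex B A a) b"
  shows "existential_doctrine R"
proof -
  interpret fp_category D by fact
  note defs = D_def[symmetric] F_def
  have gr: "greatest (fib R A) (mt A a b) (Lower (fib R A) {a, b})"
    if "A \<in> Ob D" "a \<in> F A" "b \<in> F A" for A a b
    using that mt by (intro greatest_Lower_two) (auto simp: F_def)
  have grt: "greatest (fib R A) (tp A) (carrier (fib R A))" if "A \<in> Ob D" for A
    using that tp unfolding greatest_def F_def Upper_def by blast
  have meet: "a \<sqinter>\<^bsub>fib R A\<^esub> b = mt A a b" if "A \<in> Ob D" "a \<in> F A" "b \<in> F A" for A a b
    using partial_order.meet_eqI[OF po gr] that by blast
  have top: "\<top>\<^bsub>fib R A\<^esub> = tp A" if "A \<in> Ob D" for A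
    using partial_order.top_eqI[OF po grt] that by blast
  have exq: "exq R B A a = ex B A a" if "B \<in> Ob D" "A \<in> Ob D" "a \<in> F (Prd D A B)" for B A a
    using that po ex_in ex_adj unfolding defs by (intro exq_eqI) (auto simp: D_def)
  have wpo: "weak_partial_order (fib R A)" if "A \<in> Ob D" for A
    using po[OF that] partial_order_def by auto
  have ob: "A \<in> Ob D" "B \<in> Ob D" if "f \<in> hom D A B" for f A B
    using that Dom_Ob Cod_Ob by (auto simp: hom_iff)
  have doc: "doctrine R"
  proof (rule doctrine.intro)
    show "fp_category (base R)" using base by (simp add: D_def)
  qed (use po rei_in rei_mono rei_Idt rei_Cmp wpo ob in \<open>auto simp: defs intro!: isotoneI\<close>)
  have prim: "primary_doctrine R"
  proof (rule primary_doctrine.intro[OF doc], rule primary_doctrine_axioms.intro, unfold defs)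
    show "weak_partial_order_top (fib R A)" if "A \<in> Ob D" for A
      using wpo[OF that] grt[OF that]
      by (auto simp: weak_partial_order_top_def weak_partial_order_top_axioms_def)
    show "lower_semilattice (fib R A)" if "A \<in> Ob D" for A
      using po[OF that] gr[OF that]
      by (auto simp: lower_semilattice_def lower_semilattice_axioms_def F_def)
    show "rei R f \<top>\<^bsub>fib R B\<^esub> = \<top>\<^bsub>fib R A\<^esub>" if "f \<in> hom D A B" for f A B
      using that ob[OF that] by (simp add: top rei_tp)
    show "rei R f (a \<sqinter>\<^bsub>fib R B\<^esub> b) = rei R f a \<sqinter>\<^bsub>fib R A\<^esub> rei R f b"
      if "f \<in> hom D A B" "a \<in> carrier (fib R B)" "b \<in> carrier (fib R B)" for f A B a b
      using that ob[OF that(1)] rei_in[OF that(1)] by (simp add: meet rei_mt F_def)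
  qed
  show "existential_doctrine R"
  proof (rule existential_doctrine.intro[OF prim], rule existential_doctrine_axioms.intro, unfold defs)
    fix B A assume BA: "B \<in> Ob D" "A \<in> Ob D"
    then have h: "Pr1 D A B \<in> hom D (Prd D A B) A" "Prd D A B \<in> Ob D"
      by (auto intro: Pr1_hom Prd_Ob)
    show "galois_connection \<lparr>orderA = fib R (Prd D A B), orderB = fib R A, lower = exq R B A,
        upper = rei R (Pr1 D A B)\<rparr>"
      using BA h po ex_in ex_adj rei_in[OF h(1)] exq unfolding F_def
      by (intro galois_connection.intro connection.intro galois_connection_axioms.intro) auto
    fix \<alpha> \<beta> assume ab: "\<alpha> \<in> carrier (fib R (Prd D A B))" "\<beta> \<in> carrier (fib R A)"
    then show "exq R B A (\<alpha> \<sqinter>\<^bsub>fib R (Prd D A B)\<^esub> rei R (Pr1 D A B) \<beta>) = exq R B A \<alpha> \<sqinter>\<^bsub>fib R A\<^esub> \<beta>"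
      using frob[OF BA] BA h rei_in[OF h(1)] mt(1)[OF h(2)]
      by (simp add: meet exq ex_in[unfolded F_def] F_def)
  next
    fix B f A A' \<phi>
    assume a: "B \<in> Ob D" "f \<in> hom D A A'" "\<phi> \<in> carrier (fib R (Prd D A' B))"
    let ?h = "cross D f (Idt D B)"
    have h: "?h \<in> hom D (Prd D A B) (Prd D A' B)" "Pr1 D A' B \<cdot>\<^bsub>D\<^esub> ?h = f \<cdot>\<^bsub>D\<^esub> Pr1 D A B"
      "Pr2 D A' B \<cdot>\<^bsub>D\<^esub> ?h = Idt D B \<cdot>\<^bsub>D\<^esub> Pr2 D A B"
      using cross_hom Pr1_cross Pr2_cross a Idt_hom by blast+
    have h2: "Pr2 D A' B \<cdot>\<^bsub>D\<^esub> ?h = Pr2 D A B"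
      using h(3) Cmp_Idt_left Pr2_hom ob a by metis
    show "exq R B A (rei R ?h \<phi>) = rei R f (exq R B A' \<phi>)"
      using bc[OF a(1,2) _ h(1,2) h2] rei_in[OF h(1)] a ob[OF a(2)] by (simp add: exq F_def)
  qed
qed

section \<open>Elementwise laws of an existential doctrine\<close>

context existential_doctrine
begin

sublocale base: fp_category "base P"
  by (rule base_fp_category)

lemma hom_Ob: "f \<in> hom (base P) A B \<Longrightarrow> A \<in> Ob (base P) \<and> B \<in> Ob (base P)"
  by (auto simp: base.hom_iff base.typing)

lemma rei_in: "\<lbrakk>f \<in> hom (base P) A B; a \<in> carrier (fib P B)\<rbrakk> \<Longrightarrow> rei P f a \<in> carrier (fib P A)"
  using rei_carrier by blast

lemma rei_mono:
  "\<lbrakk>f \<in> hom (base P) A B; a \<in> carrier (fib P B); b \<in> carrier (fib P B); a \<sqsubseteq>\<^bsub>fib P B\<^esub> b\<rbrakk>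
    \<Longrightarrow> rei P f a \<sqsubseteq>\<^bsub>fib P A\<^esub> rei P f b"
  using use_iso2 rei_monotone by metis

context
  fixes A assumes A: "A \<in> Ob (base P)"
begin

interpretation partial_order "fib P A" by (rule fib_poset[OF A])
interpretation weak_partial_order_top "fib P A" by (rule fib_top[OF A])
interpretation lower_semilattice "fib P A" by (rule fib_meet[OF A])

lemma fib_refl: "a \<in> carrier (fib P A) \<Longrightarrow> a \<sqsubseteq>\<^bsub>fib P A\<^esub> a"
  by (rule le_refl)

lemma fib_antisym:
  "\<lbrakk>a \<in> carrier (fib P A); b \<in> carrier (fib P A); a \<sqsubseteq>\<^bsub>fib P A\<^esub> b; b \<sqsubseteq>\<^bsub>fib P A\<^esub> a\<rbrakk> \<Longrightarrow> a = b"
  by (rule le_antisym)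

lemma fib_trans:
  "\<lbrakk>a \<sqsubseteq>\<^bsub>fib P A\<^esub> b; b \<sqsubseteq>\<^bsub>fib P A\<^esub> c;
    a \<in> carrier (fib P A); b \<in> carrier (fib P A); c \<in> carrier (fib P A)\<rbrakk> \<Longrightarrow> a \<sqsubseteq>\<^bsub>fib P A\<^esub> c"
  by (rule le_trans)

lemma fib_top_in: "\<top>\<^bsub>fib P A\<^esub> \<in> carrier (fib P A)"
  by (rule top_closed)

lemma le_fib_top: "a \<in> carrier (fib P A) \<Longrightarrow> a \<sqsubseteq>\<^bsub>fib P A\<^esub> \<top>\<^bsub>fib P A\<^esub>"
  by (rule top_higher)

lemma
  assumes "a \<in> carrier (fib P A)" "b \<in> carrier (fib P A)"
  shows fib_meet_in: "a \<sqinter>\<^bsub>fib P A\<^esub> b \<in> carrier (fib P A)"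
    and fib_meet_left: "a \<sqinter>\<^bsub>fib P A\<^esub> b \<sqsubseteq>\<^bsub>fib P A\<^esub> a"
    and fib_meet_right: "a \<sqinter>\<^bsub>fib P A\<^esub> b \<sqsubseteq>\<^bsub>fib P A\<^esub> b"
  using assms by (auto intro: meet_left meet_right)

lemma le_fib_meet:
  "\<lbrakk>c \<sqsubseteq>\<^bsub>fib P A\<^esub> a; c \<sqsubseteq>\<^bsub>fib P A\<^esub> b;
    a \<in> carrier (fib P A); b \<in> carrier (fib P A); c \<in> carrier (fib P A)\<rbrakk> \<Longrightarrow> c \<sqsubseteq>\<^bsub>fib P A\<^esub> a \<sqinter>\<^bsub>fib P A\<^esub> b"
  by (rule meet_le)

lemma
  assumes "finite S" "S \<subseteq> carrier (fib P A)"
  shows fib_Inf_in: "\<Sqinter>\<^bsub>fib P A\<^esub> S \<in> carrier (fib P A)"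
    and fib_Inf_lower: "s \<in> S \<Longrightarrow> \<Sqinter>\<^bsub>fib P A\<^esub> S \<sqsubseteq>\<^bsub>fib P A\<^esub> s"
    and fib_Inf_greatest: "\<lbrakk>c \<in> carrier (fib P A); \<And>s. s \<in> S \<Longrightarrow> c \<sqsubseteq>\<^bsub>fib P A\<^esub> s\<rbrakk>
      \<Longrightarrow> c \<sqsubseteq>\<^bsub>fib P A\<^esub> \<Sqinter>\<^bsub>fib P A\<^esub> S"
proof -
  have "greatest (fib P A) (\<Sqinter>\<^bsub>fib P A\<^esub> S) (Lower (fib P A) S)"
  \<comment> \<open>The semilattice supplies infima of nonempty finite sets; for the empty set every
    element is a lower bound, so the infimum is the top element.\<close>
  proof (cases "S = {}")
    case True
    have "greatest (fib P A) \<top>\<^bsub>fib P A\<^esub> (Lower (fib P A) S)"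
      using top_greatest by (simp add: True Lower_def greatest_def)
    then show ?thesis using inf_eqI by metis
  next
    case False then show ?thesis using finite_inf_greatest assms by blast
  qed
  then show "\<Sqinter>\<^bsub>fib P A\<^esub> S \<in> carrier (fib P A)"
    and "s \<in> S \<Longrightarrow> \<Sqinter>\<^bsub>fib P A\<^esub> S \<sqsubseteq>\<^bsub>fib P A\<^esub> s"
    and "\<lbrakk>c \<in> carrier (fib P A); \<And>s. s \<in> S \<Longrightarrow> c \<sqsubseteq>\<^bsub>fib P A\<^esub> s\<rbrakk>
      \<Longrightarrow> c \<sqsubseteq>\<^bsub>fib P A\<^esub> \<Sqinter>\<^bsub>fib P A\<^esub> S"
    using assms(2) by (auto simp: greatest_def Lower_def)
qed

end

lemma
  assumes "B \<in> Ob (base P)" "A \<in> Ob (base P)" "\<phi> \<in> carrier (fib P (Prd (base P) A B))"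
  shows exq_in: "exq P B A \<phi> \<in> carrier (fib P A)"
    and exq_le_iff: "\<beta> \<in> carrier (fib P A) \<Longrightarrow> exq P B A \<phi> \<sqsubseteq>\<^bsub>fib P A\<^esub> \<beta>
      \<longleftrightarrow> \<phi> \<sqsubseteq>\<^bsub>fib P (Prd (base P) A B)\<^esub> rei P (Pr1 (base P) A B) \<beta>"
  using exq_left_adjoint[OF assms(1,2)] assms(3)
  unfolding galois_connection_def connection_def galois_connection_axioms_def by auto

lemma beck_chevalley':
  assumes "B \<in> Ob (base P)" "f \<in> hom (base P) A A'" "\<phi> \<in> carrier (fib P (Prd (base P) A' B))"
    and "h \<in> hom (base P) (Prd (base P) A B) (Prd (base P) A' B)"
    and "Pr1 (base P) A' B \<cdot>\<^bsub>base P\<^esub> h = f \<cdot>\<^bsub>base P\<^esub> Pr1 (base P) A B"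
    and "Pr2 (base P) A' B \<cdot>\<^bsub>base P\<^esub> h = Pr2 (base P) A B"
  shows "exq P B A (rei P h \<phi>) = rei P f (exq P B A' \<phi>)"
proof -
  have "h = cross (base P) f (Idt (base P) B)"
    by (rule base.cross_eqI[OF assms(2) base.Idt_hom[OF assms(1)] assms(4,5)])
      (use assms hom_Ob[OF assms(2)] in \<open>simp add: base.products\<close>)
  then show ?thesis using beck_chevalley assms by simp
qed

end


section \<open>Directed colimits indexed by lists\<close>

text \<open>Lists are compared by their sets of entries only, so permuted lists lie below each other
  and the index is in general a directed preorder.\<close>

locale directed_lists =
  fixes J :: "'c list set"
  assumes J_nonempty: "J \<noteq> {}"
    and J_directed: "\<lbrakk>X \<in> J; Y \<in> J\<rbrakk> \<Longrightarrow> \<exists>Z\<in>J. set X \<subseteq> set Z \<and> set Y \<subseteq> set Z"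
begin

text \<open>The filter generated by the tails. As eventual statements, several conditions that each
  hold over some larger list are merged by \<open>eventually_conj\<close>.\<close>

definition large :: "'c list filter" where
  "large = (INF X\<in>J. principal {W \<in> J. set X \<subseteq> set W})"

lemma eventually_large: "eventually Q large \<longleftrightarrow> (\<exists>X\<in>J. \<forall>W\<in>J. set X \<subseteq> set W \<longrightarrow> Q W)"
proof -
  have dir: "\<exists>Z\<in>J. principal {W \<in> J. set Z \<subseteq> set W}
      \<le> inf (principal {W \<in> J. set X \<subseteq> set W}) (principal {W \<in> J. set Y \<subseteq> set W})"
    if "X \<in> J" "Y \<in> J" for X Y
  proof -
    obtain Z where "Z \<in> J" "set X \<subseteq> set Z" "set Y \<subseteq> set Z" using J_directed[OF \<open>X \<in> J\<close> \<open>Y \<in> J\<close>] by blast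
    then show ?thesis by (intro bexI[of _ Z]) auto
  qed
  show ?thesis unfolding large_def
    by (subst eventually_INF_base[OF J_nonempty dir]) (auto simp: eventually_principal)
qed

lemma large_ge: "X \<in> J \<Longrightarrow> \<forall>\<^sub>F W in large. W \<in> J \<and> set X \<subseteq> set W"
  by (auto simp: eventually_large)

lemma large_J: "\<forall>\<^sub>F W in large. W \<in> J"
  using J_nonempty by (auto simp: eventually_large)

text \<open>Every tail contains the list that generates it, so the filter is proper.\<close>

lemma large_obtains:
  assumes "eventually Q large"
  obtains W where "W \<in> J" "Q W"
  using assms by (auto simp: eventually_large)

end

locale directed_colimit = directed_lists J for J :: "'c list set" +
  fixes S :: "'c list \<Rightarrow> 'x set" and tr :: "'c list \<Rightarrow> 'c list \<Rightarrow> 'x \<Rightarrow> 'x"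
  assumes tr_in: "\<lbrakk>X \<in> J; Z \<in> J; set X \<subseteq> set Z; x \<in> S X\<rbrakk> \<Longrightarrow> tr Z X x \<in> S Z"
    and tr_tr: "\<lbrakk>X \<in> J; Z \<in> J; W \<in> J; set X \<subseteq> set Z; set Z \<subseteq> set W; x \<in> S X\<rbrakk>
      \<Longrightarrow> tr W Z (tr Z X x) = tr W X x"
begin

definition reps :: "('x \<times> 'c list) set" where
  "reps = {(x, X). X \<in> J \<and> x \<in> S X}"

text \<open>This has exactly the shape of \<open>arr_rel\<close> and \<open>el_rel\<close>, so that
  both become instances by unfolding.\<close>

definition rel :: "('x \<times> 'c list) rel" where
  "rel = {((x, X), (y, Y)). (x, X) \<in> reps \<and> (y, Y) \<in> reps \<and>
     (\<exists>Z\<in>J. set X \<subseteq> set Z \<and> set Y \<subseteq> set Z \<and> tr Z X x = tr Z Y y)}"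

text \<open>An equality over one list persists over all larger ones by \<open>tr_tr\<close>;
  conversely an eventual equality is attained at a list containing both \<open>X\<close> and
  \<open>Y\<close>.\<close>

lemma rel_iff:
  "((x, X), (y, Y)) \<in> rel \<longleftrightarrow>
    X \<in> J \<and> x \<in> S X \<and> Y \<in> J \<and> y \<in> S Y \<and> (\<forall>\<^sub>F W in large. tr W X x = tr W Y y)"
proof -
  have "(\<forall>\<^sub>F W in large. tr W X x = tr W Y y)
      \<longleftrightarrow> (\<exists>Z\<in>J. set X \<subseteq> set Z \<and> set Y \<subseteq> set Z \<and> tr Z X x = tr Z Y y)"
    if "X \<in> J" "x \<in> S X" "Y \<in> J" "y \<in> S Y"
  proof
    assume "\<forall>\<^sub>F W in large. tr W X x = tr W Y y"
    then have "\<forall>\<^sub>F W in large. tr W X x = tr W Y y \<and> (W \<in> J \<and> set X \<subseteq> set W) \<and> (W \<in> J \<and> set Y \<subseteq> set W)"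
      by (rule eventually_conj[OF _ eventually_conj[OF large_ge large_ge]]) (fact that)+
    then show "\<exists>Z\<in>J. set X \<subseteq> set Z \<and> set Y \<subseteq> set Z \<and> tr Z X x = tr Z Y y"
      by (rule large_obtains) blast
  next
    assume "\<exists>Z\<in>J. set X \<subseteq> set Z \<and> set Y \<subseteq> set Z \<and> tr Z X x = tr Z Y y"
    then obtain Z where Z: "Z \<in> J" "set X \<subseteq> set Z" "set Y \<subseteq> set Z" "tr Z X x = tr Z Y y" by blast
    show "\<forall>\<^sub>F W in large. tr W X x = tr W Y y"
      using large_ge[OF Z(1)] by eventually_elim (metis Z tr_tr that)
  qed
  then show ?thesis by (auto simp: rel_def reps_def)
qed

lemma equiv_rel: "equiv reps rel"
proof (rule equivI)
  show "rel \<subseteq> reps \<times> reps" by (auto simp: rel_def)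
  show "refl_on reps rel" by (auto simp: refl_on_def reps_def rel_iff)
  show "sym rel" by (auto simp: sym_def rel_iff elim: eventually_mono)
  show "trans rel"
  proof (rule transI, clarify)
    fix x X y Y z Z assume "((x, X), (y, Y)) \<in> rel" "((y, Y), (z, Z)) \<in> rel"
    moreover from this have "\<forall>\<^sub>F W in large. tr W X x = tr W Y y" "\<forall>\<^sub>F W in large. tr W Y y = tr W Z z"
      by (simp_all add: rel_iff)
    then have "\<forall>\<^sub>F W in large. tr W X x = tr W Z z" by eventually_elim simp
    ultimately show "((x, X), (z, Z)) \<in> rel" by (simp add: rel_iff)
  qed
qed

lemma class_eq_iff:
  assumes "X \<in> J" "x \<in> S X" "Y \<in> J" "y \<in> S Y"
  shows "rel `` {(x, X)} = rel `` {(y, Y)} \<longleftrightarrow> (\<forall>\<^sub>F W in large. tr W X x = tr W Y y)"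
  using eq_equiv_class_iff[OF equiv_rel, of "(x, X)" "(y, Y)"] assms
  by (simp add: reps_def rel_iff)

lemma class_in: "\<lbrakk>X \<in> J; x \<in> S X\<rbrakk> \<Longrightarrow> rel `` {(x, X)} \<in> reps // rel"
  by (auto intro: quotientI simp: reps_def)

lemma class_mem: "\<lbrakk>X \<in> J; x \<in> S X\<rbrakk> \<Longrightarrow> (x, X) \<in> rel `` {(x, X)}"
  by (auto simp: rel_iff)

lemma mem_class:
  "(y, Y) \<in> rel `` {(x, X)} \<Longrightarrow> Y \<in> J \<and> y \<in> S Y \<and> (\<forall>\<^sub>F W in large. tr W Y y = tr W X x)"
  by (auto simp: rel_iff elim: eventually_mono)

lemma class_tr:
  assumes "X \<in> J" "x \<in> S X" "Z \<in> J" "set X \<subseteq> set Z"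
  shows "rel `` {(tr Z X x, Z)} = rel `` {(x, X)}"
proof -
  have "\<forall>\<^sub>F W in large. tr W Z (tr Z X x) = tr W X x"
    using large_ge[OF assms(3)] by eventually_elim (use assms tr_tr in blast)
  then show ?thesis using class_eq_iff tr_in assms by blast
qed

text \<open>Transport along inclusions gives a representative over every larger list. This is what
  allows finitely many classes to be represented over a common list.\<close>

lemma eventually_class:
  assumes "c \<in> reps // rel"
  shows "\<forall>\<^sub>F W in large. \<exists>x\<in>S W. c = rel `` {(x, W)}"
proof -
  obtain x X where c: "X \<in> J" "x \<in> S X" "c = rel `` {(x, X)}"
    using assms by (auto simp: quotient_def reps_def)
  show ?thesis using large_ge[OF c(1)]
    by eventually_elim (use c class_tr tr_in in blast)
qed

end


section \<open>The category with constants\<close>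

context existential_doctrine
begin

lemma ctxsD: "X \<in> ctxs P \<Longrightarrow> distinct X \<and> fst ` set X \<subseteq> Ob (base P)"
  by (auto simp: ctxs_def)

sublocale ctxs: directed_lists "ctxs P"
proof
  have "[] \<in> ctxs P" by (simp add: ctxs_def)
  then show "ctxs P \<noteq> {}" by blast
  fix X Y assume "X \<in> ctxs P" "Y \<in> ctxs P"
  \<comment> \<open>Any duplicate-free enumeration of the union is an upper bound, as the preorder
    ignores the order of the entries.\<close>
  moreover obtain Z where "set Z = set X \<union> set Y" "distinct Z"
    using finite_distinct_list[of "set X \<union> set Y"] by auto
  ultimately show "\<exists>Z\<in>ctxs P. set X \<subseteq> set Z \<and> set Y \<subseteq> set Z"
    by (intro bexI[of _ Z]) (auto simp: ctxs_def)
qed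

abbreviation cmp (infixr \<open>\<odot>\<close> 75) where "g \<odot> f \<equiv> g \<cdot>\<^bsub>base P\<^esub> f"
abbreviation prd (infixr \<open>\<otimes>\<close> 70) where "A \<otimes> B \<equiv> Prd (base P) A B"
abbreviation pi1 where "pi1 \<equiv> Pr1 (base P)"
abbreviation pi2 where "pi2 \<equiv> Pr2 (base P)"
abbreviation pr where "pr \<equiv> pairing (base P)"
abbreviation L where "L X \<equiv> lprod (base P) X"
abbreviation wk where "wk \<equiv> weak (base P)"
abbreviation H where "H \<equiv> hom (base P)"
abbreviation ob where "ob \<equiv> Ob (base P)"

lemma L_ob: "X \<in> ctxs P \<Longrightarrow> L X \<in> ob"
  by (simp add: base.lprod_Ob ctxsD)

lemma
  assumes "X \<in> ctxs P" "Z \<in> ctxs P" "set X \<subseteq> set Z"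
  shows ctx_proj_Ar: "ctx_proj (base P) Z X \<in> Ar (base P)"
    and Dom_ctx_proj: "Dom (base P) (ctx_proj (base P) Z X) = L Z"
    and Cod_ctx_proj: "Cod (base P) (ctx_proj (base P) Z X) = L X"
    and weak_eq: "A \<in> ob \<Longrightarrow>
      wk A Z X = pr (ctx_proj (base P) Z X \<odot> pi1 (L Z) A) (pi2 (L Z) A)"
proof -
  have "ctx_proj (base P) Z X \<in> H (L Z) (L X)"
    by (rule base.ctx_proj_hom) (use ctxsD assms in auto)
  then show *: "ctx_proj (base P) Z X \<in> Ar (base P)"
    "Dom (base P) (ctx_proj (base P) Z X) = L Z" "Cod (base P) (ctx_proj (base P) Z X) = L X"
    by (auto simp: base.hom_iff)
  show "A \<in> ob \<Longrightarrow> wk A Z X = pr (ctx_proj (base P) Z X \<odot> pi1 (L Z) A) (pi2 (L Z) A)"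
    using L_ob[OF assms(2)] by (simp add: * weak_def cross_def base.products)
qed

lemmas weakening = ctx_proj_Ar Dom_ctx_proj Cod_ctx_proj weak_eq base.hom_iff base.products L_ob

lemma weak_hom:
  "\<lbrakk>X \<in> ctxs P; Z \<in> ctxs P; set X \<subseteq> set Z; A \<in> ob\<rbrakk> \<Longrightarrow> wk A Z X \<in> H (L Z \<otimes> A) (L X \<otimes> A)"
  by (simp add: weakening)

lemma weak_weak:
  assumes "X \<in> ctxs P" "Z \<in> ctxs P" "W \<in> ctxs P" "set X \<subseteq> set Z" "set Z \<subseteq> set W" "A \<in> ob"
  shows "wk A Z X \<odot> wk A W Z = wk A W X"
proof -
  have "set X \<subseteq> set W" using assms by blast
  have "ctx_proj (base P) Z X \<odot> ctx_proj (base P) W Z = ctx_proj (base P) W X"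
    by (rule base.ctx_proj_Cmp) (use assms ctxsD in auto)
  \<comment> \<open>Associating to the left, against the rewrite rules, exposes the composite of
    list projections computed just before.\<close>
  moreover have "ctx_proj (base P) Z X \<odot> (ctx_proj (base P) W Z \<odot> pi1 (L W) A)
      = (ctx_proj (base P) Z X \<odot> ctx_proj (base P) W Z) \<odot> pi1 (L W) A"
    using assms by (subst base.assoc) (simp_all add: weakening)
  ultimately show ?thesis using assms \<open>set X \<subseteq> set W\<close> by (simp add: weakening)
qed

section \<open>Arrows and elements with constants as directed colimits\<close>

lemma arr_colimit:
  assumes "A \<in> ob"
  shows "directed_colimit (ctxs P) (\<lambda>X. H (L X \<otimes> A) B) (\<lambda>W X f. f \<odot> wk A W X)"
proof unfold_locales
  show "f \<odot> wk A Z X \<in> H (L Z \<otimes> A) B"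
    if "X \<in> ctxs P" "Z \<in> ctxs P" "set X \<subseteq> set Z" "f \<in> H (L X \<otimes> A) B" for X Z f
    using base.Cmp_hom weak_hom that assms by blast
  show "(f \<odot> wk A Z X) \<odot> wk A W Z = f \<odot> wk A W X"
    if "X \<in> ctxs P" "Z \<in> ctxs P" "W \<in> ctxs P" "set X \<subseteq> set Z" "set Z \<subseteq> set W"
      "f \<in> H (L X \<otimes> A) B" for X Z W f
    using base.Cmp_assoc[OF weak_hom[OF that(2,3,5) assms] weak_hom[OF that(1,2,4) assms] that(6)]
      weak_weak[OF that(1-5) assms] by simp
qed

lemma el_colimit:
  assumes "A \<in> ob"
  shows "directed_colimit (ctxs P) (\<lambda>X. carrier (fib P (L X \<otimes> A))) (\<lambda>W X \<alpha>. rei P (wk A W X) \<alpha>)"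
proof unfold_locales
  show "rei P (wk A Z X) \<alpha> \<in> carrier (fib P (L Z \<otimes> A))"
    if "X \<in> ctxs P" "Z \<in> ctxs P" "set X \<subseteq> set Z" "\<alpha> \<in> carrier (fib P (L X \<otimes> A))" for X Z \<alpha>
    using rei_in weak_hom that assms by blast
  show "rei P (wk A W Z) (rei P (wk A Z X) \<alpha>) = rei P (wk A W X) \<alpha>"
    if "X \<in> ctxs P" "Z \<in> ctxs P" "W \<in> ctxs P" "set X \<subseteq> set Z" "set Z \<subseteq> set W"
      "\<alpha> \<in> carrier (fib P (L X \<otimes> A))" for X Z W \<alpha>
    using rei_Cmp[OF weak_hom[OF that(2,3,5) assms] weak_hom[OF that(1,2,4) assms] that(6)]
      weak_weak[OF that(1-5) assms] by simp
qed

definition germ :: "'a \<Rightarrow> 'a \<Rightarrow> 'b \<Rightarrow> ('a, 'c) ctx \<Rightarrow> ('a, 'b, 'c) under_arr" where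
  "germ A B f X = (A, B, arr_class P A B (f, X))"

lemma hom_under_cat_iff:
  "F \<in> hom (under_cat P) A B \<longleftrightarrow>
    A \<in> ob \<and> B \<in> ob \<and> (\<exists>c \<in> arr_reps P A B // arr_rel P A B. F = (A, B, c))"
  by (auto simp: hom_def under_cat_def)

text \<open>The interface to classes of arrows, imported from the abstract colimit with
  precomposition by weakening as transport.\<close>

lemma
  assumes "A \<in> ob"
  shows germ_eq_iff: "\<lbrakk>X \<in> ctxs P; f \<in> H (L X \<otimes> A) B; Y \<in> ctxs P; g \<in> H (L Y \<otimes> A) B\<rbrakk> \<Longrightarrow>
      germ A B f X = germ A B g Y \<longleftrightarrow> (\<forall>\<^sub>F W in ctxs.large. f \<odot> wk A W X = g \<odot> wk A W Y)"
    and germ_hom: "\<lbrakk>B \<in> ob; X \<in> ctxs P; f \<in> H (L X \<otimes> A) B\<rbrakk> \<Longrightarrow> germ A B f X \<in> hom (under_cat P) A B"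
    and germ_weak: "\<lbrakk>X \<in> ctxs P; f \<in> H (L X \<otimes> A) B; Z \<in> ctxs P; set X \<subseteq> set Z\<rbrakk>
      \<Longrightarrow> germ A B (f \<odot> wk A Z X) Z = germ A B f X"
    and eventually_germ: "F \<in> hom (under_cat P) A B
      \<Longrightarrow> \<forall>\<^sub>F W in ctxs.large. \<exists>f\<in>H (L W \<otimes> A) B. F = germ A B f W"
    and mem_arr_class: "(g, Y) \<in> arr_class P A B (f, X)
      \<Longrightarrow> Y \<in> ctxs P \<and> g \<in> H (L Y \<otimes> A) B \<and> (\<forall>\<^sub>F W in ctxs.large. g \<odot> wk A W Y = f \<odot> wk A W X)"
    and arr_class_self: "\<lbrakk>X \<in> ctxs P; f \<in> H (L X \<otimes> A) B\<rbrakk> \<Longrightarrow> (f, X) \<in> arr_class P A B (f, X)"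
proof -
  interpret c: directed_colimit "ctxs P" "\<lambda>X. H (L X \<otimes> A) B" "\<lambda>W X f. f \<odot> wk A W X"
    by (rule arr_colimit[OF assms])
  have reps: "arr_reps P A B = c.reps" by (simp add: arr_reps_def c.reps_def)
  have rel: "arr_rel P A B = c.rel" by (simp add: arr_rel_def c.rel_def reps)
  note defs = germ_def arr_class_def rel reps
  show "germ A B f X = germ A B g Y \<longleftrightarrow> (\<forall>\<^sub>F W in ctxs.large. f \<odot> wk A W X = g \<odot> wk A W Y)"
    if "X \<in> ctxs P" "f \<in> H (L X \<otimes> A) B" "Y \<in> ctxs P" "g \<in> H (L Y \<otimes> A) B"
    using c.class_eq_iff that by (simp add: defs)
  show "germ A B f X \<in> hom (under_cat P) A B" if "B \<in> ob" "X \<in> ctxs P" "f \<in> H (L X \<otimes> A) B"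
    using c.class_in that assms by (simp add: defs hom_under_cat_iff)
  show "germ A B (f \<odot> wk A Z X) Z = germ A B f X"
    if "X \<in> ctxs P" "f \<in> H (L X \<otimes> A) B" "Z \<in> ctxs P" "set X \<subseteq> set Z"
    using c.class_tr that by (simp add: defs)
  show "\<forall>\<^sub>F W in ctxs.large. \<exists>f\<in>H (L W \<otimes> A) B. F = germ A B f W" if F: "F \<in> hom (under_cat P) A B"
  proof -
    obtain c where "F = (A, B, c)" "c \<in> c.reps // c.rel"
      using F[unfolded hom_under_cat_iff rel reps] by blast
    then show ?thesis using c.eventually_class by (simp add: defs)
  qed
  show "Y \<in> ctxs P \<and> g \<in> H (L Y \<otimes> A) B \<and> (\<forall>\<^sub>F W in ctxs.large. g \<odot> wk A W Y = f \<odot> wk A W X)"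
    if "(g, Y) \<in> arr_class P A B (f, X)"
    using that c.mem_class by (simp add: defs)
  show "(f, X) \<in> arr_class P A B (f, X)" if "X \<in> ctxs P" "f \<in> H (L X \<otimes> A) B"
    using c.class_mem that by (simp add: defs)
qed

text \<open>The coKleisli extension of \<open>f\<close> for the comonad $\Pi Z \times -$.\<close>

definition kext :: "('a, 'c) ctx \<Rightarrow> 'a \<Rightarrow> 'b \<Rightarrow> 'b" where
  "kext Z A f = pr (pi1 (L Z) A) f"

lemma kext_hom: "\<lbrakk>Z \<in> ctxs P; A \<in> ob; f \<in> H (L Z \<otimes> A) B\<rbrakk> \<Longrightarrow> kext Z A f \<in> H (L Z \<otimes> A) (L Z \<otimes> B)"
  by (auto simp: kext_def weakening)

text \<open>Both sides project the constants from \<open>W\<close> to \<open>Z\<close> and apply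
  \<open>f\<close> to the weakened context. This naturality carries composition and reindexing from
  one list to another.\<close>

lemma weak_kext:
  assumes "Z \<in> ctxs P" "W \<in> ctxs P" "set Z \<subseteq> set W" "A \<in> ob" "f \<in> H (L Z \<otimes> A) B"
  shows "kext Z A f \<odot> wk A W Z = wk B W Z \<odot> kext W A (f \<odot> wk A W Z)"
proof -
  have "B \<in> ob" using hom_Ob assms by blast
  then show ?thesis using assms by (auto simp: kext_def weakening)
qed

text \<open>\<open>under_comp\<close> is a union over all pairs of representatives over a common
  list. All members of this union turn out to be one class, so a single pair computes it.\<close>

lemma under_comp_germ:
  assumes "A \<in> ob" "Z \<in> ctxs P" and f: "f \<in> H (L Z \<otimes> A) B" and g: "g \<in> H (L Z \<otimes> B) D"
  shows "Cmp (under_cat P) (germ B D g Z) (germ A B f Z) = germ A D (g \<odot> kext Z A f) Z"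
proof -
  have ob: "B \<in> ob" "D \<in> ob" using hom_Ob assms by blast+
  have gf: "g \<odot> kext Z A f \<in> H (L Z \<otimes> A) D" using assms kext_hom base.Cmp_hom by blast
  have *: "arr_class P A D (g' \<odot> pr (pi1 (L Z') A) f', Z') = arr_class P A D (g \<odot> kext Z A f, Z)"
    if f'_in: "(f', Z') \<in> arr_class P A B (f, Z)" and g'_in: "(g', Z') \<in> arr_class P B D (g, Z)"
    for f' g' Z'
  proof -
    note f' = mem_arr_class[OF assms(1) f'_in] and g' = mem_arr_class[OF ob(1) g'_in]
    have gf': "g' \<odot> kext Z' A f' \<in> H (L Z' \<otimes> A) D" using assms f' g' kext_hom base.Cmp_hom by blast
    \<comment> \<open>Over large \<open>W\<close> the representatives \<open>f'\<close> and
      \<open>f\<close>, and likewise \<open>g'\<close> and \<open>g\<close>, become equal, and by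
      \<open>weak_kext\<close> the weakened composite depends only on the weakened arrows.\<close>
    have "\<forall>\<^sub>F W in ctxs.large. (g' \<odot> kext Z' A f') \<odot> wk A W Z' = (g \<odot> kext Z A f) \<odot> wk A W Z"
      using f'[THEN conjunct2, THEN conjunct2] g'[THEN conjunct2, THEN conjunct2]
        ctxs.large_ge[OF assms(2)] ctxs.large_ge[OF f'[THEN conjunct1]]
    proof eventually_elim
      case (elim W)
      then have W: "W \<in> ctxs P" by blast
      have *: "(g0 \<odot> kext Z0 A f0) \<odot> wk A W Z0 = (g0 \<odot> wk B W Z0) \<odot> kext W A (f0 \<odot> wk A W Z0)"
        if Z0: "Z0 \<in> ctxs P" "set Z0 \<subseteq> set W" and f0: "f0 \<in> H (L Z0 \<otimes> A) B"
          and g0: "g0 \<in> H (L Z0 \<otimes> B) D" for g0 f0 Z0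
      proof -
        note wA = weak_hom[OF Z0(1) W Z0(2) assms(1)] and wB = weak_hom[OF Z0(1) W Z0(2) ob(1)]
        note k = kext_hom[OF Z0(1) assms(1) f0] kext_hom[OF W assms(1) base.Cmp_hom[OF wA f0]]
        show ?thesis
          using base.Cmp_assoc[OF wA k(1) g0] base.Cmp_assoc[OF k(2) wB g0]
            weak_kext[OF Z0(1) W Z0(2) assms(1) f0] by simp
      qed
      from elim have "set Z' \<subseteq> set W" "set Z \<subseteq> set W" by blast+
      with *[of Z' f' g'] *[of Z f g] f' g' f g assms(2) elim(1,2) show ?case by simp
    qed
    then have "germ A D (g' \<odot> kext Z' A f') Z' = germ A D (g \<odot> kext Z A f) Z"
      using germ_eq_iff assms f' gf gf' by blast
    then show ?thesis by (simp add: germ_def kext_def)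
  qed
  let ?M = "{arr_class P A D (g' \<odot> pr (pi1 (L Z') A) f', Z') | f' g' Z'.
    (f', Z') \<in> arr_class P A B (f, Z) \<and> (g', Z') \<in> arr_class P B D (g, Z)}"
  have "(f, Z) \<in> arr_class P A B (f, Z)" "(g, Z) \<in> arr_class P B D (g, Z)"
    using arr_class_self assms ob by blast+
  then have "arr_class P A D (g \<odot> pr (pi1 (L Z) A) f, Z) \<in> ?M" by blast
  moreover have "c = arr_class P A D (g \<odot> kext Z A f, Z)" if "c \<in> ?M" for c using that * by blast
  ultimately have "?M = {arr_class P A D (g \<odot> kext Z A f, Z)}"
    unfolding kext_def by blast
  then have "\<Union>?M = arr_class P A D (g \<odot> kext Z A f, Z)" by simp
  then show ?thesis unfolding germ_def under_comp_def under_cat_def by simp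
qed

text \<open>A base arrow ignores the constants, so it is represented over every list and not only
  the empty one; identities and projections can thus be taken over whatever list the other arrows
  use.\<close>

lemma base_arr_germ:
  assumes "f \<in> H A B" "Z \<in> ctxs P"
  shows "base_arr P f = germ A B (f \<odot> pi2 (L Z) A) Z"
proof -
  have [simp]: "Dom (base P) f = A" "Cod (base P) f = B" using assms by (auto simp: base.hom_iff)
  have A: "A \<in> ob" using hom_Ob assms by blast
  let ?n = "[] :: ('a, 'c) ctx"
  have nil: "?n \<in> ctxs P" by (simp add: ctxs_def)
  have "germ A B ((f \<odot> pi2 (L ?n) A) \<odot> wk A Z ?n) Z = germ A B (f \<odot> pi2 (L ?n) A) ?n"
    by (rule germ_weak[OF A nil]) (use assms A L_ob[OF nil] in \<open>simp_all add: base.hom_iff base.products\<close>)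
  moreover have "(f \<odot> pi2 (L ?n) A) \<odot> wk A Z ?n = f \<odot> pi2 (L Z) A"
    using assms A nil by (simp add: weakening)
  ultimately show ?thesis by (simp add: base_arr_def germ_def)
qed


section \<open>Finite products in the category with constants\<close>

lemma under_cat_simps:
  "Ob (under_cat P) = ob" "Trm (under_cat P) = Trm (base P)" "Prd (under_cat P) = Prd (base P)"
  by (simp_all add: under_cat_def)

lemma Idt_under:
  "\<lbrakk>A \<in> ob; Z \<in> ctxs P\<rbrakk> \<Longrightarrow> Idt (under_cat P) A = germ A A (pi2 (L Z) A) Z"
  using base_arr_germ[OF base.Idt_hom, of A Z] by (simp add: under_cat_def weakening)

lemma Pr1_under:
  "\<lbrakk>A \<in> ob; B \<in> ob; Z \<in> ctxs P\<rbrakk>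
    \<Longrightarrow> Pr1 (under_cat P) A B = germ (A \<otimes> B) A (pi1 A B \<odot> pi2 (L Z) (A \<otimes> B)) Z"
  using base_arr_germ[OF base.Pr1_hom, of A B Z] by (simp add: under_cat_def)

lemma Pr2_under:
  "\<lbrakk>A \<in> ob; B \<in> ob; Z \<in> ctxs P\<rbrakk>
    \<Longrightarrow> Pr2 (under_cat P) A B = germ (A \<otimes> B) B (pi2 A B \<odot> pi2 (L Z) (A \<otimes> B)) Z"
  using base_arr_germ[OF base.Pr2_hom, of A B Z] by (simp add: under_cat_def)

lemma hom_under_ob: "F \<in> hom (under_cat P) A B \<Longrightarrow> A \<in> ob \<and> B \<in> ob"
  by (simp add: hom_under_cat_iff)

lemma under_Cmp_hom:
  assumes "F \<in> hom (under_cat P) A B" "G \<in> hom (under_cat P) B D"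
  shows "Cmp (under_cat P) G F \<in> hom (under_cat P) A D"
proof -
  have ob: "A \<in> ob" "B \<in> ob" "D \<in> ob" using assms hom_under_ob by blast+
  from eventually_conj[OF ctxs.large_J eventually_conj[OF
      eventually_germ[OF ob(1) assms(1)] eventually_germ[OF ob(2) assms(2)]]]
  obtain Z f g where Z: "Z \<in> ctxs P" and fg: "f \<in> H (L Z \<otimes> A) B" "F = germ A B f Z"
    "g \<in> H (L Z \<otimes> B) D" "G = germ B D g Z"
    by (rule ctxs.large_obtains) blast
  have "g \<odot> kext Z A f \<in> H (L Z \<otimes> A) D"
    using base.Cmp_hom[OF kext_hom[OF Z ob(1) fg(1)] fg(3)] .
  then show ?thesis using fg ob Z by (simp add: under_comp_germ germ_hom)
qed

text \<open>A projection does not look at the constants, so composing with it is plain composition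
  of representatives, with no coKleisli extension left over.\<close>

lemma Pr_under_Cmp:
  assumes "A \<in> ob" "B \<in> ob" "D \<in> ob" "Z \<in> ctxs P" "h \<in> H (L Z \<otimes> D) (A \<otimes> B)"
  shows "Cmp (under_cat P) (Pr1 (under_cat P) A B) (germ D (A \<otimes> B) h Z) = germ D A (pi1 A B \<odot> h) Z"
    and "Cmp (under_cat P) (Pr2 (under_cat P) A B) (germ D (A \<otimes> B) h Z) = germ D B (pi2 A B \<odot> h) Z"
proof -
  have "pi1 A B \<odot> pi2 (L Z) (A \<otimes> B) \<in> H (L Z \<otimes> (A \<otimes> B)) A"
    "pi2 A B \<odot> pi2 (L Z) (A \<otimes> B) \<in> H (L Z \<otimes> (A \<otimes> B)) B"
    using assms by (auto simp: weakening)
  moreover have "(pi1 A B \<odot> pi2 (L Z) (A \<otimes> B)) \<odot> kext Z D h = pi1 A B \<odot> h"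
    "(pi2 A B \<odot> pi2 (L Z) (A \<otimes> B)) \<odot> kext Z D h = pi2 A B \<odot> h"
    using assms by (auto simp: weakening kext_def)
  ultimately show "Cmp (under_cat P) (Pr1 (under_cat P) A B) (germ D (A \<otimes> B) h Z) = germ D A (pi1 A B \<odot> h) Z"
    and "Cmp (under_cat P) (Pr2 (under_cat P) A B) (germ D (A \<otimes> B) h Z) = germ D B (pi2 A B \<odot> h) Z"
    using assms by (simp_all add: Pr1_under[where Z = Z] Pr2_under[where Z = Z] under_comp_germ)
qed

lemma under_cat_fp_category: "fp_category (under_cat P)"
proof (rule fp_category.intro, unfold under_cat_simps)
  let ?U = "under_cat P"
  note two = eventually_conj[OF ctxs.large_J eventually_conj[OF eventually_germ eventually_germ]]
  have ob: "Dom ?U F \<in> ob" "Cod ?U F \<in> ob" if "F \<in> Ar ?U" for F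
    using hom_under_ob[of F "Dom ?U F" "Cod ?U F"] that by (auto simp: hom_def)
  then show "Dom ?U F \<in> ob" "Cod ?U F \<in> ob" if "F \<in> Ar ?U" for F using that by blast+
  obtain Z0 where Z0: "Z0 \<in> ctxs P" using ctxs.J_nonempty by blast
  show "Idt ?U A \<in> hom ?U A A" if A: "A \<in> ob" for A
    unfolding Idt_under[OF A Z0] by (rule germ_hom[OF A A Z0]) (use A Z0 in \<open>simp add: weakening\<close>)
  show "Cmp ?U G F \<in> hom ?U A D" if "F \<in> hom ?U A B" "G \<in> hom ?U B D" for F G A B D
    using that by (rule under_Cmp_hom)
  show "Cmp ?U K (Cmp ?U G F) = Cmp ?U (Cmp ?U K G) F"
    if a: "F \<in> hom ?U A B" "G \<in> hom ?U B D" "K \<in> hom ?U D E" for F G K A B D E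
  proof -
    have ob: "A \<in> ob" "B \<in> ob" "D \<in> ob" "E \<in> ob" using a hom_under_ob by blast+
    from eventually_conj[OF eventually_germ[OF ob(3) a(3)] two[OF ob(1) a(1) ob(2) a(2)]]
    obtain Z f g k where Z: "Z \<in> ctxs P" and fgk: "f \<in> H (L Z \<otimes> A) B" "F = germ A B f Z"
      "g \<in> H (L Z \<otimes> B) D" "G = germ B D g Z" "k \<in> H (L Z \<otimes> D) E" "K = germ D E k Z"
      by (rule ctxs.large_obtains) blast
    have t: "g \<odot> kext Z A f \<in> H (L Z \<otimes> A) D" "k \<odot> kext Z B g \<in> H (L Z \<otimes> B) E"
      using base.Cmp_hom[OF kext_hom[OF Z ob(1) fgk(1)] fgk(3)]
        base.Cmp_hom[OF kext_hom[OF Z ob(2) fgk(3)] fgk(5)] .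
    \<comment> \<open>Associativity of coKleisli composition, now an equation between arrows of the
      base category.\<close>
    have "k \<odot> kext Z A (g \<odot> kext Z A f) = (k \<odot> kext Z B g) \<odot> kext Z A f"
      using fgk ob Z by (auto simp: weakening kext_def)
    then show ?thesis using Z ob fgk t by (simp add: under_comp_germ)
  qed
  show "Cmp ?U (Idt ?U B) F = F" "Cmp ?U F (Idt ?U A) = F" if a: "F \<in> hom ?U A B" for F A B
  proof -
    have ob: "A \<in> ob" "B \<in> ob" using a hom_under_ob by blast+
    from eventually_conj[OF ctxs.large_J eventually_germ[OF ob(1) a]]
    obtain Z f where Z: "Z \<in> ctxs P" and f: "f \<in> H (L Z \<otimes> A) B" "F = germ A B f Z"
      by (rule ctxs.large_obtains) blast
    have t: "pi2 (L Z) A \<in> H (L Z \<otimes> A) A" "pi2 (L Z) B \<in> H (L Z \<otimes> B) B"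
      using ob Z by (simp_all add: weakening)
    have "pi2 (L Z) B \<odot> kext Z A f = f" "f \<odot> kext Z A (pi2 (L Z) A) = f"
      using f ob Z by (auto simp: weakening kext_def)
    then show "Cmp ?U (Idt ?U B) F = F" "Cmp ?U F (Idt ?U A) = F"
      using ob Z f t by (simp_all add: Idt_under[where Z = Z] under_comp_germ)
  qed
  show "Trm (base P) \<in> ob" "\<And>A B. \<lbrakk>A \<in> ob; B \<in> ob\<rbrakk> \<Longrightarrow> A \<otimes> B \<in> ob" by (simp_all add: base.typing)
  show "\<exists>!F. F \<in> hom ?U A (Trm (base P))" if A: "A \<in> ob" for A
  proof (rule ex_ex1I)
    have "bang (base P) (L Z0 \<otimes> A) \<in> H (L Z0 \<otimes> A) (Trm (base P))"
      using A Z0 by (simp add: base.bang_hom weakening)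
    then show "\<exists>F. F \<in> hom ?U A (Trm (base P))"
      using germ_hom[OF A base.Trm_Ob Z0] by blast
    fix F G assume F: "F \<in> hom ?U A (Trm (base P))" and G: "G \<in> hom ?U A (Trm (base P))"
    from two[OF A F A G] obtain Z f g where "f \<in> H (L Z \<otimes> A) (Trm (base P))" "g \<in> H (L Z \<otimes> A) (Trm (base P))"
      "F = germ A (Trm (base P)) f Z" "G = germ A (Trm (base P)) g Z"
      by (rule ctxs.large_obtains) blast
    then show "F = G" using base.to_Trm_eq by blast
  qed
  show "Pr1 ?U A B \<in> hom ?U (A \<otimes> B) A" "Pr2 ?U A B \<in> hom ?U (A \<otimes> B) B"
    if "A \<in> ob" "B \<in> ob" for A B
    unfolding Pr1_under[OF that Z0] Pr2_under[OF that Z0]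
    by (rule germ_hom; use that Z0 in \<open>simp add: weakening\<close>)+
  show "\<exists>!K. K \<in> hom ?U D (A \<otimes> B) \<and> Cmp ?U (Pr1 ?U A B) K = F \<and> Cmp ?U (Pr2 ?U A B) K = G"
    if F: "F \<in> hom ?U D A" and G: "G \<in> hom ?U D B" for F G A B D
  proof -
    have ob: "A \<in> ob" "B \<in> ob" "D \<in> ob" "A \<otimes> B \<in> ob" using F G hom_under_ob base.Prd_Ob by blast+
    note Pr_Cmp = Pr_under_Cmp[OF ob(1-3)]
    show ?thesis
    proof (rule ex_ex1I)
      from two[OF ob(3) F ob(3) G] obtain Z f g where Z: "Z \<in> ctxs P"
        and fg: "f \<in> H (L Z \<otimes> D) A" "g \<in> H (L Z \<otimes> D) B" "F = germ D A f Z" "G = germ D B g Z"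
        by (rule ctxs.large_obtains) blast
      have "pr f g \<in> H (L Z \<otimes> D) (A \<otimes> B)" "pi1 A B \<odot> pr f g = f" "pi2 A B \<odot> pr f g = g"
        using base.pairing_props fg by blast+
      then show "\<exists>K. K \<in> hom ?U D (A \<otimes> B) \<and> Cmp ?U (Pr1 ?U A B) K = F \<and> Cmp ?U (Pr2 ?U A B) K = G"
        using Pr_Cmp[OF Z] germ_hom[OF ob(3,4) Z] fg by metis
    next
      fix K K'
      assume K: "K \<in> hom ?U D (A \<otimes> B) \<and> Cmp ?U (Pr1 ?U A B) K = F \<and> Cmp ?U (Pr2 ?U A B) K = G"
        and K': "K' \<in> hom ?U D (A \<otimes> B) \<and> Cmp ?U (Pr1 ?U A B) K' = F \<and> Cmp ?U (Pr2 ?U A B) K' = G"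
      from two[OF ob(3) K[THEN conjunct1] ob(3) K'[THEN conjunct1]] obtain Z k k' where Z: "Z \<in> ctxs P"
        and kk: "k \<in> H (L Z \<otimes> D) (A \<otimes> B)" "k' \<in> H (L Z \<otimes> D) (A \<otimes> B)"
          "K = germ D (A \<otimes> B) k Z" "K' = germ D (A \<otimes> B) k' Z"
        by (rule ctxs.large_obtains) blast
      have t: "pi1 A B \<odot> k \<in> H (L Z \<otimes> D) A" "pi1 A B \<odot> k' \<in> H (L Z \<otimes> D) A"
        "pi2 A B \<odot> k \<in> H (L Z \<otimes> D) B" "pi2 A B \<odot> k' \<in> H (L Z \<otimes> D) B"
        using kk base.Cmp_hom base.Pr1_hom base.Pr2_hom ob by blast+
      have "germ D A (pi1 A B \<odot> k) Z = germ D A (pi1 A B \<odot> k') Z"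
        "germ D B (pi2 A B \<odot> k) Z = germ D B (pi2 A B \<odot> k') Z"
        using Pr_Cmp[OF Z kk(1)] Pr_Cmp[OF Z kk(2)] K K' kk by simp_all
      then have "\<forall>\<^sub>F W in ctxs.large. (pi1 A B \<odot> k) \<odot> wk D W Z = (pi1 A B \<odot> k') \<odot> wk D W Z"
        "\<forall>\<^sub>F W in ctxs.large. (pi2 A B \<odot> k) \<odot> wk D W Z = (pi2 A B \<odot> k') \<odot> wk D W Z"
        using germ_eq_iff[OF ob(3) Z _ Z] t by blast+
      \<comment> \<open>The projections of \<open>k\<close> and \<open>k'\<close> agree only after
        weakening, so uniqueness of pairing in the base category is applied over each large
        \<open>W\<close>.\<close>
      with ctxs.large_ge[OF Z] have "\<forall>\<^sub>F W in ctxs.large. k \<odot> wk D W Z = k' \<odot> wk D W Z"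
      proof eventually_elim
        case (elim W)
        then have w: "wk D W Z \<in> H (L W \<otimes> D) (L Z \<otimes> D)" using weak_hom Z ob by blast
        show ?case
        proof (rule base.Prd_eqI)
          show "k \<odot> wk D W Z \<in> H (L W \<otimes> D) (A \<otimes> B)" "k' \<odot> wk D W Z \<in> H (L W \<otimes> D) (A \<otimes> B)"
            using base.Cmp_hom[OF w] kk by blast+
          show "pi1 A B \<odot> (k \<odot> wk D W Z) = pi1 A B \<odot> (k' \<odot> wk D W Z)"
            "pi2 A B \<odot> (k \<odot> wk D W Z) = pi2 A B \<odot> (k' \<odot> wk D W Z)"
            using elim kk(1,2)[THEN base.Cmp_assoc[OF w]] base.Pr1_hom[OF ob(1,2)] base.Pr2_hom[OF ob(1,2)]
            by simp_all
        qed (use ob in auto)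
      qed
      then show "K = K'" using germ_eq_iff[OF ob(3) Z kk(1) Z kk(2)] kk by blast
    qed
  qed
qed

end


section \<open>The doctrine with constants\<close>

context existential_doctrine
begin

abbreviation Fb where "Fb A \<equiv> carrier (fib P A)"
abbreviation U where "U \<equiv> under_doctrine P"

section \<open>Fibres, order and reindexing with constants\<close>

lemma el_reps_colimit:
  assumes "A \<in> ob"
  shows "el_reps P A = directed_colimit.reps (ctxs P) (\<lambda>X. Fb (L X \<otimes> A))"
    and "el_rel P A = directed_colimit.rel (ctxs P) (\<lambda>X. Fb (L X \<otimes> A)) (\<lambda>W X \<alpha>. rei P (wk A W X) \<alpha>)"
proof -
  interpret c: directed_colimit "ctxs P" "\<lambda>X. Fb (L X \<otimes> A)" "\<lambda>W X \<alpha>. rei P (wk A W X) \<alpha>"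
    by (rule el_colimit[OF assms])
  show reps: "el_reps P A = c.reps" by (simp add: el_reps_def c.reps_def)
  show "el_rel P A = c.rel" by (simp add: el_rel_def c.rel_def reps)
qed

lemma under_doctrine_simps:
  "base U = under_cat P" "carrier (fib U A) = el_reps P A // el_rel P A"
  "le (fib U A) = under_le P A" "eq (fib U A) = (=)" "rei U = under_rei P"
  by (simp_all add: under_doctrine_def)

lemma
  assumes "A \<in> ob"
  shows el_eq_iff: "\<lbrakk>X \<in> ctxs P; \<alpha> \<in> Fb (L X \<otimes> A); Y \<in> ctxs P; \<beta> \<in> Fb (L Y \<otimes> A)\<rbrakk> \<Longrightarrow>
      el_class P A (\<alpha>, X) = el_class P A (\<beta>, Y)
        \<longleftrightarrow> (\<forall>\<^sub>F W in ctxs.large. rei P (wk A W X) \<alpha> = rei P (wk A W Y) \<beta>)"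
    and el_in: "\<lbrakk>X \<in> ctxs P; \<alpha> \<in> Fb (L X \<otimes> A)\<rbrakk> \<Longrightarrow> el_class P A (\<alpha>, X) \<in> carrier (fib U A)"
    and el_weak: "\<lbrakk>X \<in> ctxs P; \<alpha> \<in> Fb (L X \<otimes> A); Z \<in> ctxs P; set X \<subseteq> set Z\<rbrakk>
      \<Longrightarrow> el_class P A (rei P (wk A Z X) \<alpha>, Z) = el_class P A (\<alpha>, X)"
    and eventually_el: "a \<in> carrier (fib U A)
      \<Longrightarrow> \<forall>\<^sub>F W in ctxs.large. \<exists>\<alpha>\<in>Fb (L W \<otimes> A). a = el_class P A (\<alpha>, W)"
    and mem_el_class: "(\<beta>, Y) \<in> el_class P A (\<alpha>, X) \<Longrightarrow> Y \<in> ctxs P \<and> \<beta> \<in> Fb (L Y \<otimes> A) \<and>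
      (\<forall>\<^sub>F W in ctxs.large. rei P (wk A W Y) \<beta> = rei P (wk A W X) \<alpha>)"
    and el_class_self: "\<lbrakk>X \<in> ctxs P; \<alpha> \<in> Fb (L X \<otimes> A)\<rbrakk> \<Longrightarrow> (\<alpha>, X) \<in> el_class P A (\<alpha>, X)"
proof -
  interpret c: directed_colimit "ctxs P" "\<lambda>X. Fb (L X \<otimes> A)" "\<lambda>W X \<alpha>. rei P (wk A W X) \<alpha>"
    by (rule el_colimit[OF assms])
  note defs = el_class_def el_reps_colimit[OF assms] under_doctrine_simps
  show "el_class P A (\<alpha>, X) = el_class P A (\<beta>, Y)
        \<longleftrightarrow> (\<forall>\<^sub>F W in ctxs.large. rei P (wk A W X) \<alpha> = rei P (wk A W Y) \<beta>)"
    if "X \<in> ctxs P" "\<alpha> \<in> Fb (L X \<otimes> A)" "Y \<in> ctxs P" "\<beta> \<in> Fb (L Y \<otimes> A)"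
    using c.class_eq_iff that by (simp add: defs)
  show "el_class P A (\<alpha>, X) \<in> carrier (fib U A)" if "X \<in> ctxs P" "\<alpha> \<in> Fb (L X \<otimes> A)"
    using c.class_in that by (simp add: defs)
  show "el_class P A (rei P (wk A Z X) \<alpha>, Z) = el_class P A (\<alpha>, X)"
    if "X \<in> ctxs P" "\<alpha> \<in> Fb (L X \<otimes> A)" "Z \<in> ctxs P" "set X \<subseteq> set Z"
    using c.class_tr that by (simp add: defs)
  show "\<forall>\<^sub>F W in ctxs.large. \<exists>\<alpha>\<in>Fb (L W \<otimes> A). a = el_class P A (\<alpha>, W)"
    if "a \<in> carrier (fib U A)"
    using c.eventually_class that by (simp add: defs)
  show "Y \<in> ctxs P \<and> \<beta> \<in> Fb (L Y \<otimes> A) \<and> (\<forall>\<^sub>F W in ctxs.large. rei P (wk A W Y) \<beta> = rei P (wk A W X) \<alpha>)"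
    if "(\<beta>, Y) \<in> el_class P A (\<alpha>, X)"
    using c.mem_class that by (simp add: defs)
  show "(\<alpha>, X) \<in> el_class P A (\<alpha>, X)" if "X \<in> ctxs P" "\<alpha> \<in> Fb (L X \<otimes> A)"
    using c.class_mem that by (simp add: defs)
qed

lemma rei_weak_in:
  "\<lbrakk>X \<in> ctxs P; W \<in> ctxs P; set X \<subseteq> set W; A \<in> ob; \<alpha> \<in> Fb (L X \<otimes> A)\<rbrakk>
    \<Longrightarrow> rei P (wk A W X) \<alpha> \<in> Fb (L W \<otimes> A)"
  using rei_in weak_hom by blast

lemma rei_weak_weak:
  assumes "X \<in> ctxs P" "Z \<in> ctxs P" "W \<in> ctxs P" "set X \<subseteq> set Z" "set Z \<subseteq> set W" "A \<in> ob"
    and "\<alpha> \<in> Fb (L X \<otimes> A)"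
  shows "rei P (wk A W Z) (rei P (wk A Z X) \<alpha>) = rei P (wk A W X) \<alpha>"
  using rei_Cmp[OF weak_hom[OF assms(2,3,5,6)] weak_hom[OF assms(1,2,4,6)] assms(7)]
    weak_weak[OF assms(1-6)] by simp

text \<open>\<open>under_le\<close> asks for some representatives over some list. Reindexing is
  monotone, so one such inequality propagates to all larger lists, and eventually any other
  representatives of the two classes agree with these.\<close>

lemma el_le_iff:
  assumes "A \<in> ob" "X \<in> ctxs P" "\<alpha> \<in> Fb (L X \<otimes> A)" "Y \<in> ctxs P" "\<beta> \<in> Fb (L Y \<otimes> A)"
  shows "el_class P A (\<alpha>, X) \<sqsubseteq>\<^bsub>fib U A\<^esub> el_class P A (\<beta>, Y)
    \<longleftrightarrow> (\<forall>\<^sub>F W in ctxs.large. rei P (wk A W X) \<alpha> \<sqsubseteq>\<^bsub>fib P (L W \<otimes> A)\<^esub> rei P (wk A W Y) \<beta>)"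
proof
  assume "el_class P A (\<alpha>, X) \<sqsubseteq>\<^bsub>fib U A\<^esub> el_class P A (\<beta>, Y)"
  then obtain \<alpha>' X' \<beta>' Y' Z where m: "(\<alpha>', X') \<in> el_class P A (\<alpha>, X)" "(\<beta>', Y') \<in> el_class P A (\<beta>, Y)"
    and Z: "Z \<in> ctxs P" "set X' \<subseteq> set Z" "set Y' \<subseteq> set Z"
    and le: "rei P (wk A Z X') \<alpha>' \<sqsubseteq>\<^bsub>fib P (L Z \<otimes> A)\<^esub> rei P (wk A Z Y') \<beta>'"
    unfolding under_doctrine_simps under_le_def by blast
  note a = mem_el_class[OF assms(1) m(1)] and b = mem_el_class[OF assms(1) m(2)]
  from a[THEN conjunct2, THEN conjunct2] b[THEN conjunct2, THEN conjunct2] ctxs.large_ge[OF Z(1)]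
  show "\<forall>\<^sub>F W in ctxs.large. rei P (wk A W X) \<alpha> \<sqsubseteq>\<^bsub>fib P (L W \<otimes> A)\<^esub> rei P (wk A W Y) \<beta>"
  proof eventually_elim
    case (elim W)
    have "rei P (wk A W Z) (rei P (wk A Z X') \<alpha>')
        \<sqsubseteq>\<^bsub>fib P (L W \<otimes> A)\<^esub> rei P (wk A W Z) (rei P (wk A Z Y') \<beta>')"
      by (rule rei_mono[OF weak_hom rei_weak_in rei_weak_in le]) (use a b Z elim assms(1) in simp_all)
    then show ?case
      using rei_weak_weak[of X' Z W A \<alpha>'] rei_weak_weak[of Y' Z W A \<beta>'] a b Z elim assms(1) by simp
  qed
next
  assume "\<forall>\<^sub>F W in ctxs.large. rei P (wk A W X) \<alpha> \<sqsubseteq>\<^bsub>fib P (L W \<otimes> A)\<^esub> rei P (wk A W Y) \<beta>"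
  from eventually_conj[OF this eventually_conj[OF ctxs.large_ge[OF assms(2)] ctxs.large_ge[OF assms(4)]]]
  obtain W where "W \<in> ctxs P" "set X \<subseteq> set W" "set Y \<subseteq> set W"
    "rei P (wk A W X) \<alpha> \<sqsubseteq>\<^bsub>fib P (L W \<otimes> A)\<^esub> rei P (wk A W Y) \<beta>"
    by (rule ctxs.large_obtains) blast
  with el_class_self[OF assms(1)] assms show "el_class P A (\<alpha>, X) \<sqsubseteq>\<^bsub>fib U A\<^esub> el_class P A (\<beta>, Y)"
    unfolding under_doctrine_simps under_le_def by blast
qed

lemma el_mono:
  assumes "A \<in> ob" "X \<in> ctxs P" "\<alpha> \<in> Fb (L X \<otimes> A)" "\<beta> \<in> Fb (L X \<otimes> A)" "\<alpha> \<sqsubseteq>\<^bsub>fib P (L X \<otimes> A)\<^esub> \<beta>"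
  shows "el_class P A (\<alpha>, X) \<sqsubseteq>\<^bsub>fib U A\<^esub> el_class P A (\<beta>, X)"
  unfolding el_le_iff[OF assms(1,2,3,2,4)] using ctxs.large_ge[OF assms(2)]
  by eventually_elim (rule rei_mono[OF weak_hom assms(3-5)], use assms(1,2) in simp_all)

text \<open>As for composition, \<open>weak_kext\<close> makes all members of the union in
  \<open>under_rei\<close> one class.\<close>

lemma under_rei_germ:
  assumes "A \<in> ob" "Z \<in> ctxs P" and f: "f \<in> H (L Z \<otimes> A) B" and \<beta>: "\<beta> \<in> Fb (L Z \<otimes> B)"
  shows "rei U (germ A B f Z) (el_class P B (\<beta>, Z)) = el_class P A (rei P (kext Z A f) \<beta>, Z)"
proof -
  have ob: "B \<in> ob" using hom_Ob assms by blast
  have r: "rei P (kext Z A f) \<beta> \<in> Fb (L Z \<otimes> A)" using rei_in[OF kext_hom[OF assms(2,1) f] \<beta>] .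
  have *: "el_class P A (rei P (pr (pi1 (L Z') A) f') \<beta>', Z') = el_class P A (rei P (kext Z A f) \<beta>, Z)"
    if f'_in: "(f', Z') \<in> arr_class P A B (f, Z)" and \<beta>'_in: "(\<beta>', Z') \<in> el_class P B (\<beta>, Z)"
    for f' \<beta>' Z'
  proof -
    note f' = mem_arr_class[OF assms(1) f'_in] and \<beta>' = mem_el_class[OF ob \<beta>'_in]
    have r': "rei P (kext Z' A f') \<beta>' \<in> Fb (L Z' \<otimes> A)"
      using rei_in[OF kext_hom] f' \<beta>' assms(1) by blast
    have "\<forall>\<^sub>F W in ctxs.large. rei P (wk A W Z') (rei P (kext Z' A f') \<beta>')
        = rei P (wk A W Z) (rei P (kext Z A f) \<beta>)"
      using f'[THEN conjunct2, THEN conjunct2] \<beta>'[THEN conjunct2, THEN conjunct2]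
        ctxs.large_ge[OF assms(2)] ctxs.large_ge[OF f'[THEN conjunct1]]
    proof eventually_elim
      case (elim W)
      then have W: "W \<in> ctxs P" by blast
      have *: "rei P (wk A W Z0) (rei P (kext Z0 A f0) \<beta>0)
          = rei P (kext W A (f0 \<odot> wk A W Z0)) (rei P (wk B W Z0) \<beta>0)"
        if Z0: "Z0 \<in> ctxs P" "set Z0 \<subseteq> set W" and f0: "f0 \<in> H (L Z0 \<otimes> A) B"
          and \<beta>0: "\<beta>0 \<in> Fb (L Z0 \<otimes> B)" for f0 \<beta>0 Z0
      proof -
        note wA = weak_hom[OF Z0(1) W Z0(2) assms(1)] and wB = weak_hom[OF Z0(1) W Z0(2) ob]
        note k = kext_hom[OF Z0(1) assms(1) f0] kext_hom[OF W assms(1) base.Cmp_hom[OF wA f0]]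
        show ?thesis using rei_Cmp[OF wA k(1) \<beta>0] rei_Cmp[OF k(2) wB \<beta>0]
            weak_kext[OF Z0(1) W Z0(2) assms(1) f0] by simp
      qed
      from elim have "set Z' \<subseteq> set W" "set Z \<subseteq> set W" by blast+
      with *[of Z' f' \<beta>'] *[of Z f \<beta>] f' \<beta>' f \<beta> assms(2) elim(1,2) show ?case by simp
    qed
    then show ?thesis using el_eq_iff[OF assms(1) _ r' assms(2) r] f' by (simp add: kext_def)
  qed
  let ?M = "{el_class P A (rei P (pr (pi1 (L Z') A) f') \<beta>', Z') | f' \<beta>' Z'.
    (f', Z') \<in> arr_class P A B (f, Z) \<and> (\<beta>', Z') \<in> el_class P B (\<beta>, Z)}"
  have "(f, Z) \<in> arr_class P A B (f, Z)" "(\<beta>, Z) \<in> el_class P B (\<beta>, Z)"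
    using arr_class_self el_class_self assms ob by blast+
  then have "el_class P A (rei P (pr (pi1 (L Z) A) f) \<beta>, Z) \<in> ?M" by blast
  moreover have "c = el_class P A (rei P (kext Z A f) \<beta>, Z)" if "c \<in> ?M" for c using that * by blast
  ultimately have "?M = {el_class P A (rei P (kext Z A f) \<beta>, Z)}"
    unfolding kext_def by blast
  then have "\<Union>?M = el_class P A (rei P (kext Z A f) \<beta>, Z)" by simp
  then show ?thesis unfolding germ_def under_rei_def under_doctrine_simps by simp
qed

lemmas two_el = eventually_conj[OF ctxs.large_J eventually_conj[OF eventually_el eventually_el]]
lemmas germ_el = eventually_conj[OF ctxs.large_J eventually_conj[OF eventually_germ eventually_el]]

lemma under_partial_order:
  assumes A: "A \<in> ob"
  shows "partial_order (fib U A)"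
proof (rule partial_orderI)
  show "eq (fib U A) = (=)" by (simp add: under_doctrine_simps)
  show "a \<sqsubseteq>\<^bsub>fib U A\<^esub> a" if a: "a \<in> carrier (fib U A)" for a
  proof -
    from two_el[OF A a A a] obtain Z \<alpha> where "Z \<in> ctxs P" "\<alpha> \<in> Fb (L Z \<otimes> A)" "a = el_class P A (\<alpha>, Z)"
      by (rule ctxs.large_obtains) blast
    then show ?thesis using el_mono fib_refl base.Prd_Ob L_ob A by blast
  qed
  show "a = b" if a: "a \<in> carrier (fib U A)" and b: "b \<in> carrier (fib U A)"
    and le: "a \<sqsubseteq>\<^bsub>fib U A\<^esub> b" "b \<sqsubseteq>\<^bsub>fib U A\<^esub> a" for a b
  proof -
    from two_el[OF A a A b] obtain Z \<alpha> \<beta> where Z: "Z \<in> ctxs P" and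
      r: "\<alpha> \<in> Fb (L Z \<otimes> A)" "a = el_class P A (\<alpha>, Z)" "\<beta> \<in> Fb (L Z \<otimes> A)" "b = el_class P A (\<beta>, Z)"
      by (rule ctxs.large_obtains) blast
    from le have "\<forall>\<^sub>F W in ctxs.large. rei P (wk A W Z) \<alpha> \<sqsubseteq>\<^bsub>fib P (L W \<otimes> A)\<^esub> rei P (wk A W Z) \<beta>"
      "\<forall>\<^sub>F W in ctxs.large. rei P (wk A W Z) \<beta> \<sqsubseteq>\<^bsub>fib P (L W \<otimes> A)\<^esub> rei P (wk A W Z) \<alpha>"
      using el_le_iff[OF A] Z r by simp_all
    \<comment> \<open>The two inequalities may hold from different lists on; in the filter they hold
      together, and antisymmetry of the fibres of \<open>P\<close> applies.\<close>
    with ctxs.large_ge[OF Z] have "\<forall>\<^sub>F W in ctxs.large. rei P (wk A W Z) \<alpha> = rei P (wk A W Z) \<beta>"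
    proof eventually_elim
      case (elim W)
      then have W: "W \<in> ctxs P" "set Z \<subseteq> set W" by blast+
      note in_W = rei_weak_in[OF Z W A]
      show ?case by (rule fib_antisym[OF base.Prd_Ob[OF L_ob[OF W(1)] A] in_W[OF r(1)] in_W[OF r(3)] elim(2,3)])
    qed
    then show ?thesis using el_eq_iff[OF A] Z r by simp
  qed
  show "a \<sqsubseteq>\<^bsub>fib U A\<^esub> c" if a: "a \<in> carrier (fib U A)" and b: "b \<in> carrier (fib U A)"
    and c: "c \<in> carrier (fib U A)" and le: "a \<sqsubseteq>\<^bsub>fib U A\<^esub> b" "b \<sqsubseteq>\<^bsub>fib U A\<^esub> c" for a b c
  proof -
    from eventually_conj[OF eventually_el[OF A c] two_el[OF A a A b]]
    obtain Z \<alpha> \<beta> \<gamma> where Z: "Z \<in> ctxs P" and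
      r: "\<alpha> \<in> Fb (L Z \<otimes> A)" "a = el_class P A (\<alpha>, Z)" "\<beta> \<in> Fb (L Z \<otimes> A)" "b = el_class P A (\<beta>, Z)"
        "\<gamma> \<in> Fb (L Z \<otimes> A)" "c = el_class P A (\<gamma>, Z)"
      by (rule ctxs.large_obtains) blast
    from le have "\<forall>\<^sub>F W in ctxs.large. rei P (wk A W Z) \<alpha> \<sqsubseteq>\<^bsub>fib P (L W \<otimes> A)\<^esub> rei P (wk A W Z) \<beta>"
      "\<forall>\<^sub>F W in ctxs.large. rei P (wk A W Z) \<beta> \<sqsubseteq>\<^bsub>fib P (L W \<otimes> A)\<^esub> rei P (wk A W Z) \<gamma>"
      using el_le_iff[OF A] Z r by simp_all
    with ctxs.large_ge[OF Z] have "\<forall>\<^sub>F W in ctxs.large. rei P (wk A W Z) \<alpha> \<sqsubseteq>\<^bsub>fib P (L W \<otimes> A)\<^esub> rei P (wk A W Z) \<gamma>"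
    proof eventually_elim
      case (elim W)
      then have W: "W \<in> ctxs P" "set Z \<subseteq> set W" by blast+
      note in_W = rei_weak_in[OF Z W A]
      show ?case
        by (rule fib_trans[OF base.Prd_Ob[OF L_ob[OF W(1)] A] elim(2,3)
            in_W[OF r(1)] in_W[OF r(3)] in_W[OF r(5)]])
    qed
    then show ?thesis using el_le_iff[OF A] Z r by simp
  qed
qed

lemma
  assumes "A \<in> ob" "Z \<in> ctxs P" "\<alpha> \<in> Fb (L Z \<otimes> A)" "\<beta> \<in> Fb (L Z \<otimes> A)"
  defines "m \<equiv> el_class P A (\<alpha> \<sqinter>\<^bsub>fib P (L Z \<otimes> A)\<^esub> \<beta>, Z)"
  shows el_meet_greatest: "greatest (fib U A) m (Lower (fib U A) {el_class P A (\<alpha>, Z), el_class P A (\<beta>, Z)})"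
    and el_meet: "el_class P A (\<alpha>, Z) \<sqinter>\<^bsub>fib U A\<^esub> el_class P A (\<beta>, Z) = m"
proof -
  have o: "L Z \<otimes> A \<in> ob" using base.Prd_Ob L_ob assms by blast
  note mi = fib_meet_in[OF o assms(3,4)]
  show "greatest (fib U A) m (Lower (fib U A) {el_class P A (\<alpha>, Z), el_class P A (\<beta>, Z)})"
  proof (rule greatest_Lower_two)
    show "m \<sqsubseteq>\<^bsub>fib U A\<^esub> el_class P A (\<alpha>, Z)" "m \<sqsubseteq>\<^bsub>fib U A\<^esub> el_class P A (\<beta>, Z)"
      unfolding m_def
      by (rule el_mono[OF assms(1,2) mi assms(3) fib_meet_left[OF o assms(3,4)]]
        el_mono[OF assms(1,2) mi assms(4) fib_meet_right[OF o assms(3,4)]])+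
    fix c assume c: "c \<in> carrier (fib U A)" "c \<sqsubseteq>\<^bsub>fib U A\<^esub> el_class P A (\<alpha>, Z)" "c \<sqsubseteq>\<^bsub>fib U A\<^esub> el_class P A (\<beta>, Z)"
    from two_el[OF assms(1) c(1) assms(1) c(1)] obtain X \<gamma> where X: "X \<in> ctxs P" "\<gamma> \<in> Fb (L X \<otimes> A)" "c = el_class P A (\<gamma>, X)"
      by (rule ctxs.large_obtains) blast
    have "\<forall>\<^sub>F W in ctxs.large. rei P (wk A W X) \<gamma> \<sqsubseteq>\<^bsub>fib P (L W \<otimes> A)\<^esub> rei P (wk A W Z) \<alpha>"
      "\<forall>\<^sub>F W in ctxs.large. rei P (wk A W X) \<gamma> \<sqsubseteq>\<^bsub>fib P (L W \<otimes> A)\<^esub> rei P (wk A W Z) \<beta>"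
      using c(2,3) unfolding X(3) el_le_iff[OF assms(1) X(1,2) assms(2,3)]
        el_le_iff[OF assms(1) X(1,2) assms(2,4)] .
    with ctxs.large_ge[OF assms(2)] ctxs.large_ge[OF X(1)]
    have "\<forall>\<^sub>F W in ctxs.large. rei P (wk A W X) \<gamma>
        \<sqsubseteq>\<^bsub>fib P (L W \<otimes> A)\<^esub> rei P (wk A W Z) (\<alpha> \<sqinter>\<^bsub>fib P (L Z \<otimes> A)\<^esub> \<beta>)"
    proof eventually_elim
      case (elim W)
      then have W: "W \<in> ctxs P" "set Z \<subseteq> set W" "set X \<subseteq> set W" "L W \<otimes> A \<in> ob"
        using base.Prd_Ob L_ob assms(1) by blast+
      note in_W = rei_weak_in[OF assms(2) W(1,2) assms(1)]
      \<comment> \<open>The lower bound may live over a list unrelated to \<open>Z\<close>. Over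
        \<open>W\<close> the weakened meet is a meet again, and the two can be compared
        there.\<close>
      show ?case
        unfolding rei_meet[OF weak_hom[OF assms(2) W(1,2) assms(1)] assms(3,4)]
        by (rule le_fib_meet[OF W(4) elim(3,4) in_W[OF assms(3)] in_W[OF assms(4)]
            rei_weak_in[OF X(1) W(1,3) assms(1) X(2)]])
    qed
    then show "c \<sqsubseteq>\<^bsub>fib U A\<^esub> m" unfolding m_def X(3) using el_le_iff[OF assms(1) X(1,2) assms(2) mi] by blast
  qed (use el_in[OF assms(1,2)] assms(3,4) mi in \<open>auto simp: m_def\<close>)
  then show "el_class P A (\<alpha>, Z) \<sqinter>\<^bsub>fib U A\<^esub> el_class P A (\<beta>, Z) = m"
    by (rule partial_order.meet_eqI[OF under_partial_order[OF assms(1)]])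
qed

text \<open>Weakening preserves top elements, so those over different lists represent the same class
  and \<open>Z\<close> can be arbitrary.\<close>

lemma
  assumes "A \<in> ob" "Z \<in> ctxs P"
  defines "t \<equiv> el_class P A (\<top>\<^bsub>fib P (L Z \<otimes> A)\<^esub>, Z)"
  shows el_top_greatest: "greatest (fib U A) t (carrier (fib U A))"
    and el_top: "\<top>\<^bsub>fib U A\<^esub> = t"
proof -
  have o: "L Z \<otimes> A \<in> ob" using base.Prd_Ob L_ob assms by blast
  have "a \<sqsubseteq>\<^bsub>fib U A\<^esub> t" if a: "a \<in> carrier (fib U A)" for a
  proof -
    from two_el[OF assms(1) a assms(1) a] obtain X \<alpha> where X: "X \<in> ctxs P" "\<alpha> \<in> Fb (L X \<otimes> A)" "a = el_class P A (\<alpha>, X)"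
      by (rule ctxs.large_obtains) blast
    from ctxs.large_ge[OF assms(2)] ctxs.large_ge[OF X(1)]
    have "\<forall>\<^sub>F W in ctxs.large. rei P (wk A W X) \<alpha>
        \<sqsubseteq>\<^bsub>fib P (L W \<otimes> A)\<^esub> rei P (wk A W Z) \<top>\<^bsub>fib P (L Z \<otimes> A)\<^esub>"
    proof eventually_elim
      case (elim W)
      then have W: "W \<in> ctxs P" "set Z \<subseteq> set W" "set X \<subseteq> set W" "L W \<otimes> A \<in> ob"
        using base.Prd_Ob L_ob assms(1) by blast+
      show ?case
        unfolding rei_top[OF weak_hom[OF assms(2) W(1,2) assms(1)]]
        by (rule le_fib_top[OF W(4) rei_weak_in[OF X(1) W(1,3) assms(1) X(2)]])
    qed
    then show ?thesis unfolding t_def X(3) using el_le_iff[OF assms(1) X(1,2) assms(2) fib_top_in[OF o]] by blast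
  qed
  moreover have "t \<in> carrier (fib U A)" unfolding t_def using el_in[OF assms(1,2) fib_top_in[OF o]] .
  ultimately show "greatest (fib U A) t (carrier (fib U A))" by (auto simp: greatest_def)
  then show "\<top>\<^bsub>fib U A\<^esub> = t"
    by (rule partial_order.top_eqI[OF under_partial_order[OF assms(1)]])
qed


section \<open>Quantifiers in the presence of constants\<close>

definition asc :: "'a \<Rightarrow> 'a \<Rightarrow> 'a \<Rightarrow> 'b" where
  "asc G A B = pr (pi1 G A \<odot> pi1 (G \<otimes> A) B) (pr (pi2 G A \<odot> pi1 (G \<otimes> A) B) (pi2 (G \<otimes> A) B))"

definition asc_inv :: "'a \<Rightarrow> 'a \<Rightarrow> 'a \<Rightarrow> 'b" where
  "asc_inv G A B = pr (pr (pi1 G (A \<otimes> B)) (pi1 A B \<odot> pi2 G (A \<otimes> B))) (pi2 A B \<odot> pi2 G (A \<otimes> B))"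

text \<open>This is the coKleisli extension of the first projection from
  \<open>A \<otimes> B\<close> to \<open>A\<close>; reindexing along it is the map to which the
  quantifier has to be left adjoint.\<close>

definition drop2 :: "'a \<Rightarrow> 'a \<Rightarrow> 'a \<Rightarrow> 'b" where
  "drop2 G A B = pr (pi1 G (A \<otimes> B)) (pi1 A B \<odot> pi2 G (A \<otimes> B))"

lemma
  assumes "G \<in> ob" "A \<in> ob" "B \<in> ob"
  shows asc_hom: "asc G A B \<in> H ((G \<otimes> A) \<otimes> B) (G \<otimes> (A \<otimes> B))"
    and asc_inv_hom: "asc_inv G A B \<in> H (G \<otimes> (A \<otimes> B)) ((G \<otimes> A) \<otimes> B)"
    and drop2_hom: "drop2 G A B \<in> H (G \<otimes> (A \<otimes> B)) (G \<otimes> A)"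
    and asc_asc_inv: "asc G A B \<odot> asc_inv G A B = Idt (base P) (G \<otimes> (A \<otimes> B))"
    and drop2_asc: "drop2 G A B \<odot> asc G A B = pi1 (G \<otimes> A) B"
  using assms by (simp_all add: asc_def asc_inv_def drop2_def base.hom_iff base.products)

text \<open>\<open>exq P\<close> removes the last factor of a binary product, so \<phi> is first
  moved from \<open>G \<otimes> (A \<otimes> B)\<close> to
  \<open>(G \<otimes> A) \<otimes> B\<close>, where \<open>G\<close> is the product of the
  constants.\<close>

definition uex :: "('a, 'c) ctx \<Rightarrow> 'a \<Rightarrow> 'a \<Rightarrow> 'c \<Rightarrow> 'c" where
  "uex Z B A \<phi> = exq P B (L Z \<otimes> A) (rei P (asc (L Z) A B) \<phi>)"

context
  fixes A B assumes A: "A \<in> ob" and B: "B \<in> ob"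
begin

lemma AB: "A \<otimes> B \<in> ob"
  using base.Prd_Ob A B .

lemma rei_asc_in: "\<lbrakk>Z \<in> ctxs P; \<phi> \<in> Fb (L Z \<otimes> (A \<otimes> B))\<rbrakk> \<Longrightarrow> rei P (asc (L Z) A B) \<phi> \<in> Fb ((L Z \<otimes> A) \<otimes> B)"
  using rei_in[OF asc_hom[OF L_ob A B]] .

lemma uex_in: "\<lbrakk>Z \<in> ctxs P; \<phi> \<in> Fb (L Z \<otimes> (A \<otimes> B))\<rbrakk> \<Longrightarrow> uex Z B A \<phi> \<in> Fb (L Z \<otimes> A)"
  unfolding uex_def using exq_in[OF B base.Prd_Ob[OF L_ob A] rei_asc_in] .

lemma rei_drop2_in: "\<lbrakk>Z \<in> ctxs P; \<beta> \<in> Fb (L Z \<otimes> A)\<rbrakk> \<Longrightarrow> rei P (drop2 (L Z) A B) \<beta> \<in> Fb (L Z \<otimes> (A \<otimes> B))"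
  using rei_in[OF drop2_hom[OF L_ob A B]] .

lemma rei_asc_drop2:
  assumes "Z \<in> ctxs P" "\<beta> \<in> Fb (L Z \<otimes> A)"
  shows "rei P (asc (L Z) A B) (rei P (drop2 (L Z) A B) \<beta>) = rei P (pi1 (L Z \<otimes> A) B) \<beta>"
  using rei_Cmp[OF asc_hom[OF L_ob A B] drop2_hom[OF L_ob A B]] drop2_asc[OF L_ob A B] assms by metis

text \<open>Reindexing along the reassociation reflects the order because it has a left inverse, and
  it turns \<open>drop2\<close> into a first projection; the adjunction of \<open>P\<close> does the
  rest.\<close>

lemma uex_le_iff:
  assumes Z: "Z \<in> ctxs P" and \<phi>: "\<phi> \<in> Fb (L Z \<otimes> (A \<otimes> B))" and \<beta>: "\<beta> \<in> Fb (L Z \<otimes> A)"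
  shows "uex Z B A \<phi> \<sqsubseteq>\<^bsub>fib P (L Z \<otimes> A)\<^esub> \<beta> \<longleftrightarrow> \<phi> \<sqsubseteq>\<^bsub>fib P (L Z \<otimes> (A \<otimes> B))\<^esub> rei P (drop2 (L Z) A B) \<beta>"
proof -
  let ?a = "asc (L Z) A B" and ?b = "asc_inv (L Z) A B" and ?\<beta> = "rei P (drop2 (L Z) A B) \<beta>"
  note L = L_ob[OF Z]
  note asc = asc_hom[OF L A B] and inv = asc_inv_hom[OF L A B]
  have b: "?\<beta> \<in> Fb (L Z \<otimes> (A \<otimes> B))" using rei_drop2_in[OF Z \<beta>] .
  have inverse: "rei P ?b (rei P ?a \<gamma>) = \<gamma>" if "\<gamma> \<in> Fb (L Z \<otimes> (A \<otimes> B))" for \<gamma>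
    using rei_Cmp[OF inv asc that] asc_asc_inv[OF L A B] rei_Idt[OF base.Prd_Ob[OF L AB] that] by simp
  have "uex Z B A \<phi> \<sqsubseteq>\<^bsub>fib P (L Z \<otimes> A)\<^esub> \<beta>
      \<longleftrightarrow> rei P ?a \<phi> \<sqsubseteq>\<^bsub>fib P ((L Z \<otimes> A) \<otimes> B)\<^esub> rei P ?a ?\<beta>"
    unfolding uex_def rei_asc_drop2[OF Z \<beta>]
    using exq_le_iff[OF B base.Prd_Ob[OF L A] rei_asc_in[OF Z \<phi>] \<beta>] .
  also have "\<dots> \<longleftrightarrow> \<phi> \<sqsubseteq>\<^bsub>fib P (L Z \<otimes> (A \<otimes> B))\<^esub> ?\<beta>"
    using rei_mono[OF asc \<phi> b] rei_mono[OF inv rei_asc_in[OF Z \<phi>] rei_asc_in[OF Z b]] inverse[OF \<phi>] inverse[OF b]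
    by auto
  finally show ?thesis .
qed

text \<open>The first claim is Beck-Chevalley of \<open>P\<close> along weakening: the quantifier
  commutes with enlarging the list, so its class does not depend on the representative. The second
  is the matching fact for its right adjoint.\<close>

lemma
  assumes Z: "Z \<in> ctxs P" and W: "W \<in> ctxs P" "set Z \<subseteq> set W"
  shows uex_weak: "\<phi> \<in> Fb (L Z \<otimes> (A \<otimes> B)) \<Longrightarrow>
      rei P (wk A W Z) (uex Z B A \<phi>) = uex W B A (rei P (wk (A \<otimes> B) W Z) \<phi>)"
    and drop2_weak: "\<beta> \<in> Fb (L Z \<otimes> A) \<Longrightarrow>
      rei P (wk (A \<otimes> B) W Z) (rei P (drop2 (L Z) A B) \<beta>) = rei P (drop2 (L W) A B) (rei P (wk A W Z) \<beta>)"
proof -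
  note L = L_ob[OF Z] L_ob[OF W(1)] and wA = weak_hom[OF Z W A] and wAB = weak_hom[OF Z W AB]
  \<comment> \<open>This is \<open>wk A W Z\<close> times the identity of \<open>B\<close>.\<close>
  let ?h = "pr (wk A W Z \<odot> pi1 (L W \<otimes> A) B) (pi2 (L W \<otimes> A) B)"
  have h: "?h \<in> H ((L W \<otimes> A) \<otimes> B) ((L Z \<otimes> A) \<otimes> B)" "pi1 (L Z \<otimes> A) B \<odot> ?h = wk A W Z \<odot> pi1 (L W \<otimes> A) B"
    "pi2 (L Z \<otimes> A) B \<odot> ?h = pi2 (L W \<otimes> A) B"
    using wA A B L by (simp_all add: base.hom_iff base.products)
  have e: "asc (L Z) A B \<odot> ?h = wk (A \<otimes> B) W Z \<odot> asc (L W) A B"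
    using A B AB Z W by (simp add: weakening asc_def)
  show "rei P (wk A W Z) (uex Z B A \<phi>) = uex W B A (rei P (wk (A \<otimes> B) W Z) \<phi>)"
    if \<phi>: "\<phi> \<in> Fb (L Z \<otimes> (A \<otimes> B))"
    using beck_chevalley'[OF B wA rei_asc_in[OF Z \<phi>] h] rei_Cmp[OF h(1) asc_hom[OF L(1) A B] \<phi>]
      rei_Cmp[OF asc_hom[OF L(2) A B] wAB \<phi>] e
    by (simp add: uex_def)
  have "drop2 (L Z) A B \<odot> wk (A \<otimes> B) W Z = wk A W Z \<odot> drop2 (L W) A B"
    using A B AB Z W by (simp add: weakening drop2_def)
  then show "rei P (wk (A \<otimes> B) W Z) (rei P (drop2 (L Z) A B) \<beta>) = rei P (drop2 (L W) A B) (rei P (wk A W Z) \<beta>)"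
    if "\<beta> \<in> Fb (L Z \<otimes> A)"
    using rei_Cmp[OF wAB drop2_hom[OF L(1) A B] that] rei_Cmp[OF drop2_hom[OF L(2) A B] wA that] by simp
qed

lemma under_rei_Pr1:
  assumes Z: "Z \<in> ctxs P" and \<beta>: "\<beta> \<in> Fb (L Z \<otimes> A)"
  shows "rei U (Pr1 (under_cat P) A B) (el_class P A (\<beta>, Z)) = el_class P (A \<otimes> B) (rei P (drop2 (L Z) A B) \<beta>, Z)"
proof -
  have "pi1 A B \<odot> pi2 (L Z) (A \<otimes> B) \<in> H (L Z \<otimes> (A \<otimes> B)) A"
    using A B AB L_ob[OF Z] by (simp add: base.hom_iff base.products)
  from under_rei_germ[OF AB Z this \<beta>] show ?thesis
    by (simp add: Pr1_under[OF A B Z] kext_def drop2_def)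
qed

lemma el_uex_le_iff:
  assumes Z: "Z \<in> ctxs P" and \<phi>: "\<phi> \<in> Fb (L Z \<otimes> (A \<otimes> B))" and b: "b \<in> carrier (fib U A)"
  shows "el_class P A (uex Z B A \<phi>, Z) \<sqsubseteq>\<^bsub>fib U A\<^esub> b
    \<longleftrightarrow> el_class P (A \<otimes> B) (\<phi>, Z) \<sqsubseteq>\<^bsub>fib U (A \<otimes> B)\<^esub> rei U (Pr1 (under_cat P) A B) b"
proof -
  from two_el[OF A b A b] obtain Y \<beta> where Y: "Y \<in> ctxs P" "\<beta> \<in> Fb (L Y \<otimes> A)" "b = el_class P A (\<beta>, Y)"
    by (rule ctxs.large_obtains) blast
  \<comment> \<open>The adjunction of \<open>uex\<close> over a single list holds at every large
    \<open>W\<close>, which makes the two eventual inequalities equivalent.\<close>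
  have "\<forall>\<^sub>F W in ctxs.large.
    rei P (wk A W Z) (uex Z B A \<phi>) \<sqsubseteq>\<^bsub>fib P (L W \<otimes> A)\<^esub> rei P (wk A W Y) \<beta>
      \<longleftrightarrow> rei P (wk (A \<otimes> B) W Z) \<phi> \<sqsubseteq>\<^bsub>fib P (L W \<otimes> (A \<otimes> B))\<^esub> rei P (wk (A \<otimes> B) W Y) (rei P (drop2 (L Y) A B) \<beta>)"
    using ctxs.large_ge[OF Z] ctxs.large_ge[OF Y(1)]
  proof eventually_elim
    case (elim W)
    then have W: "W \<in> ctxs P" "set Z \<subseteq> set W" "set Y \<subseteq> set W" by blast+
    show ?case
      unfolding uex_weak[OF Z W(1,2) \<phi>] drop2_weak[OF Y(1) W(1,3) Y(2)]
      by (rule uex_le_iff[OF W(1) rei_weak_in[OF Z W(1,2) AB \<phi>] rei_weak_in[OF Y(1) W(1,3) A Y(2)]])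
  qed
  then have "(\<forall>\<^sub>F W in ctxs.large.
      rei P (wk A W Z) (uex Z B A \<phi>) \<sqsubseteq>\<^bsub>fib P (L W \<otimes> A)\<^esub> rei P (wk A W Y) \<beta>)
    \<longleftrightarrow> (\<forall>\<^sub>F W in ctxs.large.
      rei P (wk (A \<otimes> B) W Z) \<phi> \<sqsubseteq>\<^bsub>fib P (L W \<otimes> (A \<otimes> B))\<^esub> rei P (wk (A \<otimes> B) W Y) (rei P (drop2 (L Y) A B) \<beta>))"
    by (rule eventually_subst)
  then show ?thesis
    unfolding Y(3) under_rei_Pr1[OF Y(1,2)] el_le_iff[OF A Z uex_in[OF Z \<phi>] Y(1,2)]
      el_le_iff[OF AB Z \<phi> Y(1) rei_drop2_in[OF Y(1,2)]] .
qed

lemma exq_under: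
  assumes Z: "Z \<in> ctxs P" and \<phi>: "\<phi> \<in> Fb (L Z \<otimes> (A \<otimes> B))"
  shows "exq U B A (el_class P (A \<otimes> B) (\<phi>, Z)) = el_class P A (uex Z B A \<phi>, Z)"
  by (rule exq_eqI[OF under_partial_order[OF A] el_in[OF A Z uex_in[OF Z \<phi>]]])
    (simp add: el_uex_le_iff[OF Z \<phi>] under_cat_simps under_doctrine_simps(1))

end

section \<open>Beck-Chevalley with constants\<close>

lemma uex_kext:
  assumes "A \<in> ob" "A' \<in> ob" "B \<in> ob" "Z \<in> ctxs P" and f: "f \<in> H (L Z \<otimes> A) A'"
    and h: "h \<in> H (L Z \<otimes> (A \<otimes> B)) (A' \<otimes> B)"
    and h1: "pi1 A' B \<odot> h = f \<odot> drop2 (L Z) A B"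
    and h2: "pi2 A' B \<odot> h = pi2 A B \<odot> pi2 (L Z) (A \<otimes> B)"
    and \<phi>: "\<phi> \<in> Fb (L Z \<otimes> (A' \<otimes> B))"
  shows "uex Z B A (rei P (kext Z (A \<otimes> B) h) \<phi>) = rei P (kext Z A f) (uex Z B A' \<phi>)"
proof -
  note L = L_ob[OF assms(4)] and AB = base.Prd_Ob[OF assms(1,3)] base.Prd_Ob[OF assms(2,3)]
  note kf = kext_hom[OF assms(4,1) f] and kh = kext_hom[OF assms(4) AB(1) h]
  let ?k = "pr (kext Z A f \<odot> pi1 (L Z \<otimes> A) B) (pi2 (L Z \<otimes> A) B)"
  have k: "?k \<in> H ((L Z \<otimes> A) \<otimes> B) ((L Z \<otimes> A') \<otimes> B)"
    "pi1 (L Z \<otimes> A') B \<odot> ?k = kext Z A f \<odot> pi1 (L Z \<otimes> A) B"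
    "pi2 (L Z \<otimes> A') B \<odot> ?k = pi2 (L Z \<otimes> A) B"
    using kf assms(1-3) L by (simp_all add: base.hom_iff base.products)
  \<comment> \<open>The two projection equations determine \<open>h\<close>, so the reassociation
    carries its coKleisli extension to \<open>?k\<close>, which is \<open>kext Z A f\<close> times
    the identity of \<open>B\<close>.\<close>
  have "h = pr (f \<odot> drop2 (L Z) A B) (pi2 A B \<odot> pi2 (L Z) (A \<otimes> B))"
    using h assms(2,3) by (simp add: h1[symmetric] h2[symmetric] base.hom_iff base.pairing_Pr_Cmp)
  then have "kext Z (A \<otimes> B) h \<odot> asc (L Z) A B = asc (L Z) A' B \<odot> ?k"
    using f assms(1-3) L AB by (simp add: kext_def asc_def drop2_def base.hom_iff base.products)
  then show ?thesis
    using beck_chevalley'[OF assms(3) kf rei_asc_in[OF assms(2,3,4) \<phi>] k]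
      rei_Cmp[OF k(1) asc_hom[OF L assms(2,3)] \<phi>] rei_Cmp[OF asc_hom[OF L assms(1,3)] kh \<phi>]
    by (simp add: uex_def)
qed

text \<open>The hypotheses are equations of germs, which hold between representatives only over some
  larger \<open>W\<close>. Once everything is weakened to such a \<open>W\<close>,
  \<open>uex_kext\<close> applies.\<close>

lemma under_beck_chevalley:
  assumes B: "B \<in> ob" and F: "F \<in> hom (under_cat P) A A'" and a: "a \<in> carrier (fib U (A' \<otimes> B))"
    and K: "K \<in> hom (under_cat P) (A \<otimes> B) (A' \<otimes> B)"
    and K1: "Cmp (under_cat P) (Pr1 (under_cat P) A' B) K = Cmp (under_cat P) F (Pr1 (under_cat P) A B)"
    and K2: "Cmp (under_cat P) (Pr2 (under_cat P) A' B) K = Pr2 (under_cat P) A B"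
  shows "exq U B A (rei U K a) = rei U F (exq U B A' a)"
proof -
  have A: "A \<in> ob" "A' \<in> ob" using hom_under_ob[OF F] by blast+
  note AB = base.Prd_Ob[OF A(1) B] base.Prd_Ob[OF A(2) B]
  from eventually_conj[OF germ_el[OF A(1) F AB(2) a] eventually_germ[OF AB(1) K]]
  obtain Z f k \<phi> where Z: "Z \<in> ctxs P" and f: "f \<in> H (L Z \<otimes> A) A'" "F = germ A A' f Z"
    and k: "k \<in> H (L Z \<otimes> (A \<otimes> B)) (A' \<otimes> B)" "K = germ (A \<otimes> B) (A' \<otimes> B) k Z"
    and \<phi>: "\<phi> \<in> Fb (L Z \<otimes> (A' \<otimes> B))" "a = el_class P (A' \<otimes> B) (\<phi>, Z)"
    by (rule ctxs.large_obtains) blast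
  note L = L_ob[OF Z]
  let ?p = "pi1 A B \<odot> pi2 (L Z) (A \<otimes> B)" and ?q = "pi2 A B \<odot> pi2 (L Z) (A \<otimes> B)"
  have t: "?p \<in> H (L Z \<otimes> (A \<otimes> B)) A" "?q \<in> H (L Z \<otimes> (A \<otimes> B)) B"
    "pi1 A' B \<odot> k \<in> H (L Z \<otimes> (A \<otimes> B)) A'" "pi2 A' B \<odot> k \<in> H (L Z \<otimes> (A \<otimes> B)) B"
    using A B AB L k by (auto simp: base.hom_iff base.products)
  have ke: "kext Z (A \<otimes> B) ?p = drop2 (L Z) A B" by (simp add: kext_def drop2_def)
  have fd: "f \<odot> drop2 (L Z) A B \<in> H (L Z \<otimes> (A \<otimes> B)) A'"
    using base.Cmp_hom[OF drop2_hom[OF L A(1) B] f(1)] .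
  have "germ (A \<otimes> B) A' (pi1 A' B \<odot> k) Z = germ (A \<otimes> B) A' (f \<odot> drop2 (L Z) A B) Z"
    using K1 Pr_under_Cmp(1)[OF A(2) B AB(1) Z k(1)] under_comp_germ[OF AB(1) Z t(1) f(1)]
    by (simp add: k f Pr1_under[OF A(1) B Z] ke)
  moreover have "germ (A \<otimes> B) B (pi2 A' B \<odot> k) Z = germ (A \<otimes> B) B ?q Z"
    using K2 Pr_under_Cmp(2)[OF A(2) B AB(1) Z k(1)] by (simp add: k Pr2_under[OF A(1) B Z])
  ultimately have "\<forall>\<^sub>F W in ctxs.large. (pi1 A' B \<odot> k) \<odot> wk (A \<otimes> B) W Z = (f \<odot> drop2 (L Z) A B) \<odot> wk (A \<otimes> B) W Z"
    "\<forall>\<^sub>F W in ctxs.large. (pi2 A' B \<odot> k) \<odot> wk (A \<otimes> B) W Z = ?q \<odot> wk (A \<otimes> B) W Z"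
    using germ_eq_iff[OF AB(1) Z t(3) Z fd] germ_eq_iff[OF AB(1) Z t(4) Z t(2)] by blast+
  from eventually_conj[OF eventually_conj[OF this] ctxs.large_ge[OF Z]]
  obtain W where W: "W \<in> ctxs P" "set Z \<subseteq> set W"
    and e1: "(pi1 A' B \<odot> k) \<odot> wk (A \<otimes> B) W Z = (f \<odot> drop2 (L Z) A B) \<odot> wk (A \<otimes> B) W Z"
    and e2: "(pi2 A' B \<odot> k) \<odot> wk (A \<otimes> B) W Z = ?q \<odot> wk (A \<otimes> B) W Z"
    by (rule ctxs.large_obtains) blast
  note wA = weak_hom[OF Z W A(1)] and wAB = weak_hom[OF Z W AB(1)]
  let ?f = "f \<odot> wk A W Z" and ?k = "k \<odot> wk (A \<otimes> B) W Z" and ?\<phi> = "rei P (wk (A' \<otimes> B) W Z) \<phi>"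
  have f': "?f \<in> H (L W \<otimes> A) A'" and k': "?k \<in> H (L W \<otimes> (A \<otimes> B)) (A' \<otimes> B)"
    and \<phi>': "?\<phi> \<in> Fb (L W \<otimes> (A' \<otimes> B))"
    using base.Cmp_hom[OF wA f(1)] base.Cmp_hom[OF wAB k(1)] rei_weak_in[OF Z W AB(2) \<phi>(1)] .
  have d: "drop2 (L Z) A B \<odot> wk (A \<otimes> B) W Z = wk A W Z \<odot> drop2 (L W) A B"
    using A B AB Z W by (simp add: weakening drop2_def)
  have "pi1 A' B \<odot> ?k = ?f \<odot> drop2 (L W) A B"
    using e1 base.Cmp_assoc[OF wAB k(1) base.Pr1_hom[OF A(2) B]] d
      base.Cmp_assoc[OF wAB drop2_hom[OF L A(1) B] f(1)]
      base.Cmp_assoc[OF drop2_hom[OF L_ob[OF W(1)] A(1) B] wA f(1)] by simp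
  moreover have "?q \<odot> wk (A \<otimes> B) W Z = pi2 A B \<odot> pi2 (L W) (A \<otimes> B)"
    using A B AB Z W by (simp add: weakening)
  then have "pi2 A' B \<odot> ?k = pi2 A B \<odot> pi2 (L W) (A \<otimes> B)"
    using e2 base.Cmp_assoc[OF wAB k(1) base.Pr2_hom[OF A(2) B]] by simp
  ultimately have "uex W B A (rei P (kext W (A \<otimes> B) ?k) ?\<phi>) = rei P (kext W A ?f) (uex W B A' ?\<phi>)"
    using uex_kext[OF A B W(1) f' k' _ _ \<phi>'] by blast
  moreover have "F = germ A A' ?f W" "K = germ (A \<otimes> B) (A' \<otimes> B) ?k W" "a = el_class P (A' \<otimes> B) (?\<phi>, W)"
    using germ_weak[OF A(1) Z f(1) W] germ_weak[OF AB(1) Z k(1) W] el_weak[OF AB(2) Z \<phi>(1) W] f k \<phi>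
    by simp_all
  ultimately show ?thesis
    using under_rei_germ[OF AB(1) W(1) k' \<phi>'] exq_under[OF A(2) B W(1) \<phi>']
      under_rei_germ[OF A(1) W(1) f' uex_in[OF A(2) B W(1) \<phi>']]
      exq_under[OF A(1) B W(1) rei_in[OF kext_hom[OF W(1) AB(1) k'] \<phi>']]
    by simp
qed

lemma under_existential: "existential_doctrine U"
proof (rule existential_doctrineI[where tp = "\<lambda>A. \<top>\<^bsub>fib U A\<^esub>" and mt = "\<lambda>A a b. a \<sqinter>\<^bsub>fib U A\<^esub> b"
      and ex = "exq U"], unfold under_doctrine_simps(1) under_cat_simps)
  show "fp_category (under_cat P)" by (rule under_cat_fp_category)
  obtain Z0 where Z0: "Z0 \<in> ctxs P" using ctxs.J_nonempty by blast
  show "partial_order (fib U A)" if "A \<in> ob" for A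
    using under_partial_order[OF that] .
  show rei_U_in: "rei U F a \<in> carrier (fib U A)"
    if F: "F \<in> hom (under_cat P) A B" and a: "a \<in> carrier (fib U B)" for F A B a
  proof -
    have A: "A \<in> ob" "B \<in> ob" using hom_under_ob[OF F] by blast+
    from germ_el[OF A(1) F A(2) a] obtain Z f \<alpha> where Z: "Z \<in> ctxs P"
      and r: "f \<in> H (L Z \<otimes> A) B" "F = germ A B f Z" "\<alpha> \<in> Fb (L Z \<otimes> B)" "a = el_class P B (\<alpha>, Z)"
      by (rule ctxs.large_obtains) blast
    show ?thesis
      unfolding r under_rei_germ[OF A(1) Z r(1,3)] by (rule el_in[OF A(1) Z rei_in[OF kext_hom[OF Z A(1) r(1)] r(3)]])
  qed
  have germ_two: "\<exists>Z f \<alpha> \<beta>. Z \<in> ctxs P \<and> f \<in> H (L Z \<otimes> A) B \<and> F = germ A B f Z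
      \<and> \<alpha> \<in> Fb (L Z \<otimes> B) \<and> a = el_class P B (\<alpha>, Z) \<and> \<beta> \<in> Fb (L Z \<otimes> B) \<and> b = el_class P B (\<beta>, Z)"
    if "A \<in> ob" "B \<in> ob" "F \<in> hom (under_cat P) A B" "a \<in> carrier (fib U B)" "b \<in> carrier (fib U B)" for F A B a b
    by (rule ctxs.large_obtains[OF eventually_conj[OF germ_el[OF that(1,3,2,4)] eventually_el[OF that(2,5)]]]) blast
  show "rei U F a \<sqsubseteq>\<^bsub>fib U A\<^esub> rei U F b"
    if F: "F \<in> hom (under_cat P) A B" and a: "a \<in> carrier (fib U B)" and b: "b \<in> carrier (fib U B)"
      and le: "a \<sqsubseteq>\<^bsub>fib U B\<^esub> b" for F A B a b
  proof -
    have A: "A \<in> ob" "B \<in> ob" using hom_under_ob[OF F] by blast+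
    obtain Z f \<alpha> \<beta> where Z: "Z \<in> ctxs P" and f: "f \<in> H (L Z \<otimes> A) B" "F = germ A B f Z"
      and \<alpha>: "\<alpha> \<in> Fb (L Z \<otimes> B)" "a = el_class P B (\<alpha>, Z)" and \<beta>: "\<beta> \<in> Fb (L Z \<otimes> B)" "b = el_class P B (\<beta>, Z)"
      using germ_two[OF A F a b] by blast
    \<comment> \<open>The inequality between \<alpha> and \<beta> holds only over a larger
      \<open>W\<close>, so the arrow is weakened to \<open>W\<close> as well before monotonicity in
      \<open>P\<close> is used.\<close>
    from eventually_conj[OF le[unfolded \<alpha>(2) \<beta>(2) el_le_iff[OF A(2) Z \<alpha>(1) Z \<beta>(1)]] ctxs.large_ge[OF Z]]
    obtain W where W: "W \<in> ctxs P" "set Z \<subseteq> set W"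
      and le: "rei P (wk B W Z) \<alpha> \<sqsubseteq>\<^bsub>fib P (L W \<otimes> B)\<^esub> rei P (wk B W Z) \<beta>"
      by (rule ctxs.large_obtains) blast
    let ?f = "f \<odot> wk A W Z" and ?\<alpha> = "rei P (wk B W Z) \<alpha>" and ?\<beta> = "rei P (wk B W Z) \<beta>"
    have f': "?f \<in> H (L W \<otimes> A) B" and \<alpha>': "?\<alpha> \<in> Fb (L W \<otimes> B)" and \<beta>': "?\<beta> \<in> Fb (L W \<otimes> B)"
      using base.Cmp_hom[OF weak_hom[OF Z W A(1)] f(1)] rei_weak_in[OF Z W A(2) \<alpha>(1)] rei_weak_in[OF Z W A(2) \<beta>(1)] .
    note k = kext_hom[OF W(1) A(1) f']
    have "el_class P A (rei P (kext W A ?f) ?\<alpha>, W) \<sqsubseteq>\<^bsub>fib U A\<^esub> el_class P A (rei P (kext W A ?f) ?\<beta>, W)"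
      by (rule el_mono[OF A(1) W(1) rei_in[OF k \<alpha>'] rei_in[OF k \<beta>'] rei_mono[OF k \<alpha>' \<beta>' le]])
    then show ?thesis
      using under_rei_germ[OF A(1) W(1) f' \<alpha>'] under_rei_germ[OF A(1) W(1) f' \<beta>'] germ_weak[OF A(1) Z f(1) W]
        el_weak[OF A(2) Z \<alpha>(1) W] el_weak[OF A(2) Z \<beta>(1) W] f \<alpha> \<beta> by simp
  qed
  show "rei U (Idt (under_cat P) A) a = a" if A: "A \<in> ob" and a: "a \<in> carrier (fib U A)" for A a
  proof -
    from two_el[OF A a A a] obtain Z \<alpha> where Z: "Z \<in> ctxs P" and \<alpha>: "\<alpha> \<in> Fb (L Z \<otimes> A)" "a = el_class P A (\<alpha>, Z)"
      by (rule ctxs.large_obtains) blast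
    have "pi2 (L Z) A \<in> H (L Z \<otimes> A) A" "kext Z A (pi2 (L Z) A) = Idt (base P) (L Z \<otimes> A)"
      using A L_ob[OF Z] by (simp_all add: kext_def base.hom_iff base.products)
    then show ?thesis
      using under_rei_germ[OF A Z _ \<alpha>(1)] Idt_under[OF A Z] \<alpha> rei_Idt[OF base.Prd_Ob[OF L_ob[OF Z] A] \<alpha>(1)] by simp
  qed
  show "rei U (Cmp (under_cat P) G F) a = rei U F (rei U G a)"
    if F: "F \<in> hom (under_cat P) A B" and G: "G \<in> hom (under_cat P) B D" and a: "a \<in> carrier (fib U D)" for F G A B D a
  proof -
    have ob: "A \<in> ob" "B \<in> ob" "D \<in> ob" using hom_under_ob[OF F] hom_under_ob[OF G] by blast+
    from eventually_conj[OF eventually_germ[OF ob(1) F] germ_el[OF ob(2) G ob(3) a]]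
    obtain Z f g \<alpha> where Z: "Z \<in> ctxs P" and f: "f \<in> H (L Z \<otimes> A) B" "F = germ A B f Z"
      and g: "g \<in> H (L Z \<otimes> B) D" "G = germ B D g Z" and \<alpha>: "\<alpha> \<in> Fb (L Z \<otimes> D)" "a = el_class P D (\<alpha>, Z)"
      by (rule ctxs.large_obtains) blast
    note kf = kext_hom[OF Z ob(1) f(1)] and kg = kext_hom[OF Z ob(2) g(1)]
    \<comment> \<open>Functoriality of coKleisli extension, on which functoriality of reindexing
      rests.\<close>
    have "kext Z A (g \<odot> kext Z A f) = kext Z B g \<odot> kext Z A f"
      using f(1) g(1) ob L_ob[OF Z] by (auto simp: kext_def base.hom_iff base.products)
    then show ?thesis
      using under_comp_germ[OF ob(1) Z f(1) g(1)] under_rei_germ[OF ob(2) Z g(1) \<alpha>(1)]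
        under_rei_germ[OF ob(1) Z f(1) rei_in[OF kg \<alpha>(1)]]
        under_rei_germ[OF ob(1) Z base.Cmp_hom[OF kf g(1)] \<alpha>(1)] rei_Cmp[OF kf kg \<alpha>(1)]
      by (simp add: f(2) g(2) \<alpha>(2))
  qed
  show "\<top>\<^bsub>fib U A\<^esub> \<in> carrier (fib U A)" "\<And>a. a \<in> carrier (fib U A) \<Longrightarrow> a \<sqsubseteq>\<^bsub>fib U A\<^esub> \<top>\<^bsub>fib U A\<^esub>" if "A \<in> ob" for A
    using el_top_greatest[OF that Z0] unfolding el_top[OF that Z0] by (auto simp: greatest_def)
  show "rei U F \<top>\<^bsub>fib U B\<^esub> = \<top>\<^bsub>fib U A\<^esub>" if F: "F \<in> hom (under_cat P) A B" for F A B
  proof -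
    have A: "A \<in> ob" "B \<in> ob" using hom_under_ob[OF F] by blast+
    from eventually_conj[OF ctxs.large_J eventually_germ[OF A(1) F]]
    obtain Z f where Z: "Z \<in> ctxs P" and f: "f \<in> H (L Z \<otimes> A) B" "F = germ A B f Z"
      by (rule ctxs.large_obtains) blast
    show ?thesis
      using under_rei_germ[OF A(1) Z f(1) fib_top_in[OF base.Prd_Ob[OF L_ob[OF Z] A(2)]]]
        rei_top[OF kext_hom[OF Z A(1) f(1)]]
      by (simp add: el_top[OF A(1) Z] el_top[OF A(2) Z] f(2))
  qed
  have meet: "greatest (fib U A) (a \<sqinter>\<^bsub>fib U A\<^esub> b) (Lower (fib U A) {a, b})"
    if A: "A \<in> ob" and a: "a \<in> carrier (fib U A)" and b: "b \<in> carrier (fib U A)" for A a b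
  proof -
    from two_el[OF A a A b] obtain Z \<alpha> \<beta> where Z: "Z \<in> ctxs P"
      and r: "\<alpha> \<in> Fb (L Z \<otimes> A)" "a = el_class P A (\<alpha>, Z)" "\<beta> \<in> Fb (L Z \<otimes> A)" "b = el_class P A (\<beta>, Z)"
      by (rule ctxs.large_obtains) blast
    show ?thesis using el_meet_greatest[OF A Z r(1,3)] el_meet[OF A Z r(1,3)] r by simp
  qed
  show "a \<sqinter>\<^bsub>fib U A\<^esub> b \<in> carrier (fib U A)" "a \<sqinter>\<^bsub>fib U A\<^esub> b \<sqsubseteq>\<^bsub>fib U A\<^esub> a" "a \<sqinter>\<^bsub>fib U A\<^esub> b \<sqsubseteq>\<^bsub>fib U A\<^esub> b"
    "\<And>c. \<lbrakk>c \<in> carrier (fib U A); c \<sqsubseteq>\<^bsub>fib U A\<^esub> a; c \<sqsubseteq>\<^bsub>fib U A\<^esub> b\<rbrakk> \<Longrightarrow> c \<sqsubseteq>\<^bsub>fib U A\<^esub> a \<sqinter>\<^bsub>fib U A\<^esub> b"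
    if "A \<in> ob" "a \<in> carrier (fib U A)" "b \<in> carrier (fib U A)" for A a b
    using meet[OF that] that by (auto simp: greatest_def Lower_def)
  show "rei U F (a \<sqinter>\<^bsub>fib U B\<^esub> b) = rei U F a \<sqinter>\<^bsub>fib U A\<^esub> rei U F b"
    if F: "F \<in> hom (under_cat P) A B" and a: "a \<in> carrier (fib U B)" and b: "b \<in> carrier (fib U B)" for F A B a b
  proof -
    have A: "A \<in> ob" "B \<in> ob" using hom_under_ob[OF F] by blast+
    obtain Z f \<alpha> \<beta> where Z: "Z \<in> ctxs P" and f: "f \<in> H (L Z \<otimes> A) B" "F = germ A B f Z"
      and \<alpha>: "\<alpha> \<in> Fb (L Z \<otimes> B)" "a = el_class P B (\<alpha>, Z)" and \<beta>: "\<beta> \<in> Fb (L Z \<otimes> B)" "b = el_class P B (\<beta>, Z)"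
      using germ_two[OF A F a b] by blast
    note k = kext_hom[OF Z A(1) f(1)]
    show ?thesis
      using under_rei_germ[OF A(1) Z f(1) \<alpha>(1)] under_rei_germ[OF A(1) Z f(1) \<beta>(1)]
        under_rei_germ[OF A(1) Z f(1) fib_meet_in[OF base.Prd_Ob[OF L_ob[OF Z] A(2)] \<alpha>(1) \<beta>(1)]]
        el_meet[OF A(2) Z \<alpha>(1) \<beta>(1)] el_meet[OF A(1) Z rei_in[OF k \<alpha>(1)] rei_in[OF k \<beta>(1)]]
        rei_meet[OF k \<alpha>(1) \<beta>(1)] f(2) \<alpha>(2) \<beta>(2) by simp
  qed
  show "exq U B A a \<in> carrier (fib U A)" if "B \<in> ob" "A \<in> ob" "a \<in> carrier (fib U (A \<otimes> B))" for A B a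
  proof -
    note AB = base.Prd_Ob[OF that(2,1)]
    from two_el[OF AB that(3) AB that(3)] obtain Z \<phi> where Z: "Z \<in> ctxs P"
      and \<phi>: "\<phi> \<in> Fb (L Z \<otimes> (A \<otimes> B))" "a = el_class P (A \<otimes> B) (\<phi>, Z)"
      by (rule ctxs.large_obtains) blast
    show ?thesis unfolding \<phi>(2) exq_under[OF that(2,1) Z \<phi>(1)]
      by (rule el_in[OF that(2) Z uex_in[OF that(2,1) Z \<phi>(1)]])
  qed
  show "exq U B A a \<sqsubseteq>\<^bsub>fib U A\<^esub> b \<longleftrightarrow> a \<sqsubseteq>\<^bsub>fib U (A \<otimes> B)\<^esub> rei U (Pr1 (under_cat P) A B) b"
    if "B \<in> ob" "A \<in> ob" "a \<in> carrier (fib U (A \<otimes> B))" "b \<in> carrier (fib U A)" for A B a b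
  proof -
    note AB = base.Prd_Ob[OF that(2,1)]
    from two_el[OF AB that(3) AB that(3)] obtain Z \<phi> where Z: "Z \<in> ctxs P"
      and \<phi>: "\<phi> \<in> Fb (L Z \<otimes> (A \<otimes> B))" "a = el_class P (A \<otimes> B) (\<phi>, Z)"
      by (rule ctxs.large_obtains) blast
    show ?thesis unfolding \<phi>(2) exq_under[OF that(2,1) Z \<phi>(1)]
      by (rule el_uex_le_iff[OF that(2,1) Z \<phi>(1) that(4)])
  qed
  show "exq U B A (rei U K a) = rei U F (exq U B A' a)"
    if "B \<in> ob" "F \<in> hom (under_cat P) A A'" "a \<in> carrier (fib U (A' \<otimes> B))"
      "K \<in> hom (under_cat P) (A \<otimes> B) (A' \<otimes> B)"
      "Cmp (under_cat P) (Pr1 (under_cat P) A' B) K = Cmp (under_cat P) F (Pr1 (under_cat P) A B)"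
      "Cmp (under_cat P) (Pr2 (under_cat P) A' B) K = Pr2 (under_cat P) A B" for B F A A' K a
    using under_beck_chevalley[OF that] .
  show "exq U B A (a \<sqinter>\<^bsub>fib U (A \<otimes> B)\<^esub> rei U (Pr1 (under_cat P) A B) b) = exq U B A a \<sqinter>\<^bsub>fib U A\<^esub> b"
    if "B \<in> ob" "A \<in> ob" "a \<in> carrier (fib U (A \<otimes> B))" "b \<in> carrier (fib U A)" for A B a b
  proof -
    note AB = base.Prd_Ob[OF that(2,1)]
    from two_el[OF AB that(3) that(2) that(4)] obtain Z \<phi> \<beta> where Z: "Z \<in> ctxs P"
      and \<phi>: "\<phi> \<in> Fb (L Z \<otimes> (A \<otimes> B))" "a = el_class P (A \<otimes> B) (\<phi>, Z)"
      and \<beta>: "\<beta> \<in> Fb (L Z \<otimes> A)" "b = el_class P A (\<beta>, Z)"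
      by (rule ctxs.large_obtains) blast
    note d = rei_drop2_in[OF that(2,1) Z \<beta>(1)] and LA = base.Prd_Ob[OF L_ob[OF Z] that(2)]
    let ?m = "\<phi> \<sqinter>\<^bsub>fib P (L Z \<otimes> (A \<otimes> B))\<^esub> rei P (drop2 (L Z) A B) \<beta>"
    have m: "?m \<in> Fb (L Z \<otimes> (A \<otimes> B))" using fib_meet_in[OF base.Prd_Ob[OF L_ob[OF Z] AB] \<phi>(1) d] .
    \<comment> \<open>Reassociation turns reindexing along \<open>drop2\<close> into reindexing
      along a first projection, the form in which Frobenius of \<open>P\<close> applies.\<close>
    have "uex Z B A ?m = uex Z B A \<phi> \<sqinter>\<^bsub>fib P (L Z \<otimes> A)\<^esub> \<beta>"
      unfolding uex_def rei_meet[OF asc_hom[OF L_ob[OF Z] that(2,1)] \<phi>(1) d] rei_asc_drop2[OF that(2,1) Z \<beta>(1)]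
      by (rule frobenius[OF that(1) LA rei_asc_in[OF that(2,1) Z \<phi>(1)] \<beta>(1)])
    then show ?thesis
      using under_rei_Pr1[OF that(2,1) Z \<beta>(1)] el_meet[OF AB Z \<phi>(1) d] exq_under[OF that(2,1) Z \<phi>(1)]
        exq_under[OF that(2,1) Z m] el_meet[OF that(2) Z uex_in[OF that(2,1) Z \<phi>(1)] \<beta>(1)] \<phi>(2) \<beta>(2)
      by simp
  qed
qed

end


section \<open>Adding a directed system of axioms to an existential doctrine\<close>

text \<open>An abstract form of the second colimit. In the application \<open>N\<close> consists of
  the finite sets of Henkin indices, and \<open>ax A V\<close> is the conjunction of the axioms in
  \<open>V\<close> seen over \<open>A\<close>. By \<open>rei_ax\<close> the axioms behave as closed
  formulas.\<close>

locale axiom_system = existential_doctrine P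
  for P :: "('o, 'm, 'p) doctrine_data" and N :: "'n set set" and ax :: "'o \<Rightarrow> 'n set \<Rightarrow> 'p" +
  assumes N_empty: "{} \<in> N"
    and N_Un: "\<lbrakk>V \<in> N; W \<in> N\<rbrakk> \<Longrightarrow> V \<union> W \<in> N"
    and ax_in: "\<lbrakk>A \<in> Ob (base P); V \<in> N\<rbrakk> \<Longrightarrow> ax A V \<in> carrier (fib P A)"
    and ax_antimono: "\<lbrakk>A \<in> Ob (base P); V \<in> N; W \<in> N; V \<subseteq> W\<rbrakk> \<Longrightarrow> ax A W \<sqsubseteq>\<^bsub>fib P A\<^esub> ax A V"
    and ax_Un: "\<lbrakk>A \<in> Ob (base P); V \<in> N; W \<in> N\<rbrakk> \<Longrightarrow> ax A V \<sqinter>\<^bsub>fib P A\<^esub> ax A W \<sqsubseteq>\<^bsub>fib P A\<^esub> ax A (V \<union> W)"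
    and rei_ax: "\<lbrakk>f \<in> hom (base P) A B; V \<in> N\<rbrakk> \<Longrightarrow> rei P f (ax B V) = ax A V"
begin

section \<open>Classes modulo the axioms\<close>

definition qreps :: "'o \<Rightarrow> ('p \<times> 'n set) set" where
  "qreps A = {(a, V). V \<in> N \<and> a \<in> carrier (fib P A) \<and> a \<sqsubseteq>\<^bsub>fib P A\<^esub> ax A V}"

definition qrel :: "'o \<Rightarrow> ('p \<times> 'n set) rel" where
  "qrel A = {((a, V), (b, V')). (a, V) \<in> qreps A \<and> (b, V') \<in> qreps A \<and>
     (\<exists>W\<in>N. V \<union> V' \<subseteq> W \<and> a \<sqinter>\<^bsub>fib P A\<^esub> ax A W = b \<sqinter>\<^bsub>fib P A\<^esub> ax A W)}"

definition qle :: "'o \<Rightarrow> ('p \<times> 'n set) set \<Rightarrow> ('p \<times> 'n set) set \<Rightarrow> bool" where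
  "qle A s t \<longleftrightarrow> (\<exists>(a, V)\<in>s. \<exists>(b, V')\<in>t. \<exists>W\<in>N. V \<union> V' \<subseteq> W \<and>
     a \<sqinter>\<^bsub>fib P A\<^esub> ax A W \<sqsubseteq>\<^bsub>fib P A\<^esub> b \<sqinter>\<^bsub>fib P A\<^esub> ax A W)"

definition qrei :: "'m \<Rightarrow> ('p \<times> 'n set) set \<Rightarrow> ('p \<times> 'n set) set" where
  "qrei f t = (\<Union>(b, V)\<in>t. qrel (Dom (base P) f) `` {(rei P f b, V)})"

definition quot :: "('o, 'm, ('p \<times> 'n set) set) doctrine_data" where
  "quot = \<lparr>base = base P, fib = (\<lambda>A. \<lparr>carrier = qreps A // qrel A, eq = (=), le = qle A\<rparr>), rei = qrei\<rparr>"

text \<open>The order of the quotient without the bookkeeping of \<open>qle\<close>: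
  \<open>W\<close> is not tied to the sets carried by the classes, and the axioms stand on the left
  only. Antitonicity of \<open>ax\<close> makes the two forms agree.\<close>

definition entails :: "'o \<Rightarrow> 'p \<Rightarrow> 'p \<Rightarrow> bool" where
  "entails A a b \<longleftrightarrow> (\<exists>W\<in>N. a \<sqinter>\<^bsub>fib P A\<^esub> ax A W \<sqsubseteq>\<^bsub>fib P A\<^esub> b)"

abbreviation "F A \<equiv> carrier (fib P A)"
abbreviation "qcl A a V \<equiv> qrel A `` {(a, V)}"

lemma qrepsD: "(a, V) \<in> qreps A \<Longrightarrow> V \<in> N \<and> a \<in> F A \<and> a \<sqsubseteq>\<^bsub>fib P A\<^esub> ax A V"
  by (simp add: qreps_def)

lemma qreps_in: "(a, V) \<in> qreps A \<Longrightarrow> a \<in> F A"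
  by (simp add: qreps_def)

lemma entailsI: "\<lbrakk>a \<sqinter>\<^bsub>fib P A\<^esub> ax A W \<sqsubseteq>\<^bsub>fib P A\<^esub> b; W \<in> N\<rbrakk> \<Longrightarrow> entails A a b"
  by (auto simp: entails_def)

context
  fixes A assumes A: "A \<in> Ob (base P)"
begin

lemma meet_ax_le:
  assumes "a \<in> F A" "W \<in> N" "W' \<in> N" "W \<subseteq> W'"
  shows "a \<sqinter>\<^bsub>fib P A\<^esub> ax A W' \<sqsubseteq>\<^bsub>fib P A\<^esub> a \<sqinter>\<^bsub>fib P A\<^esub> ax A W"
proof -
  note i = ax_in[OF A assms(2)] ax_in[OF A assms(3)]
  note m = fib_meet_in[OF A assms(1) i(2)]
  show ?thesis
    by (rule le_fib_meet[OF A fib_meet_left[OF A assms(1) i(2)]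
        fib_trans[OF A fib_meet_right[OF A assms(1) i(2)] ax_antimono[OF A assms(2-4)] m i(2,1)] assms(1) i(1) m])
qed

lemma entails_mono:
  assumes "a \<in> F A" "b \<in> F A" "W \<in> N" "W' \<in> N" "W \<subseteq> W'" "a \<sqinter>\<^bsub>fib P A\<^esub> ax A W \<sqsubseteq>\<^bsub>fib P A\<^esub> b"
  shows "a \<sqinter>\<^bsub>fib P A\<^esub> ax A W' \<sqsubseteq>\<^bsub>fib P A\<^esub> b \<sqinter>\<^bsub>fib P A\<^esub> ax A W'"
proof -
  note i = ax_in[OF A assms(3)] ax_in[OF A assms(4)]
  note m = fib_meet_in[OF A assms(1) i(1)] fib_meet_in[OF A assms(1) i(2)]
  show ?thesis
    by (rule le_fib_meet[OF A fib_trans[OF A meet_ax_le[OF assms(1,3-5)] assms(6) m(2,1) assms(2)]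
        fib_meet_right[OF A assms(1) i(2)] assms(2) i(2) m(2)])
qed

lemma le_entails:
  assumes "a \<in> F A" "b \<in> F A" "a \<sqsubseteq>\<^bsub>fib P A\<^esub> b"
  shows "entails A a b"
proof -
  note i = ax_in[OF A N_empty]
  have "a \<sqinter>\<^bsub>fib P A\<^esub> ax A {} \<sqsubseteq>\<^bsub>fib P A\<^esub> b"
    by (rule fib_trans[OF A fib_meet_left[OF A assms(1) i] assms(3) fib_meet_in[OF A assms(1) i] assms(1,2)])
  then show ?thesis using N_empty by (auto simp: entails_def)
qed

lemma entails_ax: "\<lbrakk>a \<in> F A; V \<in> N\<rbrakk> \<Longrightarrow> entails A a (ax A V)"
  using fib_meet_right[OF A _ ax_in[OF A]] by (auto simp: entails_def)

text \<open>Two entailments can share one set of axioms, since both survive enlarging it to the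
  union. A prescribed \<open>V\<close> is absorbed too, because \<open>qrel\<close> and
  \<open>qle\<close> ask for a \<open>W\<close> above the sets of the representatives.\<close>

lemma entails_common:
  assumes "a \<in> F A" "b \<in> F A" "c \<in> F A" "d \<in> F A" "entails A a b" "entails A c d" "V \<in> N"
  obtains W where "W \<in> N" "V \<subseteq> W"
    "a \<sqinter>\<^bsub>fib P A\<^esub> ax A W \<sqsubseteq>\<^bsub>fib P A\<^esub> b \<sqinter>\<^bsub>fib P A\<^esub> ax A W" "c \<sqinter>\<^bsub>fib P A\<^esub> ax A W \<sqsubseteq>\<^bsub>fib P A\<^esub> d \<sqinter>\<^bsub>fib P A\<^esub> ax A W"
proof -
  obtain W1 W2 where W: "W1 \<in> N" "W2 \<in> N" "a \<sqinter>\<^bsub>fib P A\<^esub> ax A W1 \<sqsubseteq>\<^bsub>fib P A\<^esub> b" "c \<sqinter>\<^bsub>fib P A\<^esub> ax A W2 \<sqsubseteq>\<^bsub>fib P A\<^esub> d"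
    using assms(5,6) by (auto simp: entails_def)
  have "V \<union> (W1 \<union> W2) \<in> N" using W assms N_Un by blast
  with that[of "V \<union> (W1 \<union> W2)"] entails_mono W assms show thesis by blast
qed

lemma entails_trans:
  assumes "a \<in> F A" "b \<in> F A" "c \<in> F A" "entails A a b" "entails A b c"
  shows "entails A a c"
proof -
  obtain W where W: "W \<in> N" "a \<sqinter>\<^bsub>fib P A\<^esub> ax A W \<sqsubseteq>\<^bsub>fib P A\<^esub> b \<sqinter>\<^bsub>fib P A\<^esub> ax A W"
    "b \<sqinter>\<^bsub>fib P A\<^esub> ax A W \<sqsubseteq>\<^bsub>fib P A\<^esub> c \<sqinter>\<^bsub>fib P A\<^esub> ax A W"
    using entails_common[OF assms(1,2,2,3,4,5) N_empty] by blast
  note i = ax_in[OF A W(1)]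
  note m = fib_meet_in[OF A assms(1) i] fib_meet_in[OF A assms(2) i] fib_meet_in[OF A assms(3) i]
  show ?thesis
    by (rule entailsI[OF fib_trans[OF A fib_trans[OF A W(2,3) m] fib_meet_left[OF A assms(3) i] m(1,3) assms(3)] W(1)])
qed

lemma entails_meet:
  assumes "a \<in> F A" "b \<in> F A" "c \<in> F A" "entails A c a" "entails A c b"
  shows "entails A c (a \<sqinter>\<^bsub>fib P A\<^esub> b)"
proof -
  obtain W where W: "W \<in> N" "c \<sqinter>\<^bsub>fib P A\<^esub> ax A W \<sqsubseteq>\<^bsub>fib P A\<^esub> a \<sqinter>\<^bsub>fib P A\<^esub> ax A W"
    "c \<sqinter>\<^bsub>fib P A\<^esub> ax A W \<sqsubseteq>\<^bsub>fib P A\<^esub> b \<sqinter>\<^bsub>fib P A\<^esub> ax A W"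
    using entails_common[OF assms(3,1,3,2,4,5) N_empty] by blast
  note i = ax_in[OF A W(1)]
  note m = fib_meet_in[OF A assms(1) i] fib_meet_in[OF A assms(2) i] fib_meet_in[OF A assms(3) i]
  have "c \<sqinter>\<^bsub>fib P A\<^esub> ax A W \<sqsubseteq>\<^bsub>fib P A\<^esub> a" "c \<sqinter>\<^bsub>fib P A\<^esub> ax A W \<sqsubseteq>\<^bsub>fib P A\<^esub> b"
    by (rule fib_trans[OF A W(2) fib_meet_left[OF A assms(1) i] m(3,1) assms(1)]
      fib_trans[OF A W(3) fib_meet_left[OF A assms(2) i] m(3,2) assms(2)])+
  from le_fib_meet[OF A this assms(1,2) m(3)] W(1) show ?thesis
    unfolding entails_def by blast
qed

text \<open>Equality of the meets with \<open>ax A W\<close> gives both entailments. Conversely they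
  are witnessed by a common \<open>W\<close> containing \<open>V\<close> and \<open>V'\<close>,
  where antisymmetry applies.\<close>

lemma qrel_iff:
  "((a, V), (b, V')) \<in> qrel A \<longleftrightarrow>
    (a, V) \<in> qreps A \<and> (b, V') \<in> qreps A \<and> entails A a b \<and> entails A b a"
proof -
  have "(\<exists>W\<in>N. V \<union> V' \<subseteq> W \<and> a \<sqinter>\<^bsub>fib P A\<^esub> ax A W = b \<sqinter>\<^bsub>fib P A\<^esub> ax A W) \<longleftrightarrow> entails A a b \<and> entails A b a"
    if "(a, V) \<in> qreps A" "(b, V') \<in> qreps A"
  proof
    note ab = qrepsD[OF that(1)] qrepsD[OF that(2)]
    assume "\<exists>W\<in>N. V \<union> V' \<subseteq> W \<and> a \<sqinter>\<^bsub>fib P A\<^esub> ax A W = b \<sqinter>\<^bsub>fib P A\<^esub> ax A W"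
    then obtain W where W: "W \<in> N" "a \<sqinter>\<^bsub>fib P A\<^esub> ax A W = b \<sqinter>\<^bsub>fib P A\<^esub> ax A W" by blast
    have "a \<sqinter>\<^bsub>fib P A\<^esub> ax A W \<sqsubseteq>\<^bsub>fib P A\<^esub> a" "b \<sqinter>\<^bsub>fib P A\<^esub> ax A W \<sqsubseteq>\<^bsub>fib P A\<^esub> b"
      using fib_meet_left[OF A _ ax_in[OF A W(1)]] ab by blast+
    with W show "entails A a b \<and> entails A b a" unfolding entails_def by metis
  next
    note ab = qrepsD[OF that(1)] qrepsD[OF that(2)]
    then have i: "a \<in> F A" "b \<in> F A" and V: "V \<union> V' \<in> N" using N_Un by blast+
    assume "entails A a b \<and> entails A b a"
    then obtain W where W: "W \<in> N" "V \<union> V' \<subseteq> W" "a \<sqinter>\<^bsub>fib P A\<^esub> ax A W \<sqsubseteq>\<^bsub>fib P A\<^esub> b \<sqinter>\<^bsub>fib P A\<^esub> ax A W"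
      "b \<sqinter>\<^bsub>fib P A\<^esub> ax A W \<sqsubseteq>\<^bsub>fib P A\<^esub> a \<sqinter>\<^bsub>fib P A\<^esub> ax A W"
      using entails_common[OF i i(2,1) _ _ V] by blast
    note ix = ax_in[OF A W(1)]
    have "a \<sqinter>\<^bsub>fib P A\<^esub> ax A W = b \<sqinter>\<^bsub>fib P A\<^esub> ax A W"
      by (rule fib_antisym[OF A fib_meet_in[OF A i(1) ix] fib_meet_in[OF A i(2) ix] W(3,4)])
    with W show "\<exists>W\<in>N. V \<union> V' \<subseteq> W \<and> a \<sqinter>\<^bsub>fib P A\<^esub> ax A W = b \<sqinter>\<^bsub>fib P A\<^esub> ax A W" by blast
  qed
  then show ?thesis by (auto simp: qrel_def)
qed

lemma entails_refl: "a \<in> F A \<Longrightarrow> entails A a a"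
  by (rule le_entails[OF _ _ fib_refl[OF A]])

lemma equiv_qrel: "equiv (qreps A) (qrel A)"
proof (rule equivI)
  show "qrel A \<subseteq> qreps A \<times> qreps A" by (auto simp: qrel_def)
  show "refl_on (qreps A) (qrel A)" 
    unfolding refl_on_def by (auto simp: qrel_iff entails_refl[OF qreps_in])
  show "sym (qrel A)" by (auto simp: sym_def qrel_iff)
  show "trans (qrel A)"
  proof (rule transI, clarify)
    fix a V b V' c V'' assume "((a, V), (b, V')) \<in> qrel A" "((b, V'), (c, V'')) \<in> qrel A"
    then have r: "(a, V) \<in> qreps A" "(b, V') \<in> qreps A" "(c, V'') \<in> qreps A"
      and e: "entails A a b" "entails A b a" "entails A b c" "entails A c b"
      by (simp_all add: qrel_iff)
    note i = r[THEN qreps_in]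
    show "((a, V), (c, V'')) \<in> qrel A"
      using r entails_trans[OF i e(1,3)] entails_trans[OF i(3,2,1) e(4,2)] by (simp add: qrel_iff)
  qed
qed

lemma qcl_eq_iff:
  "\<lbrakk>(a, V) \<in> qreps A; (b, V') \<in> qreps A\<rbrakk> \<Longrightarrow> qcl A a V = qcl A b V' \<longleftrightarrow> entails A a b \<and> entails A b a"
  using eq_equiv_class_iff[OF equiv_qrel] by (simp add: qrel_iff)

lemma qcl_in: "(a, V) \<in> qreps A \<Longrightarrow> qcl A a V \<in> carrier (fib quot A)"
  by (simp add: quot_def quotientI)

lemma qcl_cases:
  assumes "s \<in> carrier (fib quot A)"
  obtains a V where "(a, V) \<in> qreps A" "s = qcl A a V"
  using assms by (auto simp: quot_def elim: quotientE)

lemma qcl_self: "(a, V) \<in> qreps A \<Longrightarrow> (a, V) \<in> qcl A a V"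
  using equiv_class_self[OF equiv_qrel] .

lemma qle_iff:
  assumes "(a, V) \<in> qreps A" "(b, V') \<in> qreps A"
  shows "qcl A a V \<sqsubseteq>\<^bsub>fib quot A\<^esub> qcl A b V' \<longleftrightarrow> entails A a b"
proof
  note ab = qrepsD[OF assms(1)] qrepsD[OF assms(2)]
  assume "qcl A a V \<sqsubseteq>\<^bsub>fib quot A\<^esub> qcl A b V'"
  then obtain a0 V0 b0 V0' W where m: "((a, V), (a0, V0)) \<in> qrel A" "((b, V'), (b0, V0')) \<in> qrel A"
    and W: "W \<in> N" "a0 \<sqinter>\<^bsub>fib P A\<^esub> ax A W \<sqsubseteq>\<^bsub>fib P A\<^esub> b0 \<sqinter>\<^bsub>fib P A\<^esub> ax A W"
    by (auto simp: quot_def qle_def)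
  then have i: "a0 \<in> F A" "b0 \<in> F A" and e: "entails A a a0" "entails A b0 b"
    by (auto simp: qrel_iff qreps_in)
  note ix = ax_in[OF A W(1)]
  have "entails A a0 b0"
    by (rule entailsI[OF fib_trans[OF A W(2) fib_meet_left[OF A i(2) ix] fib_meet_in[OF A i(1) ix]
        fib_meet_in[OF A i(2) ix] i(2)] W(1)])
  then show "entails A a b"
    using entails_trans[OF _ i(1,2) e(1)] entails_trans[OF _ i(2) _ _ e(2)] ab by blast
next
  note ab = qrepsD[OF assms(1)] qrepsD[OF assms(2)]
  then have i: "a \<in> F A" "b \<in> F A" and V: "V \<union> V' \<in> N" using N_Un by blast+
  assume e: "entails A a b"
  then obtain W where "W \<in> N" "V \<union> V' \<subseteq> W" "a \<sqinter>\<^bsub>fib P A\<^esub> ax A W \<sqsubseteq>\<^bsub>fib P A\<^esub> b \<sqinter>\<^bsub>fib P A\<^esub> ax A W"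
    using entails_common[OF i i e e V] by blast
  with qcl_self[OF assms(1)] qcl_self[OF assms(2)] show "qcl A a V \<sqsubseteq>\<^bsub>fib quot A\<^esub> qcl A b V'"
    unfolding quot_def qle_def by simp blast
qed

lemma quot_partial_order: "partial_order (fib quot A)"
proof (rule partial_orderI)
  show "eq (fib quot A) = (=)" by (simp add: quot_def)
  show "s \<sqsubseteq>\<^bsub>fib quot A\<^esub> s" if "s \<in> carrier (fib quot A)" for s
    using that by (auto elim!: qcl_cases simp: qle_iff intro: entails_refl[OF qreps_in])
  show "s = t" if s: "s \<in> carrier (fib quot A)" and t: "t \<in> carrier (fib quot A)"
    and le: "s \<sqsubseteq>\<^bsub>fib quot A\<^esub> t" "t \<sqsubseteq>\<^bsub>fib quot A\<^esub> s" for s t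
  proof -
    from s obtain a V where a: "(a, V) \<in> qreps A" "s = qcl A a V" by (rule qcl_cases)
    from t obtain b V' where b: "(b, V') \<in> qreps A" "t = qcl A b V'" by (rule qcl_cases)
    show ?thesis
      using le unfolding a(2) b(2) qle_iff[OF a(1) b(1)] qle_iff[OF b(1) a(1)] qcl_eq_iff[OF a(1) b(1)]
      by blast
  qed
  show "s \<sqsubseteq>\<^bsub>fib quot A\<^esub> u" if s: "s \<in> carrier (fib quot A)" and t: "t \<in> carrier (fib quot A)"
    and u: "u \<in> carrier (fib quot A)" and le: "s \<sqsubseteq>\<^bsub>fib quot A\<^esub> t" "t \<sqsubseteq>\<^bsub>fib quot A\<^esub> u" for s t u
  proof -
    from s obtain a V where a: "(a, V) \<in> qreps A" "s = qcl A a V" by (rule qcl_cases)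
    from t obtain b V' where b: "(b, V') \<in> qreps A" "t = qcl A b V'" by (rule qcl_cases)
    from u obtain c V'' where c: "(c, V'') \<in> qreps A" "u = qcl A c V''" by (rule qcl_cases)
    show ?thesis
      using le entails_trans[OF qreps_in[OF a(1)] qreps_in[OF b(1)] qreps_in[OF c(1)]]
      unfolding a(2) b(2) c(2) qle_iff[OF a(1) b(1)] qle_iff[OF b(1) c(1)] qle_iff[OF a(1) c(1)] by blast
  qed
qed

text \<open>A representative must lie below its own axioms; the meet lies below both conjunctions
  and hence, by \<open>ax_Un\<close>, below that of the union.\<close>

lemma qreps_meet:
  assumes "(a, V) \<in> qreps A" "(b, V') \<in> qreps A"
  shows "(a \<sqinter>\<^bsub>fib P A\<^esub> b, V \<union> V') \<in> qreps A"
proof -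
  note a = qrepsD[OF assms(1)] and b = qrepsD[OF assms(2)]
  have i: "a \<in> F A" "b \<in> F A" "V \<in> N" "V' \<in> N" using a b by blast+
  note m = fib_meet_in[OF A i(1,2)] and ix = ax_in[OF A i(3)] ax_in[OF A i(4)]
  have "a \<sqinter>\<^bsub>fib P A\<^esub> b \<sqsubseteq>\<^bsub>fib P A\<^esub> ax A V" "a \<sqinter>\<^bsub>fib P A\<^esub> b \<sqsubseteq>\<^bsub>fib P A\<^esub> ax A V'"
    using fib_trans[OF A fib_meet_left[OF A i(1,2)] _ m i(1) ix(1)]
      fib_trans[OF A fib_meet_right[OF A i(1,2)] _ m i(2) ix(2)] a b by blast+
  then have "a \<sqinter>\<^bsub>fib P A\<^esub> b \<sqsubseteq>\<^bsub>fib P A\<^esub> ax A V \<sqinter>\<^bsub>fib P A\<^esub> ax A V'"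
    using le_fib_meet[OF A _ _ ix m] by blast
  from fib_trans[OF A this ax_Un[OF A i(3,4)] m fib_meet_in[OF A ix] ax_in[OF A N_Un[OF i(3,4)]]]
  show ?thesis using m N_Un[OF i(3,4)] by (simp add: qreps_def)
qed

lemma
  assumes a: "(a, V) \<in> qreps A" and b: "(b, V') \<in> qreps A"
  defines "m \<equiv> qcl A (a \<sqinter>\<^bsub>fib P A\<^esub> b) (V \<union> V')"
  shows quot_meet_greatest: "greatest (fib quot A) m (Lower (fib quot A) {qcl A a V, qcl A b V'})"
    and quot_meet: "qcl A a V \<sqinter>\<^bsub>fib quot A\<^esub> qcl A b V' = m"
proof -
  have i: "a \<in> F A" "b \<in> F A" using qrepsD[OF a] qrepsD[OF b] by blast+
  note m = fib_meet_in[OF A i] and r = qreps_meet[OF a b]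
  show "greatest (fib quot A) m (Lower (fib quot A) {qcl A a V, qcl A b V'})"
    unfolding m_def
  proof (rule greatest_Lower_two)
    show "qcl A (a \<sqinter>\<^bsub>fib P A\<^esub> b) (V \<union> V') \<sqsubseteq>\<^bsub>fib quot A\<^esub> qcl A a V"
      unfolding qle_iff[OF r a] by (rule le_entails[OF m i(1) fib_meet_left[OF A i]])
    show "qcl A (a \<sqinter>\<^bsub>fib P A\<^esub> b) (V \<union> V') \<sqsubseteq>\<^bsub>fib quot A\<^esub> qcl A b V'"
      unfolding qle_iff[OF r b] by (rule le_entails[OF m i(2) fib_meet_right[OF A i]])
    fix s assume s: "s \<in> carrier (fib quot A)" "s \<sqsubseteq>\<^bsub>fib quot A\<^esub> qcl A a V" "s \<sqsubseteq>\<^bsub>fib quot A\<^esub> qcl A b V'"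
    from s(1) obtain c V'' where c: "(c, V'') \<in> qreps A" "s = qcl A c V''" by (rule qcl_cases)
    then show "s \<sqsubseteq>\<^bsub>fib quot A\<^esub> qcl A (a \<sqinter>\<^bsub>fib P A\<^esub> b) (V \<union> V')"
      using s(2,3) entails_meet[OF i] qrepsD[OF c(1)] by (simp add: qle_iff a b r)
  qed (use qcl_in a b r in auto)
  then show "qcl A a V \<sqinter>\<^bsub>fib quot A\<^esub> qcl A b V' = m"
    by (rule partial_order.meet_eqI[OF quot_partial_order])
qed

lemma qreps_ax: "V \<in> N \<Longrightarrow> (ax A V, V) \<in> qreps A"
  using ax_in[OF A] fib_refl[OF A] by (simp add: qreps_def)

end

section \<open>Reindexing and quantifiers modulo the axioms\<close>

lemma rei_entails:
  assumes f: "f \<in> hom (base P) A B" and i: "a \<in> F B" "b \<in> F B" and e: "entails B a b"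
  shows "entails A (rei P f a) (rei P f b)"
proof -
  have B: "B \<in> Ob (base P)" using hom_Ob[OF f] by blast
  obtain W where W: "W \<in> N" "a \<sqinter>\<^bsub>fib P B\<^esub> ax B W \<sqsubseteq>\<^bsub>fib P B\<^esub> b" using e by (auto simp: entails_def)
  note ix = ax_in[OF B W(1)]
  have "rei P f (a \<sqinter>\<^bsub>fib P B\<^esub> ax B W) \<sqsubseteq>\<^bsub>fib P A\<^esub> rei P f b"
    by (rule rei_mono[OF f fib_meet_in[OF B i(1) ix] i(2) W(2)])
  then show ?thesis using rei_meet[OF f i(1) ix] rei_ax[OF f W(1)] W(1) by (auto simp: entails_def)
qed

lemma qreps_rei:
  assumes "f \<in> hom (base P) A B" "(b, V) \<in> qreps B"
  shows "(rei P f b, V) \<in> qreps A"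
proof -
  have b: "V \<in> N" "b \<in> F B" "b \<sqsubseteq>\<^bsub>fib P B\<^esub> ax B V" and B: "B \<in> Ob (base P)"
    using qrepsD[OF assms(2)] hom_Ob[OF assms(1)] by blast+
  show ?thesis
    using rei_in[OF assms(1) b(2)] rei_mono[OF assms(1) b(2) ax_in[OF B b(1)] b(3)] rei_ax[OF assms(1) b(1)] b(1)
    by (simp add: qreps_def)
qed

text \<open>\<open>qrei\<close> is a union over representatives. Reindexing respects entailment, so
  all members coincide, and the union over a nonempty class is their common value.\<close>

lemma quot_rei:
  assumes f: "f \<in> hom (base P) A B" and b: "(b, V) \<in> qreps B"
  shows "rei quot f (qcl B b V) = qcl A (rei P f b) V"
proof -
  have A: "A \<in> Ob (base P)" "B \<in> Ob (base P)" "Dom (base P) f = A"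
    using hom_Ob[OF f] f by (auto simp: base.hom_iff)
  have "qcl A (rei P f b') V' = qcl A (rei P f b) V" if m: "(b', V') \<in> qcl B b V" for b' V'
  proof -
    from m have b': "(b', V') \<in> qreps B" and e: "entails B b b'" "entails B b' b"
      by (auto simp: qrel_iff[OF A(2)])
    then show ?thesis
      using qcl_eq_iff[OF A(1) qreps_rei[OF f b'] qreps_rei[OF f b]] rei_entails[OF f] qrepsD[OF b] qrepsD[OF b'] by blast
  qed
  moreover have "qcl B b V \<noteq> {}" using qcl_self[OF A(2) b] by blast
  ultimately have "(\<Union>(b', V')\<in>qcl B b V. qcl A (rei P f b') V') = qcl A (rei P f b) V"
    by (intro SUP_eq_const) (simp_all only: split_paired_all prod.case not_False_eq_True)
  then show ?thesis by (simp add: quot_def qrei_def A(3))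
qed

text \<open>The set \<open>V\<close> can be kept under the quantifier: by adjunction the quantified
  element lies below \<open>ax A V\<close> as soon as \<open>a\<close> lies below its reindexing,
  which is again an axiom.\<close>

lemma
  assumes B: "B \<in> Ob (base P)" and A: "A \<in> Ob (base P)" and a: "(a, V) \<in> qreps (Prd (base P) A B)"
  shows qreps_exq: "(exq P B A a, V) \<in> qreps A"
    and quot_exq_le_iff: "t \<in> carrier (fib quot A) \<Longrightarrow> qcl A (exq P B A a) V \<sqsubseteq>\<^bsub>fib quot A\<^esub> t
      \<longleftrightarrow> qcl (Prd (base P) A B) a V \<sqsubseteq>\<^bsub>fib quot (Prd (base P) A B)\<^esub> rei quot (Pr1 (base P) A B) t"
    and quot_exq: "exq quot B A (qcl (Prd (base P) A B) a V) = qcl A (exq P B A a) V"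
proof -
  let ?AB = "Prd (base P) A B" and ?p = "Pr1 (base P) A B"
  note AB = base.Prd_Ob[OF A B] and p = base.Pr1_hom[OF A B]
  from qrepsD[OF a] have i: "V \<in> N" "a \<in> F ?AB" "a \<sqsubseteq>\<^bsub>fib P ?AB\<^esub> ax ?AB V" by blast+
  note e = exq_in[OF B A i(2)]
  show r: "(exq P B A a, V) \<in> qreps A"
    using i e exq_le_iff[OF B A i(2) ax_in[OF A i(1)]] rei_ax[OF p i(1)] by (simp add: qreps_def)
  show adj: "qcl A (exq P B A a) V \<sqsubseteq>\<^bsub>fib quot A\<^esub> t
      \<longleftrightarrow> qcl ?AB a V \<sqsubseteq>\<^bsub>fib quot ?AB\<^esub> rei quot ?p t" if "t \<in> carrier (fib quot A)" for t
  proof -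
    from that obtain b V' where b: "(b, V') \<in> qreps A" "t = qcl A b V'" by (rule qcl_cases[OF A])
    then have bi: "b \<in> F A" using qrepsD by blast
    \<comment> \<open>Frobenius moves the axiom under the quantifier, and stability of the axioms
      identifies its reindexing with \<open>ax ?AB W\<close>; so one \<open>W\<close> witnesses both
      entailments.\<close>
    have "exq P B A a \<sqinter>\<^bsub>fib P A\<^esub> ax A W \<sqsubseteq>\<^bsub>fib P A\<^esub> b
        \<longleftrightarrow> a \<sqinter>\<^bsub>fib P ?AB\<^esub> ax ?AB W \<sqsubseteq>\<^bsub>fib P ?AB\<^esub> rei P ?p b" if W: "W \<in> N" for W
      using frobenius[OF B A i(2) ax_in[OF A W]] rei_ax[OF p W]
        exq_le_iff[OF B A fib_meet_in[OF AB i(2) ax_in[OF AB W]] bi] by simp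
    then show ?thesis
      unfolding b(2) quot_rei[OF p b(1)] qle_iff[OF A r b(1)] qle_iff[OF AB a qreps_rei[OF p b(1)]] entails_def
      by blast
  qed
  show "exq quot B A (qcl ?AB a V) = qcl A (exq P B A a) V"
    by (rule exq_eqI[OF quot_partial_order[OF A] qcl_in[OF A r]]) (simp add: adj, simp add: quot_def)
qed

lemma quot_base: "base quot = base P"
  by (simp add: quot_def)

lemma quot_existential: "existential_doctrine quot"
\<comment> \<open>The top class is that of \<open>ax A {}\<close>: representatives have to lie below
  their axioms, and every element entails \<open>ax A {}\<close>.\<close>
proof (rule existential_doctrineI[where tp = "\<lambda>A. qcl A (ax A {}) {}" and mt = "\<lambda>A a b. a \<sqinter>\<^bsub>fib quot A\<^esub> b"
      and ex = "exq quot"], unfold quot_base)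
  show "fp_category (base P)" by (rule base_fp_category)
  show "partial_order (fib quot A)" if "A \<in> Ob (base P)" for A using quot_partial_order[OF that] .
  fix f A B assume f: "f \<in> hom (base P) A B"
  then have A: "A \<in> Ob (base P)" "B \<in> Ob (base P)" using hom_Ob by blast+
  show "rei quot f s \<in> carrier (fib quot A)" if "s \<in> carrier (fib quot B)" for s
    using that by (auto elim!: qcl_cases[OF A(2)] simp: quot_rei[OF f] intro!: qcl_in[OF A(1)] qreps_rei[OF f])
  show "rei quot f s \<sqsubseteq>\<^bsub>fib quot A\<^esub> rei quot f t"
    if "s \<in> carrier (fib quot B)" "t \<in> carrier (fib quot B)" "s \<sqsubseteq>\<^bsub>fib quot B\<^esub> t" for s t
    using that by (auto elim!: qcl_cases[OF A(2)] intro: rei_entails[OF f qreps_in qreps_in]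
        simp: quot_rei[OF f] qle_iff[OF A(1)] qle_iff[OF A(2)] qreps_rei[OF f])
  show "rei quot f (qcl B (ax B {}) {}) = qcl A (ax A {}) {}"
    using quot_rei[OF f qreps_ax[OF A(2) N_empty]] rei_ax[OF f N_empty] by simp
  show "rei quot f (s \<sqinter>\<^bsub>fib quot B\<^esub> t) = rei quot f s \<sqinter>\<^bsub>fib quot A\<^esub> rei quot f t"
    if "s \<in> carrier (fib quot B)" "t \<in> carrier (fib quot B)" for s t
  proof -
    from that obtain a V b V' where r: "(a, V) \<in> qreps B" "s = qcl B a V" "(b, V') \<in> qreps B" "t = qcl B b V'"
      by (auto elim!: qcl_cases[OF A(2)])
    then show ?thesis
      using quot_meet[OF A(2) r(1,3)] quot_meet[OF A(1) qreps_rei[OF f r(1)] qreps_rei[OF f r(3)]]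
        quot_rei[OF f qreps_meet[OF A(2) r(1,3)]] rei_meet[OF f] qrepsD[OF r(1)] qrepsD[OF r(3)]
      by (simp add: quot_rei[OF f])
  qed
next
  fix A assume A: "A \<in> Ob (base P)"
  show "rei quot (Idt (base P) A) s = s" if s: "s \<in> carrier (fib quot A)" for s
  proof -
    from s obtain a V where a: "(a, V) \<in> qreps A" "s = qcl A a V" by (rule qcl_cases[OF A])
    then show ?thesis
      using quot_rei[OF base.Idt_hom[OF A] a(1)] rei_Idt[OF A qreps_in[OF a(1)]] by simp
  qed
  show "qcl A (ax A {}) {} \<in> carrier (fib quot A)"
    using qcl_in[OF A qreps_ax[OF A N_empty]] .
  show "s \<sqsubseteq>\<^bsub>fib quot A\<^esub> qcl A (ax A {}) {}" if "s \<in> carrier (fib quot A)" for s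
  proof -
    from that obtain a V where a: "(a, V) \<in> qreps A" "s = qcl A a V" by (rule qcl_cases[OF A])
    show ?thesis
      unfolding a(2) qle_iff[OF A a(1) qreps_ax[OF A N_empty]] by (rule entails_ax[OF A qreps_in[OF a(1)] N_empty])
  qed
  have meet: "greatest (fib quot A) (s \<sqinter>\<^bsub>fib quot A\<^esub> t) (Lower (fib quot A) {s, t})"
    if "s \<in> carrier (fib quot A)" "t \<in> carrier (fib quot A)" for s t
  proof -
    from that(1) obtain a V where a: "(a, V) \<in> qreps A" "s = qcl A a V" by (rule qcl_cases[OF A])
    from that(2) obtain b V' where b: "(b, V') \<in> qreps A" "t = qcl A b V'" by (rule qcl_cases[OF A])
    show ?thesis
      using quot_meet_greatest[OF A a(1) b(1)] unfolding a(2) b(2) quot_meet[OF A a(1) b(1)] .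
  qed
  show "s \<sqinter>\<^bsub>fib quot A\<^esub> t \<in> carrier (fib quot A)" "s \<sqinter>\<^bsub>fib quot A\<^esub> t \<sqsubseteq>\<^bsub>fib quot A\<^esub> s" "s \<sqinter>\<^bsub>fib quot A\<^esub> t \<sqsubseteq>\<^bsub>fib quot A\<^esub> t"
    "\<And>c. \<lbrakk>c \<in> carrier (fib quot A); c \<sqsubseteq>\<^bsub>fib quot A\<^esub> s; c \<sqsubseteq>\<^bsub>fib quot A\<^esub> t\<rbrakk> \<Longrightarrow> c \<sqsubseteq>\<^bsub>fib quot A\<^esub> s \<sqinter>\<^bsub>fib quot A\<^esub> t"
    if "s \<in> carrier (fib quot A)" "t \<in> carrier (fib quot A)" for s t
    using meet[OF that] that by (auto simp: greatest_def Lower_def)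
next
  fix f g A B D s assume a: "f \<in> hom (base P) A B" "g \<in> hom (base P) B D" "s \<in> carrier (fib quot D)"
  then have D: "D \<in> Ob (base P)" using hom_Ob by blast
  from a(3) obtain b V where b: "(b, V) \<in> qreps D" "s = qcl D b V" by (rule qcl_cases[OF D])
  then show "rei quot (g \<cdot>\<^bsub>base P\<^esub> f) s = rei quot f (rei quot g s)"
    using quot_rei[OF base.Cmp_hom[OF a(1,2)] b(1)] quot_rei[OF a(2) b(1)] quot_rei[OF a(1) qreps_rei[OF a(2) b(1)]]
      rei_Cmp[OF a(1,2)] qrepsD[OF b(1)] by simp
next
  fix B A s assume B: "B \<in> Ob (base P)" and A: "A \<in> Ob (base P)" and s: "s \<in> carrier (fib quot (Prd (base P) A B))"
  note AB = base.Prd_Ob[OF A B] and p = base.Pr1_hom[OF A B]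
  from s obtain a V where a: "(a, V) \<in> qreps (Prd (base P) A B)" "s = qcl (Prd (base P) A B) a V"
    by (rule qcl_cases[OF AB])
  show "exq quot B A s \<in> carrier (fib quot A)"
    unfolding a(2) quot_exq[OF B A a(1)] by (rule qcl_in[OF A qreps_exq[OF B A a(1)]])
  fix t assume t: "t \<in> carrier (fib quot A)"
  show "exq quot B A s \<sqsubseteq>\<^bsub>fib quot A\<^esub> t \<longleftrightarrow> s \<sqsubseteq>\<^bsub>fib quot (Prd (base P) A B)\<^esub> rei quot (Pr1 (base P) A B) t"
    unfolding a(2) quot_exq[OF B A a(1)] by (rule quot_exq_le_iff[OF B A a(1) t])
  from t obtain b V' where b: "(b, V') \<in> qreps A" "t = qcl A b V'" by (rule qcl_cases[OF A])
  show "exq quot B A (s \<sqinter>\<^bsub>fib quot (Prd (base P) A B)\<^esub> rei quot (Pr1 (base P) A B) t) = exq quot B A s \<sqinter>\<^bsub>fib quot A\<^esub> t"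
    using quot_rei[OF p b(1)] quot_meet[OF AB a(1) qreps_rei[OF p b(1)]] quot_exq[OF B A a(1)]
      quot_exq[OF B A qreps_meet[OF AB a(1) qreps_rei[OF p b(1)]]] quot_meet[OF A qreps_exq[OF B A a(1)] b(1)]
      frobenius[OF B A] qrepsD[OF a(1)] qrepsD[OF b(1)] a(2) b(2) by simp
next
  fix B f A A' h s
  assume a: "B \<in> Ob (base P)" "f \<in> hom (base P) A A'" "s \<in> carrier (fib quot (Prd (base P) A' B))"
    "h \<in> hom (base P) (Prd (base P) A B) (Prd (base P) A' B)"
    "Pr1 (base P) A' B \<cdot>\<^bsub>base P\<^esub> h = f \<cdot>\<^bsub>base P\<^esub> Pr1 (base P) A B"
    "Pr2 (base P) A' B \<cdot>\<^bsub>base P\<^esub> h = Pr2 (base P) A B"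
  have A: "A \<in> Ob (base P)" "A' \<in> Ob (base P)" using hom_Ob[OF a(2)] by blast+
  from a(3) obtain b V where b: "(b, V) \<in> qreps (Prd (base P) A' B)" "s = qcl (Prd (base P) A' B) b V"
    by (rule qcl_cases[OF base.Prd_Ob[OF A(2) a(1)]])
  show "exq quot B A (rei quot h s) = rei quot f (exq quot B A' s)"
    using quot_rei[OF a(4) b(1)] quot_exq[OF a(1) A(1) qreps_rei[OF a(4) b(1)]] quot_exq[OF a(1) A(2) b(1)]
      quot_rei[OF a(2) qreps_exq[OF a(1) A(2) b(1)]] beck_chevalley'[OF a(1,2) _ a(4-6)] qrepsD[OF b(1)] b(2)
    by simp
qed

text \<open>Richness has to hold only up to axioms in the original doctrine, because entailment in
  the quotient absorbs \<open>W\<close>.\<close>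

lemma quot_rich:
  assumes witness: "\<And>A a. \<lbrakk>A \<in> Ob (base P); a \<in> carrier (fib P A)\<rbrakk> \<Longrightarrow>
    \<exists>d\<in>hom (base P) (Trm (base P)) A. \<exists>W\<in>N.
      exq P A (Trm (base P)) (rei P (Pr2 (base P) (Trm (base P)) A) a) \<sqinter>\<^bsub>fib P (Trm (base P))\<^esub> ax (Trm (base P)) W
        \<sqsubseteq>\<^bsub>fib P (Trm (base P))\<^esub> rei P d a"
  shows "rich_doctrine quot"
proof (rule rich_doctrine.intro[OF quot_existential], rule rich_doctrine_axioms.intro, unfold quot_base)
  let ?t = "Trm (base P)"
  fix A s assume A: "A \<in> Ob (base P)" and s: "s \<in> carrier (fib quot A)"
  note t = base.Trm_Ob
  note p = base.Pr2_hom[OF t A]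
  from s obtain a V where a: "(a, V) \<in> qreps A" "s = qcl A a V" by (rule qcl_cases[OF A])
  obtain d where d: "d \<in> hom (base P) ?t A"
    and e: "entails ?t (exq P A ?t (rei P (Pr2 (base P) ?t A) a)) (rei P d a)"
    using witness[OF A qreps_in[OF a(1)]] by (auto simp: entails_def)
  have "exq quot A ?t (rei quot (Pr2 (base P) ?t A) s) \<sqsubseteq>\<^bsub>fib quot ?t\<^esub> rei quot d s"
    unfolding a(2) quot_rei[OF p a(1)] quot_rei[OF d a(1)] quot_exq[OF A t qreps_rei[OF p a(1)]]
      qle_iff[OF t qreps_exq[OF A t qreps_rei[OF p a(1)]] qreps_rei[OF d a(1)]] by (rule e)
  with d show "\<exists>d\<in>hom (base P) ?t A. exq quot A ?t (rei quot (Pr2 (base P) ?t A) s) \<sqsubseteq>\<^bsub>fib quot ?t\<^esub> rei quot d s"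
    by blast
qed

end


section \<open>Henkin axioms\<close>

locale henkin_extension = implicational_doctrine P + existential_doctrine P
  for P :: "('o, 'm, 'p) doctrine_data" +
  fixes ls :: "('o, 'p) listing"
  assumes admissible: "admissible_listing P ls"
begin

text \<open>Testing the adjunction at the implication itself gives modus ponens. Antisymmetry gives
  the uniqueness on which the description \<open>himp\<close> relies.\<close>

lemma
  assumes A: "A \<in> Ob (base P)" and a: "a \<in> carrier (fib P A)" and b: "b \<in> carrier (fib P A)"
  shows himp_in: "himp (fib P A) a b \<in> carrier (fib P A)"
    and meet_himp_le: "a \<sqinter>\<^bsub>fib P A\<^esub> himp (fib P A) a b \<sqsubseteq>\<^bsub>fib P A\<^esub> b"
proof -
  have "\<exists>!c. is_himp (fib P A) a b c"
  proof (rule ex_ex1I[OF himp_exists[OF assms]])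
    fix c d assume "is_himp (fib P A) a b c" "is_himp (fib P A) a b d"
    then show "c = d"
      unfolding is_himp_def using fib_antisym[OF A] fib_refl[OF A] by metis
  qed
  then have "is_himp (fib P A) a b (himp (fib P A) a b)"
    unfolding himp_def by (rule theI')
  then show "himp (fib P A) a b \<in> carrier (fib P A)" "a \<sqinter>\<^bsub>fib P A\<^esub> himp (fib P A) a b \<sqsubseteq>\<^bsub>fib P A\<^esub> b"
    unfolding is_himp_def meet_comm[of _ a] using fib_refl[OF A] by blast+
qed

lemma listing_in:
  assumes "B \<in> ob" "j \<in> Field (Lam P)" "ls B j = (\<phi>, X)"
  shows "X \<in> ctxs P \<and> \<phi> \<in> Fb (L X \<otimes> B)"
proof -
  have "ls B j \<in> el_reps P B" using admissible assms(1,2) unfolding admissible_listing_def by blast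
  then show ?thesis by (simp add: assms(3) el_reps_def)
qed

lemma
  assumes B: "B \<in> ob" and j: "j \<in> Field (Lam P)"
  shows witness_in: "witness P ls B j \<in> Field (Lam P)"
    and witness_fresh: "witness P ls B j \<notin> snd ` set (snd (ls B j))"
proof -
  interpret wo_rel "Lam P"
    unfolding Lam_def wo_rel_def by (rule card_of_Well_order)
  let ?w = "witness P ls B"
  \<comment> \<open>The set to be avoided at \<open>j\<close> consults \<open>d\<close> only
    strictly below \<open>j\<close>, so the recursion is well founded.\<close>
  have "adm_wo (\<lambda>d j. suc (witness_avoid P ls B d j))"
    unfolding adm_wo_def witness_avoid_def by (metis (no_types, lifting) image_cong)
  from worec_fixpoint[OF this] have rec: "?w j = suc (witness_avoid P ls B ?w j)"
    unfolding witness_def by metis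
  have ne: "AboveS (witness_avoid P ls B ?w j) \<noteq> {}"
    using admissible B j by (auto simp: admissible_listing_def)
  \<comment> \<open>Having a strict upper bound already confines the set to the field, so no induction on
    \<open>j\<close> is needed.\<close>
  then have "witness_avoid P ls B ?w j \<subseteq> Field (Lam P)"
    by (auto simp: Order_Relation.AboveS_def intro: FieldI1)
  from suc_AboveS[OF this ne] have w: "?w j \<in> AboveS (witness_avoid P ls B ?w j)"
    unfolding rec .
  then show "?w j \<in> Field (Lam P)" by (simp add: Order_Relation.AboveS_def)
  \<comment> \<open>The avoided labels come from all \<open>k\<close> up to and including
    \<open>j\<close>; reflexivity covers the list of \<open>j\<close> itself.\<close>
  have "j \<in> under j" using REFL j by (auto simp: Order_Relation.under_def refl_on_def)
  then have "snd ` set (snd (ls B j)) \<subseteq> witness_avoid P ls B ?w j"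
    unfolding witness_avoid_def by blast
  with w show "?w j \<notin> snd ` set (snd (ls B j))"
    by (auto simp: Order_Relation.AboveS_def)
qed

lemma star_ctx:
  assumes "B \<in> ob" "j \<in> Field (Lam P)" "ls B j = (\<phi>, X)"
  shows "X @ [(B, witness P ls B j)] \<in> ctxs P"
  using listing_in[OF assms] witness_in[OF assms(1,2)] witness_fresh[OF assms(1,2)] assms
  by (force simp: ctxs_def)

lemma
  assumes "B \<in> ob" "j \<in> Field (Lam P)" "ls B j = (\<phi>, X)"
  defines "p \<equiv> pi1 (L (X @ [(B, witness P ls B j)])) (Trm (base P))"
    and "Xs \<equiv> X @ [(B, witness P ls B j)]"
    and "e \<equiv> rei P (pi1 (L X) B) (exq P B (L X) \<phi>)"
  shows henkin_axiom_eq: "henkin_axiom P ls (B, j)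
      = el_class P (Trm (base P)) (rei P p (himp (fib P (L X \<otimes> B)) e \<phi>), Xs)"
    and henkin_axiom_in: "henkin_axiom P ls (B, j) \<in> carrier (fib U (Trm (base P)))"
proof -
  note X = listing_in[OF assms(1-3)] and Xs = star_ctx[OF assms(1-3)]
  note LX = L_ob[OF X[THEN conjunct1]]
  show eq: "henkin_axiom P ls (B, j)
      = el_class P (Trm (base P)) (rei P p (himp (fib P (L X \<otimes> B)) e \<phi>), Xs)"
    by (simp add: henkin_axiom_def henkin_formula_def assms(3) p_def Xs_def e_def Let_def)
  have "himp (fib P (L X \<otimes> B)) e \<phi> \<in> Fb (L X \<otimes> B)"
    unfolding e_def
    by (rule himp_in[OF base.Prd_Ob[OF LX assms(1)]
        rei_in[OF base.Pr1_hom[OF LX assms(1)] exq_in[OF assms(1) LX X[THEN conjunct2]]] X[THEN conjunct2]])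
  \<comment> \<open>Appending an entry of sort \<open>B\<close> makes the product of the extended
    list equal to \<open>L X \<otimes> B\<close>, so a formula over \<open>L X \<otimes> B\<close>
    can be reindexed along \<open>p\<close>.\<close>
  moreover have "p \<in> H (L Xs \<otimes> Trm (base P)) (L X \<otimes> B)"
    using base.Pr1_hom[OF L_ob[OF Xs] base.Trm_Ob] by (simp add: p_def Xs_def base.lprod_snoc)
  ultimately show "henkin_axiom P ls (B, j) \<in> carrier (fib U (Trm (base P)))"
    unfolding eq by (intro el_in[OF base.Trm_Ob] rei_in) (use Xs in \<open>simp_all add: Xs_def\<close>)
qed

lemma henkin_axioms_in:
  "V \<in> henkin_sets P \<Longrightarrow> finite (henkin_axiom P ls ` V) \<and> henkin_axiom P ls ` V \<subseteq> carrier (fib U (Trm (base P)))"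
  using henkin_axiom_in by (fastforce simp: henkin_sets_def)

text \<open>Antitonicity and the union law are properties of finite infima over the terminal object,
  transported by reindexing along the arrow to it. Stability under reindexing is uniqueness of that
  arrow.\<close>

lemma henkin_axiom_system: "axiom_system U (henkin_sets P) (axioms_at P ls)"
proof (rule axiom_system.intro[OF under_existential], rule axiom_system_axioms.intro,
    unfold under_doctrine_simps(1) under_cat_simps)
  interpret under: existential_doctrine U by (rule under_existential)
  interpret uc: fp_category "under_cat P" by (rule under_cat_fp_category)
  let ?t = "Trm (base P)" and ?b = "bang (under_cat P)"
  let ?I = "\<lambda>V. \<Sqinter>\<^bsub>fib U ?t\<^esub> (henkin_axiom P ls ` V)"
  note obj = under_doctrine_simps(1) under_cat_simps
  have t: "?t \<in> Ob (base U)" by (simp add: obj base.Trm_Ob)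
  have ax: "axioms_at P ls A V = rei U (?b A) (?I V)" for A V
    by (simp add: axioms_at_def obj)
  have b: "?b A \<in> hom (base U) A ?t" if "A \<in> ob" for A
    using uc.bang_hom[of A] that by (simp add: obj)
  have I: "?I V \<in> carrier (fib U ?t)" if "V \<in> henkin_sets P" for V
    using under.fib_Inf_in[OF t] henkin_axioms_in[OF that] by blast
  show "{} \<in> henkin_sets P" by (simp add: henkin_sets_def)
  show Un: "V \<union> W \<in> henkin_sets P" if "V \<in> henkin_sets P" "W \<in> henkin_sets P" for V W
    using that by (simp add: henkin_sets_def)
  show "axioms_at P ls A V \<in> carrier (fib U A)" if "A \<in> ob" "V \<in> henkin_sets P" for A V
    unfolding ax by (rule under.rei_in[OF b[OF that(1)] I[OF that(2)]])
  show "axioms_at P ls A W \<sqsubseteq>\<^bsub>fib U A\<^esub> axioms_at P ls A V"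
    if "A \<in> ob" "V \<in> henkin_sets P" "W \<in> henkin_sets P" "V \<subseteq> W" for A V W
  proof -
    have "?I W \<sqsubseteq>\<^bsub>fib U ?t\<^esub> ?I V"
      using henkin_axioms_in[OF that(2)] henkin_axioms_in[OF that(3)] that(4)
      by (intro under.fib_Inf_greatest[OF t] under.fib_Inf_lower[OF t] I that(3)) auto
    then show ?thesis unfolding ax by (rule under.rei_mono[OF b[OF that(1)] I[OF that(3)] I[OF that(2)]])
  qed
  show "axioms_at P ls A V \<sqinter>\<^bsub>fib U A\<^esub> axioms_at P ls A W \<sqsubseteq>\<^bsub>fib U A\<^esub> axioms_at P ls A (V \<union> W)"
    if "A \<in> ob" "V \<in> henkin_sets P" "W \<in> henkin_sets P" for A V W
  proof -
    note VW = Un[OF that(2,3)] and i = I[OF that(2)] I[OF that(3)]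
    note m = under.fib_meet_in[OF t i]
    have "?I V \<sqinter>\<^bsub>fib U ?t\<^esub> ?I W \<sqsubseteq>\<^bsub>fib U ?t\<^esub> s" if s: "s \<in> henkin_axiom P ls ` (V \<union> W)" for s
    proof -
      have sin: "s \<in> carrier (fib U ?t)" using henkin_axioms_in[OF VW] s by blast
      consider "s \<in> henkin_axiom P ls ` V" | "s \<in> henkin_axiom P ls ` W" using s by blast
      then show ?thesis
      proof cases
        case 1
        then have "?I V \<sqsubseteq>\<^bsub>fib U ?t\<^esub> s"
          using under.fib_Inf_lower[OF t] henkin_axioms_in[OF \<open>V \<in> henkin_sets P\<close>] by blast
        from under.fib_trans[OF t under.fib_meet_left[OF t i] this m i(1) sin] show ?thesis .
      next
        case 2
        then have "?I W \<sqsubseteq>\<^bsub>fib U ?t\<^esub> s"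
          using under.fib_Inf_lower[OF t] henkin_axioms_in[OF \<open>W \<in> henkin_sets P\<close>] by blast
        from under.fib_trans[OF t under.fib_meet_right[OF t i] this m i(2) sin] show ?thesis .
      qed
    qed
    then have "?I V \<sqinter>\<^bsub>fib U ?t\<^esub> ?I W \<sqsubseteq>\<^bsub>fib U ?t\<^esub> ?I (V \<union> W)"
      using under.fib_Inf_greatest[OF t _ _ m] henkin_axioms_in[OF VW] by blast
    from under.rei_mono[OF b[OF that(1)] m I[OF VW] this] show ?thesis
      unfolding ax under.rei_meet[OF b[OF that(1)] i] .
  qed
  show "rei U F (axioms_at P ls B V) = axioms_at P ls A V"
    if F: "F \<in> hom (under_cat P) A B" and V: "V \<in> henkin_sets P" for F A B V
  proof -
    have A: "A \<in> ob" "B \<in> ob" using hom_under_ob[OF F] by blast+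
    have bF: "Cmp (under_cat P) (?b B) F \<in> hom (under_cat P) A (Trm (under_cat P))"
      using uc.Cmp_hom[OF F] b[OF A(2)] by (simp add: obj)
    have "Cmp (under_cat P) (?b B) F = ?b A"
      by (rule uc.to_Trm_eq[OF bF]) (use b[OF A(1)] in \<open>simp add: obj\<close>)
    moreover have "F \<in> hom (base U) A B" using F by (simp add: obj)
    ultimately show ?thesis
      unfolding ax using under.rei_Cmp[OF _ b[OF A(2)] I[OF V], of F A] by (simp add: obj)
  qed
qed

text \<open>The abstract quotient was set up with the same relations, so the two records agree
  component by component.\<close>

lemma arrow_doctrine_eq: "arrow_doctrine P ls = axiom_system.quot U (henkin_sets P) (axioms_at P ls)"
proof -
  interpret ax: axiom_system U "henkin_sets P" "axioms_at P ls" by (rule henkin_axiom_system)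
  have reps: "arrow_reps P ls A = ax.qreps A" for A by (auto simp: arrow_reps_def ax.qreps_def)
  have rel: "arrow_rel P ls A = ax.qrel A" for A by (simp add: arrow_rel_def ax.qrel_def reps)
  have le: "arrow_le P ls A = ax.qle A" for A by (intro ext) (simp add: arrow_le_def ax.qle_def)
  have rei: "arrow_rei P ls = ax.qrei"
    by (intro ext) (simp add: arrow_rei_def ax.qrei_def rel under_doctrine_simps(1))
  show ?thesis by (simp add: arrow_doctrine_def ax.quot_def reps rel le rei under_doctrine_simps(1))
qed

text \<open>The quantifier with constants only has to skip the factor \<open>t\<close>: the
  reassociated context maps to \<open>L X \<otimes> A\<close> along \<open>?h\<close>, and
  Beck-Chevalley for the projection from \<open>L X \<otimes> t\<close> moves the quantifier past
  it.\<close>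

lemma exq_under_Trm:
  assumes A: "A \<in> ob" and X: "X \<in> ctxs P" and \<phi>: "\<phi> \<in> Fb (L X \<otimes> A)"
  defines "t \<equiv> Trm (base P)"
  shows "exq U A t (rei U (Pr2 (under_cat P) t A) (el_class P A (\<phi>, X)))
    = el_class P t (rei P (pi1 (L X) t) (exq P A (L X) \<phi>), X)"
proof -
  have t: "t \<in> ob" unfolding t_def by (rule base.Trm_Ob)
  note LX = L_ob[OF X] and tA = base.Prd_Ob[OF t A]
  let ?q = "pi2 t A \<odot> pi2 (L X) (t \<otimes> A)" and ?h = "pr (pi1 (L X) t \<odot> pi1 (L X \<otimes> t) A) (pi2 (L X \<otimes> t) A)"
  have q: "?q \<in> H (L X \<otimes> (t \<otimes> A)) A" using t A tA LX by (simp add: base.hom_iff base.products)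
  note k = kext_hom[OF X tA q]
  have h: "?h \<in> H ((L X \<otimes> t) \<otimes> A) (L X \<otimes> A)" "pi1 (L X) A \<odot> ?h = pi1 (L X) t \<odot> pi1 (L X \<otimes> t) A"
    "pi2 (L X) A \<odot> ?h = pi2 (L X \<otimes> t) A"
    using t A LX by (simp_all add: base.hom_iff base.products)
  have "kext X (t \<otimes> A) ?q \<odot> asc (L X) t A = ?h"
    using t A tA LX by (simp add: kext_def asc_def base.products)
  then have "uex X A t (rei P (kext X (t \<otimes> A) ?q) \<phi>) = rei P (pi1 (L X) t) (exq P A (L X) \<phi>)"
    unfolding uex_def
    using rei_Cmp[OF asc_hom[OF LX t A] k \<phi>] beck_chevalley'[OF A base.Pr1_hom[OF LX t] \<phi> h] by simp
  then show ?thesis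
    using under_rei_germ[OF tA X q \<phi>] exq_under[OF t A X rei_in[OF k \<phi>]]
    by (simp add: Pr2_under[OF t A X])
qed

text \<open>All three elements are rewritten over the extended list as reindexings along the single
  projection \<open>?p\<close> from \<open>(L X \<otimes> A) \<otimes> t\<close>; the claim then
  becomes modus ponens in the fibre over \<open>L X \<otimes> A\<close>.\<close>

lemma henkin_witness:
  assumes A: "A \<in> ob" and j: "j \<in> Field (Lam P)" and lsj: "ls A j = (\<phi>, X)"
  defines "t \<equiv> Trm (base P)" and "a \<equiv> el_class P A (\<phi>, X)"
  shows "\<exists>d\<in>hom (under_cat P) t A.
    exq U A t (rei U (Pr2 (under_cat P) t A) a) \<sqinter>\<^bsub>fib U t\<^esub> henkin_axiom P ls (A, j) \<sqsubseteq>\<^bsub>fib U t\<^esub> rei U d a"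
proof -
  let ?e = "(A, witness P ls A j)" and ?Xs = "X @ [(A, witness P ls A j)]"
  have X: "X \<in> ctxs P" and \<phi>: "\<phi> \<in> Fb (L X \<otimes> A)" using listing_in[OF A j lsj] by blast+
  have t: "t \<in> ob" unfolding t_def by (rule base.Trm_Ob)
  have Xs: "?Xs \<in> ctxs P" "set X \<subseteq> set ?Xs" using star_ctx[OF A j lsj] by auto
  have LXs: "L ?Xs = L X \<otimes> A" by (simp add: base.lprod_snoc)
  note LX = L_ob[OF X] and LXA = base.Prd_Ob[OF L_ob[OF X] A]
  let ?p = "pi1 (L X \<otimes> A) t" and ?E = "exq P A (L X) \<phi>"
  let ?e = "rei P (pi1 (L X) A) ?E"
  let ?H = "himp (fib P (L X \<otimes> A)) ?e \<phi>"
  have p: "?p \<in> H (L ?Xs \<otimes> t) (L X \<otimes> A)" unfolding LXs by (rule base.Pr1_hom[OF LXA t])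
  note E = exq_in[OF A LX \<phi>]
  note e = rei_in[OF base.Pr1_hom[OF LX A] E]
  note Hin = himp_in[OF LXA e \<phi>]
  have c: "ctx_proj (base P) ?Xs X = pi1 (L X) A"
    using base.ctx_proj_snoc_self[of X "(A, witness P ls A j)"] ctxsD[OF Xs(1)] by simp
  have wk: "wk B ?Xs X = pr (pi1 (L X) A \<odot> pi1 (L X \<otimes> A) B) (pi2 (L X \<otimes> A) B)" if "B \<in> ob" for B
    using weak_eq[OF X Xs that] by (simp add: c LXs)

  \<comment> \<open>Weakening the existential formula to the extended list means forgetting the new
    constant, that is, projecting along \<open>pi1 (L X) A\<close>.\<close>
  have "pi1 (L X) t \<odot> wk t ?Xs X = pi1 (L X) A \<odot> ?p"
    unfolding wk[OF t] using A t LX LXA by (simp add: base.products)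
  then have "rei P (wk t ?Xs X) (rei P (pi1 (L X) t) ?E) = rei P ?p ?e"
    using rei_Cmp[OF weak_hom[OF X Xs t] base.Pr1_hom[OF LX t] E] rei_Cmp[OF p base.Pr1_hom[OF LX A] E] by simp
  then have ex: "exq U A t (rei U (Pr2 (under_cat P) t A) a) = el_class P t (rei P ?p ?e, ?Xs)"
    unfolding a_def t_def[symmetric] exq_under_Trm[OF A X \<phi>, folded t_def]
    using el_weak[OF t X rei_in[OF base.Pr1_hom[OF LX t] E] Xs] by simp

  \<comment> \<open>The new constant: the projection to the factor of the appended entry.\<close>
  let ?d = "pi2 (L X) A \<odot> ?p"
  have d: "?d \<in> H (L ?Xs \<otimes> t) A" using base.Cmp_hom[OF p base.Pr2_hom[OF LX A]] .
  \<comment> \<open>Substituting the new constant for the variable of sort \<open>A\<close> gives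
    back the factor that weakening drops; what remains is \<phi> in its own context, reindexed along
    \<open>?p\<close>.\<close>
  have "wk A ?Xs X \<odot> kext ?Xs t ?d = ?p"
    unfolding wk[OF A] kext_def LXs using A t LX LXA by (simp add: base.products)
  then have "rei P (kext ?Xs t ?d) (rei P (wk A ?Xs X) \<phi>) = rei P ?p \<phi>"
    using rei_Cmp[OF kext_hom[OF Xs(1) t d] weak_hom[OF X Xs A] \<phi>] by simp
  then have da: "rei U (germ t A ?d ?Xs) a = el_class P t (rei P ?p \<phi>, ?Xs)"
    using under_rei_germ[OF t Xs(1) d rei_weak_in[OF X Xs A \<phi>]] el_weak[OF A X \<phi> Xs] by (simp add: a_def)

  have "henkin_axiom P ls (A, j) = el_class P t (rei P ?p ?H, ?Xs)"
    using henkin_axiom_eq[OF A j lsj] by (simp add: LXs t_def)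
  then have "exq U A t (rei U (Pr2 (under_cat P) t A) a) \<sqinter>\<^bsub>fib U t\<^esub> henkin_axiom P ls (A, j)
      = el_class P t (rei P ?p (?e \<sqinter>\<^bsub>fib P (L X \<otimes> A)\<^esub> ?H), ?Xs)"
    using el_meet[OF t Xs(1) rei_in[OF p e] rei_in[OF p Hin]] rei_meet[OF p e Hin] ex by simp
  moreover note m = fib_meet_in[OF LXA e Hin]
  have "el_class P t (rei P ?p (?e \<sqinter>\<^bsub>fib P (L X \<otimes> A)\<^esub> ?H), ?Xs)
      \<sqsubseteq>\<^bsub>fib U t\<^esub> el_class P t (rei P ?p \<phi>, ?Xs)"
    by (rule el_mono[OF t Xs(1) rei_in[OF p m] rei_in[OF p \<phi>] rei_mono[OF p m \<phi> meet_himp_le[OF LXA e \<phi>]]])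
  ultimately show ?thesis
    using germ_hom[OF t A Xs(1) d] da by (intro bexI[of _ "germ t A ?d ?Xs"]) simp_all
qed

lemma arrow_doctrine_rich: "rich_doctrine (arrow_doctrine P ls)"
  unfolding arrow_doctrine_eq
proof (rule axiom_system.quot_rich[OF henkin_axiom_system], unfold under_doctrine_simps(1) under_cat_simps)
  interpret under: existential_doctrine U by (rule under_existential)
  interpret uc: fp_category "under_cat P" by (rule under_cat_fp_category)
  let ?t = "Trm (base P)"
  note obj = under_doctrine_simps(1) under_cat_simps
  fix A a assume A: "A \<in> ob" and a: "a \<in> carrier (fib U A)"
  have t: "?t \<in> Ob (base U)" by (simp add: obj base.Trm_Ob)
  \<comment> \<open>Every element occurs in the listing, and its index selects the axiom to be
    used.\<close>
  obtain j where j: "j \<in> Field (Lam P)" "a = el_class P A (ls A j)"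
    using admissible A a unfolding admissible_listing_def by blast
  obtain \<phi> X where lsj: "ls A j = (\<phi>, X)" by fastforce
  let ?h = "henkin_axiom P ls (A, j)" and ?x = "exq U A ?t (rei U (Pr2 (under_cat P) ?t A) a)"
  obtain d where d: "d \<in> hom (under_cat P) ?t A" and le: "?x \<sqinter>\<^bsub>fib U ?t\<^esub> ?h \<sqsubseteq>\<^bsub>fib U ?t\<^esub> rei U d a"
    using henkin_witness[OF A j(1) lsj] j(2) lsj by auto
  have W: "{(A, j)} \<in> henkin_sets P" using A j by (simp add: henkin_sets_def)
  have h: "?h \<in> carrier (fib U ?t)" using henkin_axioms_in[OF W] by simp
  let ?I = "\<Sqinter>\<^bsub>fib U ?t\<^esub> {?h}"
  have I: "?I \<in> carrier (fib U ?t)" "?I \<sqsubseteq>\<^bsub>fib U ?t\<^esub> ?h"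
    using under.fib_Inf_in[OF t] under.fib_Inf_lower[OF t] h by auto
  \<comment> \<open>Over the terminal object the arrow to it is the identity, so
    \<open>axioms_at\<close> is the infimum of the axioms itself.\<close>
  have "bang (under_cat P) ?t = Idt (under_cat P) ?t"
    using uc.to_Trm_eq[OF uc.bang_hom uc.Idt_hom, OF uc.Trm_Ob uc.Trm_Ob] by (simp add: obj)
  then have ax: "axioms_at P ls ?t {(A, j)} = ?I"
    using under.rei_Idt[OF t I(1)] by (simp add: axioms_at_def obj)
  have da: "rei U d a \<in> carrier (fib U ?t)"
    using under.rei_in[of d ?t A] d a by (simp add: obj)
  have "Pr2 (under_cat P) ?t A \<in> hom (base U) (Prd (base U) ?t A) A"
    using uc.Pr2_hom[of ?t A] A base.Trm_Ob by (simp add: obj)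
  then have "rei U (Pr2 (under_cat P) ?t A) a \<in> carrier (fib U (Prd (base U) ?t A))"
    using a by (rule under.rei_in)
  then have x: "?x \<in> carrier (fib U ?t)"
    using under.exq_in[of A ?t] A t by (simp add: obj)
  note m = under.fib_meet_in[OF t x I(1)] and mh = under.fib_meet_in[OF t x h]
  have "?x \<sqinter>\<^bsub>fib U ?t\<^esub> ?I \<sqsubseteq>\<^bsub>fib U ?t\<^esub> ?x \<sqinter>\<^bsub>fib U ?t\<^esub> ?h"
    by (rule under.le_fib_meet[OF t under.fib_meet_left[OF t x I(1)]
        under.fib_trans[OF t under.fib_meet_right[OF t x I(1)] I(2) m I(1) h] x h m])
  from under.fib_trans[OF t this le m mh da]
  have "?x \<sqinter>\<^bsub>fib U ?t\<^esub> axioms_at P ls ?t {(A, j)} \<sqsubseteq>\<^bsub>fib U ?t\<^esub> rei U d a"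
    unfolding ax .
  with d W show "\<exists>d\<in>hom (under_cat P) ?t A. \<exists>W\<in>henkin_sets P.
      ?x \<sqinter>\<^bsub>fib U ?t\<^esub> axioms_at P ls ?t W \<sqsubseteq>\<^bsub>fib U ?t\<^esub> rei U d a" by blast
qed

end

theorem theorem3p11:
  fixes P :: "('o, 'm, 'p) doctrine_data"
    and ls :: "('o, 'p) listing"
  assumes "implicational_doctrine P" and "existential_doctrine P"
    and "admissible_listing P ls"
  shows "rich_doctrine (arrow_doctrine P ls)"
proof -
  interpret henkin_extension P ls
    using assms by (simp add: henkin_extension_def henkin_extension_axioms_def)
  show ?thesis by (rule arrow_doctrine_rich)
qed

end
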